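(* Let $\mathbb{G}$ be a Carnot group possessing a non-zero non-abnormal horizontal direction and assume that $N\trianglelefteq\mathbb{G}$ is a normal subgroup of $\mathbb{G}$. Then the Carnot group $\mathbb{G}/N$ possesses a non-zero non-abnormal horizontal direction.
   Context: A Carnot group $\mathbb{G}$ of step $s\in\mathbb{N}$ is a connected and simply connected Lie group whose Lie algebra $\mathfrak{g}$ is stratified into $s$ layers: $\mathfrak{g}=\mathfrak{g}_1\oplus\dots\oplus\mathfrak{g}_s$ with $[\mathfrak{g}_1,\mathfrak{g}_i]=\mathfrak{g}_{i+1}$ for $1\le i\le s-1$, $\mathfrak{g}_s\ne\{0\}$, and $[\mathfrak{g}_1,\mathfrak{g}_s]=\{0\}$. The horizontal layer is $\mathfrak{g}_1$, and horizontal directions are its elements. The end-point map $\mathrm{End}:L^\infty([0,1];\mathfrak{g}_1)\to\mathbb{G}$ is defined by $\mathrm{End}(h)=\gamma(1)$, where $\gamma:[0,1]\to\mathbb{G}$ is the horizontal curve that is the unique solution of $\dot\gamma(t)=h(t)$ (with $h(t)$ viewed as a left-invariant vector field evaluated at $\gamma(t)$), $\gamma(0)=0$, where $0$ denotes the identity element of $\mathbb{G}$. A horizontal curve $\gamma:[0,1]\to\mathbb{G}$ is non-abnormal if the differential of $\mathrm{End}$ at the control $h$ of $\gamma$ has full rank. A horizontal direction $X\in\mathfrak{g}_1\setminus\{0\}$ is non-abnormal if the curve $t\mapsto\exp(tX)$, $t\in[0,1]$, is non-abnormal. The same definitions are used for the Carnot group $\mathbb{G}/N$. *)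

theory Defs
  imports
    "HOL-Analysis.Analysis"
    "HOL-Algebra.Coset"
    "HOL-Probability.Essential_Supremum"
begin

section \<open>Smooth manifolds\<close>

text \<open>In finite dimension, \<open>f\<close> is of class \<open>C\<^sup>k\<^sup>+\<^sup>1\<close> on an open set iff it is
  differentiable there and all its directional derivatives are of class \<open>C\<^sup>k\<close>.\<close>

primrec Ck_on :: "nat \<Rightarrow> 'e::real_normed_vector set \<Rightarrow> ('e \<Rightarrow> 'f::real_normed_vector) \<Rightarrow> bool" where
  "Ck_on 0 = (\<lambda>S f. continuous_on S f)"
| "Ck_on (Suc k) = (\<lambda>S f. \<exists>f'. (\<forall>x\<in>S. (f has_derivative f' x) (at x)) \<and>
                                (\<forall>v. Ck_on k S (\<lambda>x. f' x v)))"

definition smooth_on :: "'e::real_normed_vector set \<Rightarrow> ('e \<Rightarrow> 'f::real_normed_vector) \<Rightarrow> bool" where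
  "smooth_on S f \<longleftrightarrow> (\<forall>k. Ck_on k S f)"

text \<open>A chart is a pair (domain, coordinate map); the coordinate map is only relevant on
  the domain.\<close>

type_synonym ('a, 'e) chart = "'a set \<times> ('a \<Rightarrow> 'e)"

record ('a, 'e) manifold =
  mtop :: "'a topology"
  charts :: "('a, 'e) chart set"

abbreviation chart_inv :: "('a, 'e) chart \<Rightarrow> 'e \<Rightarrow> 'a" where
  "chart_inv c \<equiv> inv_into (fst c) (snd c)"

definition in_charts :: "('a, 'e) chart \<Rightarrow> ('b, 'f) chart \<Rightarrow> ('a \<Rightarrow> 'b) \<Rightarrow> 'e \<Rightarrow> 'f" where
  "in_charts c d f = snd d \<circ> f \<circ> chart_inv c"

definition smooth_manifold :: "('a, 'e::euclidean_space) manifold \<Rightarrow> bool" where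
  "smooth_manifold M \<longleftrightarrow>
     Hausdorff_space (mtop M) \<and>
     (\<exists>\<B>. countable \<B> \<and> (\<forall>B\<in>\<B>. openin (mtop M) B) \<and>
          (\<forall>U x. openin (mtop M) U \<and> x \<in> U \<longrightarrow> (\<exists>B\<in>\<B>. x \<in> B \<and> B \<subseteq> U))) \<and>
     (\<forall>c\<in>charts M. openin (mtop M) (fst c) \<and> open (snd c ` fst c) \<and>
          homeomorphic_map (subtopology (mtop M) (fst c)) (top_of_set (snd c ` fst c)) (snd c)) \<and>
     (\<Union>c\<in>charts M. fst c) = topspace (mtop M) \<and>
     (\<forall>c\<in>charts M. \<forall>d\<in>charts M. smooth_on (snd c ` (fst c \<inter> fst d)) (in_charts c d id))"

definition product_manifold ::
    "('a, 'e) manifold \<Rightarrow> ('b, 'f) manifold \<Rightarrow> ('a \<times> 'b, 'e \<times> 'f) manifold" where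
  "product_manifold M N =
     \<lparr>mtop = prod_topology (mtop M) (mtop N),
      charts = {(fst c \<times> fst d, map_prod (snd c) (snd d)) | c d. c \<in> charts M \<and> d \<in> charts N}\<rparr>"

definition smooth_map ::
    "('a, 'e::euclidean_space) manifold \<Rightarrow> ('b, 'f::euclidean_space) manifold \<Rightarrow> ('a \<Rightarrow> 'b) \<Rightarrow> bool" where
  "smooth_map M N f \<longleftrightarrow>
     continuous_map (mtop M) (mtop N) f \<and>
     (\<forall>c\<in>charts M. \<forall>d\<in>charts N.
        smooth_on (snd c ` {p \<in> fst c. f p \<in> fst d}) (in_charts c d f))"

text \<open>The differential of \<open>f\<close> at \<open>p\<close>, in the coordinates given by \<open>c\<close> (around \<open>p\<close>)
  and \<open>d\<close> (around \<open>f p\<close>).\<close>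

definition tangent_map ::
    "('a, 'e::euclidean_space) chart \<Rightarrow> ('b, 'f::euclidean_space) chart \<Rightarrow> ('a \<Rightarrow> 'b) \<Rightarrow> 'a \<Rightarrow> 'e \<Rightarrow> 'f" where
  "tangent_map c d f p = frechet_derivative (in_charts c d f) (at (snd c p))"

definition smooth_submersion ::
    "('a, 'e::euclidean_space) manifold \<Rightarrow> ('b, 'f::euclidean_space) manifold \<Rightarrow> ('a \<Rightarrow> 'b) \<Rightarrow> bool" where
  "smooth_submersion M N f \<longleftrightarrow>
     smooth_map M N f \<and>
     (\<forall>c\<in>charts M. \<forall>d\<in>charts N. \<forall>p\<in>fst c. f p \<in> fst d \<longrightarrow> surj (tangent_map c d f p))"

definition simply_connected_space :: "'a topology \<Rightarrow> bool" where
  "simply_connected_space T \<longleftrightarrow>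
     path_connected_space T \<and>
     (\<forall>g. pathin T g \<and> g 1 = g 0 \<longrightarrow>
        (\<exists>a\<in>topspace T. homotopic_with (\<lambda>h. h 1 = h 0) (top_of_set {0..1}) T g (\<lambda>_. a)))"


section \<open>Lie groups\<close>

definition lie_group :: "('a, 'z) monoid_scheme \<Rightarrow> ('a, 'e::euclidean_space) manifold \<Rightarrow> bool" where
  "lie_group G M \<longleftrightarrow>
     group G \<and> smooth_manifold M \<and> topspace (mtop M) = carrier G \<and>
     smooth_map (product_manifold M M) M (\<lambda>(x, y). x \<otimes>\<^bsub>G\<^esub> y) \<and>
     smooth_map M M (\<lambda>x. inv\<^bsub>G\<^esub> x)"

text \<open>The Lie algebra is the tangent space at the identity. It is identified with the model
  space \<open>'e\<close> through a chart around the identity, chosen once and for all; another choice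
  changes everything below by a linear isomorphism of \<open>'e\<close>.\<close>

definition id_chart :: "('a, 'z) monoid_scheme \<Rightarrow> ('a, 'e) manifold \<Rightarrow> ('a, 'e) chart" where
  "id_chart G M = (SOME c. c \<in> charts M \<and> \<one>\<^bsub>G\<^esub> \<in> fst c)"

text \<open>The value at \<open>p\<close>, in the coordinates of the chart \<open>c\<close> around \<open>p\<close>, of the left-invariant
  vector field that takes the value \<open>v\<close> at the identity.\<close>

definition left_inv_field ::
    "('a, 'z) monoid_scheme \<Rightarrow> ('a, 'e::euclidean_space) manifold \<Rightarrow> ('a, 'e) chart \<Rightarrow> 'e \<Rightarrow> 'a \<Rightarrow> 'e" where
  "left_inv_field G M c v p = tangent_map (id_chart G M) c (\<lambda>q. p \<otimes>\<^bsub>G\<^esub> q) \<one>\<^bsub>G\<^esub> v"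

definition vf_bracket :: "('e::real_normed_vector \<Rightarrow> 'e) \<Rightarrow> ('e \<Rightarrow> 'e) \<Rightarrow> 'e \<Rightarrow> 'e" where
  "vf_bracket X Y x = frechet_derivative Y (at x) (X x) - frechet_derivative X (at x) (Y x)"

definition lie_bracket ::
    "('a, 'z) monoid_scheme \<Rightarrow> ('a, 'e::euclidean_space) manifold \<Rightarrow> 'e \<Rightarrow> 'e \<Rightarrow> 'e" where
  "lie_bracket G M v w =
     (let c = id_chart G M;
          field = (\<lambda>u x. left_inv_field G M c u (chart_inv c x))
      in vf_bracket (field v) (field w) (snd c \<one>\<^bsub>G\<^esub>))"

definition lie_exp :: "('a, 'z) monoid_scheme \<Rightarrow> ('a, 'e::euclidean_space) manifold \<Rightarrow> 'e \<Rightarrow> 'a" where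
  "lie_exp G M v =
     (THE p. \<exists>\<gamma>. continuous_map euclideanreal (mtop M) \<gamma> \<and> \<gamma> 0 = \<one>\<^bsub>G\<^esub> \<and> \<gamma> 1 = p \<and>
        (\<forall>t. \<forall>c\<in>charts M. \<gamma> t \<in> fst c \<longrightarrow>
           ((snd c \<circ> \<gamma>) has_vector_derivative left_inv_field G M c v (\<gamma> t)) (at t)))"

text \<open>The Lie group structure on \<open>G/N\<close>, when it exists, is the unique one for which the
  projection is a smooth submersion; its topology is the quotient topology.\<close>

definition quotient_lie_group ::
    "('a, 'z) monoid_scheme \<Rightarrow> ('a, 'e::euclidean_space) manifold \<Rightarrow> 'a set \<Rightarrow>
     ('a set, 'f::euclidean_space) manifold \<Rightarrow> bool" where
  "quotient_lie_group G M N Q \<longleftrightarrow>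
     lie_group (G Mod N) Q \<and> smooth_submersion M Q (\<lambda>x. N #>\<^bsub>G\<^esub> x)"


section \<open>Carnot groups\<close>

definition stratification :: "('e::real_vector \<Rightarrow> 'e \<Rightarrow> 'e) \<Rightarrow> (nat \<Rightarrow> 'e set) \<Rightarrow> nat \<Rightarrow> bool" where
  "stratification br V s \<longleftrightarrow>
     1 \<le> s \<and>
     (\<forall>i\<in>{1..s}. subspace (V i)) \<and>
     span (\<Union>i\<in>{1..s}. V i) = UNIV \<and>
     (\<forall>x. (\<forall>i\<in>{1..s}. x i \<in> V i) \<and> (\<Sum>i=1..s. x i) = 0 \<longrightarrow> (\<forall>i\<in>{1..s}. x i = 0)) \<and>
     (\<forall>i\<in>{1..<s}. span {br x y | x y. x \<in> V 1 \<and> y \<in> V i} = V (Suc i)) \<and>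
     V s \<noteq> {0} \<and>
     (\<forall>x\<in>V 1. \<forall>y\<in>V s. br x y = 0)"

definition carnot_group ::
    "('a, 'z) monoid_scheme \<Rightarrow> ('a, 'e::euclidean_space) manifold \<Rightarrow> (nat \<Rightarrow> 'e set) \<Rightarrow> nat \<Rightarrow> bool" where
  "carnot_group G M V s \<longleftrightarrow>
     lie_group G M \<and> connected_space (mtop M) \<and> simply_connected_space (mtop M) \<and>
     stratification (lie_bracket G M) V s"


section \<open>The end-point map and non-abnormal directions\<close>

text \<open>Elements of \<open>L\<^sup>\<infinity>([0,1]; W)\<close> are represented by functions; two functions that agree
  almost everywhere on \<open>[0,1]\<close> represent the same element.\<close>

definition linf_esssup :: "(real \<Rightarrow> 'e::euclidean_space) \<Rightarrow> ereal" where
  "linf_esssup h = esssup (lebesgue_on {0..1}) (\<lambda>t. ereal (norm (h t)))"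

definition linf :: "'e::euclidean_space set \<Rightarrow> (real \<Rightarrow> 'e) set" where
  "linf W = {h. h \<in> borel_measurable (lebesgue_on {0..1}) \<and>
                (\<forall>t\<in>{0..1}. h t \<in> W) \<and> linf_esssup h < \<infinity>}"

definition linf_norm :: "(real \<Rightarrow> 'e::euclidean_space) \<Rightarrow> real" where
  "linf_norm h = real_of_ereal (linf_esssup h)"

text \<open>\<open>\<gamma>\<close> starts at the identity and solves \<open>\<gamma>'(t) = h(t)\<close> on \<open>[0,1]\<close>, where \<open>h(t)\<close> is
  viewed as a left-invariant vector field at \<open>\<gamma>(t)\<close>. As \<open>h\<close> is merely measurable and essentially
  bounded, this means that in every chart \<open>\<gamma>\<close> is absolutely continuous with the prescribed
  derivative almost everywhere, i.e. that it satisfies the integrated equation.\<close>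

definition curve_with_control ::
    "('a, 'z) monoid_scheme \<Rightarrow> ('a, 'e::euclidean_space) manifold \<Rightarrow> (real \<Rightarrow> 'e) \<Rightarrow> (real \<Rightarrow> 'a) \<Rightarrow> bool" where
  "curve_with_control G M h \<gamma> \<longleftrightarrow>
     continuous_map (top_of_set {0..1}) (mtop M) \<gamma> \<and> \<gamma> 0 = \<one>\<^bsub>G\<^esub> \<and>
     (\<forall>c\<in>charts M. \<forall>a b. 0 \<le> a \<and> a \<le> b \<and> b \<le> 1 \<and> \<gamma> ` {a..b} \<subseteq> fst c \<longrightarrow>
        ((\<lambda>t. left_inv_field G M c (h t) (\<gamma> t)) has_integral
           (snd c (\<gamma> b) - snd c (\<gamma> a))) {a..b})"

definition end_point :: "('a, 'z) monoid_scheme \<Rightarrow> ('a, 'e::euclidean_space) manifold \<Rightarrow> (real \<Rightarrow> 'e) \<Rightarrow> 'a" where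
  "end_point G M h = (THE p. \<exists>\<gamma>. curve_with_control G M h \<gamma> \<and> \<gamma> 1 = p)"

text \<open>\<open>D\<close> is the Frechet differential at \<open>h\<close> of the end-point map on \<open>L\<^sup>\<infinity>([0,1]; W)\<close>,
  read in a chart \<open>c\<close> around the end point. Boundedness makes \<open>D\<close> well defined on
  almost-everywhere classes.\<close>

definition end_differential ::
    "('a, 'z) monoid_scheme \<Rightarrow> ('a, 'e::euclidean_space) manifold \<Rightarrow> 'e set \<Rightarrow> (real \<Rightarrow> 'e) \<Rightarrow>
     ('a, 'e) chart \<Rightarrow> ((real \<Rightarrow> 'e) \<Rightarrow> 'e) \<Rightarrow> bool" where
  "end_differential G M W h c D \<longleftrightarrow>
     (\<forall>k\<in>linf W. \<forall>l\<in>linf W. D (\<lambda>t. k t + l t) = D k + D l) \<and>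
     (\<forall>k\<in>linf W. \<forall>a. D (\<lambda>t. a *\<^sub>R k t) = a *\<^sub>R D k) \<and>
     (\<exists>C. \<forall>k\<in>linf W. norm (D k) \<le> C * linf_norm k) \<and>
     (\<forall>\<epsilon>>0. \<exists>\<delta>>0. \<forall>k\<in>linf W. linf_norm k < \<delta> \<longrightarrow>
        end_point G M (\<lambda>t. h t + k t) \<in> fst c \<and>
        norm (snd c (end_point G M (\<lambda>t. h t + k t)) - snd c (end_point G M h) - D k)
          \<le> \<epsilon> * linf_norm k)"

definition end_full_rank ::
    "('a, 'z) monoid_scheme \<Rightarrow> ('a, 'e::euclidean_space) manifold \<Rightarrow> 'e set \<Rightarrow> (real \<Rightarrow> 'e) \<Rightarrow> bool" where
  "end_full_rank G M W h \<longleftrightarrow>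
     (\<exists>c\<in>charts M. end_point G M h \<in> fst c \<and>
        (\<exists>D. end_differential G M W h c D \<and> D ` linf W = UNIV))"

definition nonabnormal_curve ::
    "('a, 'z) monoid_scheme \<Rightarrow> ('a, 'e::euclidean_space) manifold \<Rightarrow> 'e set \<Rightarrow> (real \<Rightarrow> 'a) \<Rightarrow> bool" where
  "nonabnormal_curve G M W \<gamma> \<longleftrightarrow>
     (\<exists>h\<in>linf W. curve_with_control G M h \<gamma> \<and> end_full_rank G M W h)"

definition nonabnormal_direction ::
    "('a, 'z) monoid_scheme \<Rightarrow> ('a, 'e::euclidean_space) manifold \<Rightarrow> 'e set \<Rightarrow> 'e \<Rightarrow> bool" where
  "nonabnormal_direction G M W X \<longleftrightarrow>
     X \<in> W \<and> X \<noteq> 0 \<and> nonabnormal_curve G M W (\<lambda>t. lie_exp G M (t *\<^sub>R X))"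

end

theory Submission
  imports Defs
begin

text \<open>Let \<open>H\<close> be a Lipschitz function on an interval. A curve \<open>\<gamma>\<close> solves \<open>\<gamma>' = H'\<close> iff, at every time \<open>t\<close>, the increment
  \<open>\<gamma>(t)\<^sup>-\<^sup>1 \<gamma>(s)\<close>, read in a chart, equals \<open>H(s) - H(t)\<close> up to \<open>o(s - t)\<close>. In this form products of curves
  are easy to differentiate: if \<open>\<eta>\<close> has the control \<open>Ad(exp tX) k(t)\<close>, then \<open>\<eta>(t) exp(tX)\<close> has the control
  \<open>X + k(t)\<close>. So the end-point map near the constant control \<open>X\<close> reduces to small controls, where it is
  \<open>k \<mapsto> \<integral> k\<close> up to a quadratic error, and its differential at \<open>X\<close> is \<open>k \<mapsto> \<integral> Ad(exp tX) k(t) dt\<close> up to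
  a right translation. Consequently \<open>X\<close> is non-abnormal iff the spaces \<open>ad_X\<^sup>j V\<^sub>1\<close> span the Lie algebra, which
  by the grading says that \<open>ad_X : V\<^sub>k \<rightarrow> V\<^sub>k\<^sub>+\<^sub>1\<close> is onto for every \<open>k\<close>. The differential of the projection is
  an epimorphism of Lie algebras. It need not respect the layers, but it respects the lower central series, on
  whose graded quotients the \<open>W\<^sub>1\<close>-component \<open>Y\<close> of the image of \<open>X\<close> acts as that image does; so \<open>ad_Y\<close> is
  onto from \<open>W\<^sub>k\<close> to \<open>W\<^sub>k\<^sub>+\<^sub>1\<close>. If \<open>Y = 0\<close>, then \<open>G/N\<close> is abelian and every direction is
  non-abnormal.\<close>

section \<open>Essentially bounded controls\<close>

text \<open>Controls are only measurable, so \<open>\<gamma>' = h\<close> holds merely almost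
  everywhere, and exceptional null sets would have to be carried through every group operation.
  Passing to the primitive \<open>H\<close> removes them: at each time the curve minus a frozen
  linear image of \<open>H\<close> has derivative zero, although \<open>H\<close> itself need not be
  differentiable. The chain rule survives because \<open>H\<close> is Lipschitz, and uniqueness
  reduces to the fact that a function with zero derivative is constant. Picard iteration runs in one
  chart and reaches only small controls. The exponential is obtained from it by rescaling and
  translating, the controls near \<open>X\<close> by the product formula. The series of
  \<open>Ad(exp tX)\<close> in powers of \<open>ad_X\<close> is never summed. Only
  \<open>d/dt Ad(exp tX) v = Ad(exp tX) [X, v]\<close> is used, paired with a vector orthogonal to
  the spaces in question. The rest is linear algebra: \<open>ad_X^j\<close> maps \<open>V 1\<close>
  into layer \<open>j + 1\<close>, so if these images span, each of them fills its layer.\<close>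

abbreviation zero_deriv :: "(real \<Rightarrow> 'e::real_normed_vector) \<Rightarrow> real \<Rightarrow> real set \<Rightarrow> bool" where
  "zero_deriv f t S \<equiv> (f has_derivative (\<lambda>_. 0)) (at t within S)"

text \<open>A chain rule for a curve that only follows \<open>H\<close> to first order. The
  Lipschitz bound of \<open>H\<close> turns the error of \<open>F\<close>, small against
  \<open>|x s - x t|\<close>, into one that is small against \<open>|s - t|\<close>.\<close>

lemma zero_derivative_comp:
  fixes x H :: "real \<Rightarrow> 'e::real_normed_vector" and F :: "'e \<Rightarrow> 'f::real_normed_vector"
  assumes x: "zero_deriv (\<lambda>s. x s - H s) t S"
    and H: "C-lipschitz_on S H" and t: "t \<in> S"
    and F: "(F has_derivative F') (at (x t))"
  shows "zero_deriv (\<lambda>s. F (x s) - F' (H s)) t S"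
  unfolding has_derivative_within_alt
proof (intro conjI allI impI)
  show "bounded_linear (\<lambda>_::real. 0::'f)" by simp
next
  fix \<epsilon> :: real assume \<epsilon>: "\<epsilon> > 0"
  interpret F': bounded_linear F' using F by (rule has_derivative_bounded_linear)
  obtain B where B: "B > 0" "\<And>v. norm (F' v) \<le> norm v * B" using F'.pos_bounded by blast
  have C: "0 \<le> C" using H by (rule lipschitz_on_nonneg)
  have x': "\<exists>d>0. \<forall>s\<in>S. norm (s - t) < d \<longrightarrow> norm (x s - H s - (x t - H t)) \<le> e * norm (s - t)"
    if "e > 0" for e
    using x that unfolding has_derivative_within_alt by auto
  \<comment> \<open>Half of \<open>\<epsilon>\<close> for each error: \<open>\<epsilon>1\<close>
    pays for \<open>F'\<close> applied to the error of \<open>x\<close>, \<open>\<epsilon>2\<close>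
    for the error of \<open>F\<close>, where
    \<open>|x s - x t| \<le> (C + 1) |s - t|\<close>.\<close>
  define \<epsilon>1 where "\<epsilon>1 = \<epsilon> / (2 * B)"
  define \<epsilon>2 where "\<epsilon>2 = \<epsilon> / (2 * (C + 1))"
  have pos: "\<epsilon>1 > 0" "\<epsilon>2 > 0" using \<epsilon> B C by (auto simp: \<epsilon>1_def \<epsilon>2_def)
  obtain d1 where d1: "d1 > 0" "\<And>s. s \<in> S \<Longrightarrow> norm (s - t) < d1 \<Longrightarrow> norm (x s - H s - (x t - H t)) \<le> \<epsilon>1 * norm (s - t)"
    using x'[OF pos(1)] by blast
  obtain d2 where d2: "d2 > 0" "\<And>s. s \<in> S \<Longrightarrow> norm (s - t) < d2 \<Longrightarrow> norm (x s - H s - (x t - H t)) \<le> 1 * norm (s - t)"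
    using x'[of 1] by (metis zero_less_one)
  obtain d3 where d3: "d3 > 0" "\<And>y. norm (y - x t) < d3 \<Longrightarrow> norm (F y - F (x t) - F' (y - x t)) \<le> \<epsilon>2 * norm (y - x t)"
    using F pos(2) unfolding has_derivative_at_alt by blast
  have "norm (F (x s) - F' (H s) - (F (x t) - F' (H t)) - 0) \<le> \<epsilon> * norm (s - t)"
    if s: "s \<in> S" "norm (s - t) < min d1 (min d2 (d3 / (C + 1)))" for s
  proof -
    have H1: "norm (H s - H t) \<le> C * norm (s - t)"
      using H s(1) t unfolding lipschitz_on_def dist_norm by blast
    have "norm (x s - x t) \<le> norm (x s - H s - (x t - H t)) + norm (H s - H t)"
      by (rule order_trans[OF _ norm_triangle_ineq]) (simp add: algebra_simps)
    then have xs: "norm (x s - x t) \<le> (C + 1) * norm (s - t)"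
      using d2(2)[of s] s H1 by (simp add: algebra_simps)
    have "(C + 1) * norm (s - t) < d3"
      using s(2) C by (simp add: field_simps)
    then have r2: "norm (F (x s) - F (x t) - F' (x s - x t)) \<le> \<epsilon>2 * norm (x s - x t)"
      using xs by (intro d3(2)) linarith
    also have "\<dots> \<le> \<epsilon>2 * ((C + 1) * norm (s - t))" using xs pos by simp
    also have "\<dots> = \<epsilon> / 2 * norm (s - t)" using C by (simp add: \<epsilon>2_def field_simps add_eq_0_iff)
    finally have 2: "norm (F (x s) - F (x t) - F' (x s - x t)) \<le> \<epsilon> / 2 * norm (s - t)" .
    have "norm (F' (x s - H s - (x t - H t))) \<le> norm (x s - H s - (x t - H t)) * B" by (rule B(2))
    also have "\<dots> \<le> (\<epsilon>1 * norm (s - t)) * B" using d1(2)[of s] s B by (intro mult_right_mono) auto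
    also have "\<dots> = \<epsilon> / 2 * norm (s - t)" using B by (simp add: \<epsilon>1_def)
    finally have 1: "norm (F' (x s - H s - (x t - H t))) \<le> \<epsilon> / 2 * norm (s - t)" .
    have eq: "F (x s) - F' (H s) - (F (x t) - F' (H t)) - 0
        = (F (x s) - F (x t) - F' (x s - x t)) + F' (x s - H s - (x t - H t))"
      by (simp add: F'.diff)
    show ?thesis unfolding eq using norm_triangle_mono[OF 2 1] by linarith
  qed
  then show "\<exists>d>0. \<forall>y\<in>S. norm (y - t) < d \<longrightarrow>
      norm (F (x y) - F' (H y) - (F (x t) - F' (H t)) - 0) \<le> \<epsilon> * norm (y - t)"
    using d1(1) d2(1) d3(1) C by (intro exI[of _ "min d1 (min d2 (d3 / (C + 1)))"]) auto
qed

section \<open>Families of linear maps in finite dimension\<close>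

lemma linear_expand_Basis:
  fixes L :: "'e::euclidean_space \<Rightarrow> 'f::real_normed_vector"
  assumes "linear L"
  shows "L v = (\<Sum>b\<in>Basis. (v \<bullet> b) *\<^sub>R L b)"
  by (metis (no_types, lifting) assms euclidean_representation linear_scale linear_sum sum.cong)

lemma norm_linear_le_sum_Basis:
  fixes L :: "'e::euclidean_space \<Rightarrow> 'f::real_normed_vector"
  assumes "linear L"
  shows "norm (L v) \<le> (\<Sum>b\<in>Basis. norm (L b)) * norm v"
proof -
  have "L v = (\<Sum>b\<in>Basis. (v \<bullet> b) *\<^sub>R L b)" by (rule linear_expand_Basis[OF assms])
  also have "norm \<dots> \<le> (\<Sum>b\<in>Basis. norm v * norm (L b))"
    by (intro sum_norm_le) (auto intro!: mult_right_mono simp: Basis_le_norm)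
  finally show ?thesis by (simp add: sum_distrib_left[symmetric] mult.commute)
qed

text \<open>Convergence on the finitely many basis vectors already controls the operator
  norm.\<close>

lemma eventually_linear_close:
  fixes A :: "'x \<Rightarrow> 'e::euclidean_space \<Rightarrow> 'f::real_normed_vector"
  assumes lim: "\<And>v. ((\<lambda>s. A s v) \<longlongrightarrow> B v) F"
    and lin: "\<forall>\<^sub>F s in F. linear (A s)" "linear B" and "\<epsilon> > 0"
  shows "\<forall>\<^sub>F s in F. \<forall>v. norm (A s v - B v) \<le> \<epsilon> * norm v"
proof -
  have "((\<lambda>s. \<Sum>b\<in>Basis. norm (A s b - B b)) \<longlongrightarrow> (\<Sum>b\<in>Basis. norm (B b - B b))) F"
    by (intro tendsto_intros lim)
  then have "\<forall>\<^sub>F s in F. (\<Sum>b\<in>Basis. norm (A s b - B b)) < \<epsilon>"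
    using \<open>\<epsilon> > 0\<close> by (intro order_tendstoD(2)) auto
  with lin(1) show ?thesis
  proof eventually_elim
    case (elim s)
    have "linear (\<lambda>v. A s v - B v)" using elim lin(2) by (intro linear_compose_sub)
    from norm_linear_le_sum_Basis[OF this] show ?case
      using elim by (meson less_imp_le mult_right_mono norm_ge_zero order_trans)
  qed
qed

lemma linear_family_bound:
  fixes A :: "'x::topological_space \<Rightarrow> 'e::euclidean_space \<Rightarrow> 'f::real_normed_vector"
  assumes "compact T" "\<And>v. continuous_on T (\<lambda>t. A t v)" "\<And>t. t \<in> T \<Longrightarrow> linear (A t)"
  obtains K where "K > 0" "\<And>t v. t \<in> T \<Longrightarrow> norm (A t v) \<le> K * norm v"
proof -
  have "compact ((\<lambda>t. \<Sum>b\<in>Basis. norm (A t b)) ` T)"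
    by (intro compact_continuous_image continuous_intros assms)
  then obtain K where K: "K > 0" "\<And>t. t \<in> T \<Longrightarrow> norm (\<Sum>b\<in>Basis. norm (A t b)) \<le> K"
    unfolding compact_eq_bounded_closed bounded_pos by auto
  show thesis
  proof
    fix t v assume "t \<in> T"
    from norm_linear_le_sum_Basis[OF assms(3)[OF this], of v] K(2)[OF this]
    show "norm (A t v) \<le> K * norm v"
      by (smt (verit, best) mult_right_mono norm_ge_zero real_norm_def)
  qed (rule K(1))
qed

section \<open>Essentially bounded functions and their primitives\<close>

text \<open>The bound is an explicit constant and the set is arbitrary, so that estimates restrict
  to subintervals and no essential supremum has to be computed.\<close>

definition ess_bdd :: "real set \<Rightarrow> real \<Rightarrow> (real \<Rightarrow> 'e::euclidean_space) \<Rightarrow> bool" where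
  "ess_bdd S C h \<longleftrightarrow> 0 \<le> C \<and> h \<in> borel_measurable (lebesgue_on S) \<and> negligible {t\<in>S. C < norm (h t)}"

lemma ess_bdd_subset:
  assumes "ess_bdd S C h" "T \<subseteq> S" "T \<in> sets lebesgue"
  shows "ess_bdd T C h"
proof -
  have "h \<in> borel_measurable (lebesgue_on T)"
    using assms measurable_restrict_mono unfolding ess_bdd_def by blast
  moreover have "negligible {t\<in>T. C < norm (h t)}"
    by (rule negligible_subset[of "{t\<in>S. C < norm (h t)}"]) (use assms in \<open>auto simp: ess_bdd_def\<close>)
  ultimately show ?thesis using assms by (auto simp: ess_bdd_def)
qed

text \<open>Setting \<open>h\<close> to zero where it exceeds \<open>C\<close> changes it on a null
  set and leaves a bounded measurable function \<open>g\<close>.\<close>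

lemma ess_bdd_integral:
  fixes h :: "real \<Rightarrow> 'e::euclidean_space"
  assumes "ess_bdd {a..b} C h"
  shows ess_bdd_integrable: "h integrable_on {a..b}"
    and ess_bdd_norm_integral_le: "a \<le> b \<Longrightarrow> norm (integral {a..b} h) \<le> C * (b - a)"
proof -
  define N where "N = {t\<in>{a..b}. C < norm (h t)}"
  have N: "negligible N" and C: "0 \<le> C" and m: "h \<in> borel_measurable (lebesgue_on {a..b})"
    using assms by (auto simp: ess_bdd_def N_def)
  define g where "g t = (if norm (h t) \<le> C then h t else 0)" for t
  have gm: "g \<in> borel_measurable (lebesgue_on {a..b})"
    unfolding g_def using m by measurable
  have gC: "norm (g t) \<le> C" for t using C by (simp add: g_def)
  have gi: "g integrable_on {a..b}"
    by (rule set_lebesgue_integral_eq_integral(1), rule measurable_bounded_by_integrable_imp_absolutely_integrable[OF gm, of "\<lambda>_. C"])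
      (auto simp: gC)
  have eq: "h t = g t" if "t \<in> {a..b} - N" for t using that by (auto simp: N_def g_def)
  show "h integrable_on {a..b}"
    by (rule integrable_spike[OF gi N eq])
  show "norm (integral {a..b} h) \<le> C * (b - a)" if "a \<le> b"
  proof -
    have "norm (integral {a..b} g) \<le> integral {a..b} (\<lambda>_. C)"
      by (rule integral_norm_bound_integral[OF gi]) (auto simp: gC)
    moreover have "integral {a..b} h = integral {a..b} g"
      by (rule integral_spike[OF N]) (use eq in auto)
    ultimately show ?thesis using that by (simp add: mult.commute)
  qed
qed

text \<open>Measurability comes from the expansion of \<open>h t\<close> in the basis, which makes
  \<open>A t (h t)\<close> a finite sum of products of measurable functions.\<close>

lemma ess_bdd_apply:
  fixes A :: "real \<Rightarrow> 'e::euclidean_space \<Rightarrow> 'f::euclidean_space"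
  assumes h: "ess_bdd S C h" and S: "S \<in> sets lebesgue"
    and A: "\<And>v. continuous_on S (\<lambda>t. A t v)" "\<And>t. t \<in> S \<Longrightarrow> linear (A t)"
    and K: "0 \<le> K" "\<And>t v. t \<in> S \<Longrightarrow> norm (A t v) \<le> K * norm v"
  shows "ess_bdd S (K * C) (\<lambda>t. A t (h t))"
proof -
  have hm: "h \<in> borel_measurable (lebesgue_on S)" using h by (simp add: ess_bdd_def)
  have Am: "(\<lambda>t. A t v) \<in> borel_measurable (lebesgue_on S)" for v
    using continuous_imp_measurable_on_sets_lebesgue[OF A(1) S] .
  have "(\<lambda>t. \<Sum>b\<in>Basis. (h t \<bullet> b) *\<^sub>R A t b) \<in> borel_measurable (lebesgue_on S)"
    using hm Am by measurable
  moreover have "A t (h t) = (\<Sum>b\<in>Basis. (h t \<bullet> b) *\<^sub>R A t b)" if "t \<in> space (lebesgue_on S)" for t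
    using that by (intro linear_expand_Basis A(2)) auto
  ultimately have m: "(\<lambda>t. A t (h t)) \<in> borel_measurable (lebesgue_on S)"
    by (subst measurable_cong) auto
  have "negligible {t\<in>S. K * C < norm (A t (h t))}"
  proof (rule negligible_subset[of "{t\<in>S. C < norm (h t)}"])
    show "negligible {t\<in>S. C < norm (h t)}" using h by (simp add: ess_bdd_def)
    show "{t\<in>S. K * C < norm (A t (h t))} \<subseteq> {t\<in>S. C < norm (h t)}"
      using K by (auto simp: not_le[symmetric]) (meson mult_left_mono order_trans)
  qed
  with m show ?thesis using h K by (auto simp: ess_bdd_def)
qed

lemma ess_bdd_freeze_derivative:
  fixes A :: "real \<Rightarrow> 'e::euclidean_space \<Rightarrow> 'f::euclidean_space"
  assumes k: "ess_bdd {a..b} C k" and A: "\<And>v. continuous_on {a..b} (\<lambda>t. A t v)"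
    and lin: "\<And>t. t \<in> {a..b} \<Longrightarrow> linear (A t)"
    and H: "\<And>t s. a \<le> t \<Longrightarrow> t \<le> s \<Longrightarrow> s \<le> b \<Longrightarrow> (k has_integral (H s - H t)) {t..s}"
    and I: "\<And>t s. a \<le> t \<Longrightarrow> t \<le> s \<Longrightarrow> s \<le> b \<Longrightarrow> ((\<lambda>\<tau>. A \<tau> (k \<tau>)) has_integral (I s - I t)) {t..s}"
    and t: "t \<in> {a..b}"
  shows "zero_deriv (\<lambda>s. I s - A t (H s)) t {a..b}"
  unfolding has_derivative_within_alt
proof (intro conjI allI impI)
  show "bounded_linear (\<lambda>_::real. 0::'f)" by simp
next
  fix \<epsilon> :: real assume \<epsilon>: "\<epsilon> > 0"
  have C: "0 \<le> C" using k by (simp add: ess_bdd_def)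
  have lt: "linear (A t)" by (rule lin[OF t])
  define \<epsilon>1 where "\<epsilon>1 = \<epsilon> / (C + 1)"
  have e1: "\<epsilon>1 > 0" "\<epsilon>1 * C \<le> \<epsilon>" using \<epsilon> C by (auto simp: \<epsilon>1_def field_simps)
  have "\<forall>\<^sub>F s in at t within {a..b}. \<forall>v. norm (A s v - A t v) \<le> \<epsilon>1 * norm v"
  proof (rule eventually_linear_close[OF _ _ lt e1(1)])
    show "((\<lambda>s. A s v) \<longlongrightarrow> A t v) (at t within {a..b})" for v
      using A t by (simp add: continuous_on_def)
    show "\<forall>\<^sub>F s in at t within {a..b}. linear (A s)"
      by (simp add: eventually_at_filter lin)
  qed
  then obtain d where d: "d > 0" "\<And>s v. s \<in> {a..b} \<Longrightarrow> s \<noteq> t \<Longrightarrow> dist s t < d \<Longrightarrow> norm (A s v - A t v) \<le> \<epsilon>1 * norm v"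
    unfolding eventually_at by blast
  have d': "norm (A s v - A t v) \<le> \<epsilon>1 * norm v" if "s \<in> {a..b}" "\<bar>s - t\<bar> < d" for s v
    using d(2)[of s v] that e1(1) by (cases "s = t") (auto simp: dist_real_def)
  have "norm (I s - A t (H s) - (I t - A t (H t)) - 0) \<le> \<epsilon> * norm (s - t)"
    if s: "s \<in> {a..b}" "norm (s - t) < d" for s
  proof -
    \<comment> \<open>Ordering the end points avoids oriented integrals; the case distinction below
      restores the sign.\<close>
    define p q where "p = min s t" and "q = max s t"
    have pq: "a \<le> p" "p \<le> q" "q \<le> b" using s t by (auto simp: p_def q_def)
    have hi: "((\<lambda>\<tau>. A \<tau> (k \<tau>) - A t (k \<tau>)) has_integral ((I q - I p) - A t (H q - H p))) {p..q}"
      by (intro has_integral_diff I H pq has_integral_linear[OF H, of p q "A t", unfolded o_def] lt[unfolded linear_conv_bounded_linear])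
    have "ess_bdd {p..q} (\<epsilon>1 * C) (\<lambda>\<tau>. A \<tau> (k \<tau>) - A t (k \<tau>))"
    proof (rule ess_bdd_apply[where A="\<lambda>\<tau> v. A \<tau> v - A t v"])
      show "ess_bdd {p..q} C k" by (rule ess_bdd_subset[OF k]) (use pq in auto)
      show "continuous_on {p..q} (\<lambda>\<tau>. A \<tau> v - A t v)" for v
        by (intro continuous_intros continuous_on_subset[OF A]) (use pq in auto)
      show "linear (\<lambda>v. A \<tau> v - A t v)" if "\<tau> \<in> {p..q}" for \<tau>
        using that pq by (intro linear_compose_sub lin t) auto
      show "norm (A \<tau> v - A t v) \<le> \<epsilon>1 * norm v" if "\<tau> \<in> {p..q}" for \<tau> v
        using that pq s t by (intro d') (auto simp: p_def q_def)
    qed (use e1 in auto)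
    from ess_bdd_norm_integral_le[OF this pq(2)]
    have "norm ((I q - I p) - A t (H q - H p)) \<le> \<epsilon>1 * C * (q - p)"
      by (simp add: integral_unique[OF hi])
    also have "\<dots> \<le> \<epsilon> * (q - p)" using e1(2) pq by (intro mult_right_mono) auto
    also have "q - p = norm (s - t)" by (auto simp: p_def q_def)
    finally have le: "norm ((I q - I p) - A t (H q - H p)) \<le> \<epsilon> * norm (s - t)" .
    show ?thesis
    proof (cases "s \<le> t")
      case True
      then have "I s - A t (H s) - (I t - A t (H t)) - 0 = - ((I q - I p) - A t (H q - H p))"
        by (simp add: p_def q_def linear_diff[OF lt] min_def max_def)
      then show ?thesis using le by (metis norm_minus_cancel)
    next
      case False
      then have "I s - A t (H s) - (I t - A t (H t)) - 0 = (I q - I p) - A t (H q - H p)"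
        by (simp add: p_def q_def linear_diff[OF lt] min_def max_def)
      then show ?thesis using le by metis
    qed
  qed
  then show "\<exists>d>0. \<forall>y\<in>{a..b}. norm (y - t) < d \<longrightarrow>
      norm (I y - A t (H y) - (I t - A t (H t)) - 0) \<le> \<epsilon> * norm (y - t)"
    using d(1) by blast
qed


lemma has_integral_indefinite_diff:
  fixes h :: "real \<Rightarrow> 'e::euclidean_space"
  assumes "h integrable_on {a..b}" "a \<le> t" "t \<le> s" "s \<le> b"
  shows "(h has_integral (integral {a..s} h - integral {a..t} h)) {t..s}"
proof -
  have i: "h integrable_on {a..s}" "h integrable_on {t..s}"
    using assms by (auto intro: integrable_subinterval_real)
  have "integral {a..t} h + integral {t..s} h = integral {a..s} h"
    by (rule Henstock_Kurzweil_Integration.integral_combine) (use assms i in auto)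
  then have "integral {a..s} h - integral {a..t} h = integral {t..s} h"
    by (simp add: algebra_simps)
  then show ?thesis using i(2) by (simp add: integrable_integral)
qed

lemma ess_bdd_indefinite_lipschitz:
  fixes h :: "real \<Rightarrow> 'e::euclidean_space"
  assumes "ess_bdd {a..b} C h"
  shows "C-lipschitz_on {a..b} (\<lambda>t. integral {a..t} h)"
proof (rule lipschitz_onI)
  show "0 \<le> C" using assms by (simp add: ess_bdd_def)
  have *: "dist (integral {a..t} h) (integral {a..s} h) \<le> C * dist t s"
    if "t \<in> {a..b}" "s \<in> {a..b}" "t \<le> s" for t s
  proof -
    have "integral {a..s} h - integral {a..t} h = integral {t..s} h"
      using has_integral_indefinite_diff[OF ess_bdd_integrable[OF assms], of t s] that
      by (simp add: integral_unique)
    moreover have "ess_bdd {t..s} C h"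
      using that by (intro ess_bdd_subset[OF assms]) auto
    ultimately show ?thesis
      using ess_bdd_norm_integral_le[of t s C h] that
      by (simp add: dist_norm norm_minus_commute)
  qed
  show "dist (integral {a..t} h) (integral {a..s} h) \<le> C * dist t s"
    if "t \<in> {a..b}" "s \<in> {a..b}" for t s
    using *[of t s] *[of s t] that by (cases "t \<le> s") (auto simp: dist_commute)
qed

section \<open>Picard iteration for small controls\<close>

text \<open>Banach's fixed point theorem on curves in the ball. The time interval stays all of
  \<open>[0,1]\<close>: instead of a short time, the smallness of the control bound \<open>C\<close>
  makes the integral operator preserve the ball and contract.\<close>

lemma picard_controlled:
  fixes A :: "'e::euclidean_space \<Rightarrow> 'e \<Rightarrow> 'e"
  assumes k: "ess_bdd {0..1} C k"
    and lin: "\<And>x. x \<in> cball e \<rho> \<Longrightarrow> linear (A x)"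
    and K: "0 \<le> K" "\<And>x v. x \<in> cball e \<rho> \<Longrightarrow> norm (A x v) \<le> K * norm v"
    and L: "0 \<le> L" "\<And>x y v. x \<in> cball e \<rho> \<Longrightarrow> y \<in> cball e \<rho> \<Longrightarrow> norm (A x v - A y v) \<le> L * norm (x - y) * norm v"
    and small: "K * C \<le> \<rho>" "L * C < 1"
  obtains x where "continuous_on {0..1} x" "x 0 = e" "\<And>t. t \<in> {0..1} \<Longrightarrow> norm (x t - e) \<le> K * C"
    "\<And>a b. 0 \<le> a \<Longrightarrow> a \<le> b \<Longrightarrow> b \<le> 1 \<Longrightarrow> ((\<lambda>\<tau>. A (x \<tau>) (k \<tau>)) has_integral (x b - x a)) {a..b}"
proof -
  have C: "0 \<le> C" using k by (simp add: ess_bdd_def)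
  have \<rho>: "0 \<le> \<rho>" using small(1) K(1) C by (meson mult_nonneg_nonneg order_trans)
  define S where "S = PiC UNIV (\<lambda>_::real. cball e \<rho>)"
  have S: "f \<in> S \<longleftrightarrow> (\<forall>t. apply_bcontfun f t \<in> cball e \<rho>)" for f
    by (auto simp: S_def mem_PiC_iff)
  have "closed S" unfolding S_def by (rule closed_PiC) auto
  then have cS: "complete S" by (simp add: complete_eq_closed)
  have "const_bcontfun e \<in> S" using \<rho> by (simp add: S)
  then have neS: "S \<noteq> {}" by blast
  have contA: "continuous_on (cball e \<rho>) (\<lambda>x. A x v)" for v
  proof (rule lipschitz_on_continuous_on[of "L * norm v"], rule lipschitz_onI)
    show "dist (A x v) (A y v) \<le> L * norm v * dist x y" if "x \<in> cball e \<rho>" "y \<in> cball e \<rho>" for x y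
      using L(2)[OF that, of v] by (simp add: dist_norm mult_ac)
  qed (use L in auto)
  \<comment> \<open>Clamping the time to \<open>[0,1]\<close> makes \<open>J f\<close> a bounded
    continuous function on the whole line, hence an element of the complete metric space of such
    functions.\<close>
  define J where "J f t = e + integral {0..max 0 (min 1 t)} (\<lambda>\<tau>. A (apply_bcontfun f \<tau>) (k \<tau>))" for f and t :: real
  have eb: "ess_bdd {0..1} (K * C) (\<lambda>\<tau>. A (apply_bcontfun f \<tau>) (k \<tau>))" if "f \<in> S" for f
  proof (rule ess_bdd_apply[OF k])
    show "continuous_on {0..1} (\<lambda>t. A (apply_bcontfun f t) v)" for v
      by (rule continuous_on_compose2[OF contA]) (use that S in auto)
  qed (use that S lin K in auto)
  have Jb: "norm (J f t - e) \<le> K * C" if "f \<in> S" for f t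
  proof -
    have "ess_bdd {0..max 0 (min 1 t)} (K * C) (\<lambda>\<tau>. A (apply_bcontfun f \<tau>) (k \<tau>))"
      by (rule ess_bdd_subset[OF eb[OF that]]) auto
    from ess_bdd_norm_integral_le[OF this]
    have "norm (J f t - e) \<le> K * C * (max 0 (min 1 t) - 0)" by (simp add: J_def)
    also have "\<dots> \<le> K * C * 1" using K C by (intro mult_left_mono) auto
    finally show ?thesis by simp
  qed
  have Jc: "continuous_on UNIV (J f)" if "f \<in> S" for f
    unfolding J_def
    by (intro continuous_intros continuous_on_compose2[OF indefinite_integral_continuous_1[OF ess_bdd_integrable[OF eb[OF that]]]]) auto
  have Jbc: "J f \<in> bcontfun" if "f \<in> S" for f
  proof (rule bcontfun_normI[OF Jc[OF that]])
    show "norm (J f t) \<le> K * C + norm e" for t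
      using Jb[OF that, of t] norm_triangle_sub[of "J f t" e] by linarith
  qed
  define T where "T f = Bcontfun (J f)" for f
  have Tapp: "apply_bcontfun (T f) t = J f t" if "f \<in> S" for f t
    using Jbc[OF that] by (simp add: T_def Bcontfun_inverse)
  have TS: "T ` S \<subseteq> S"
  proof (rule image_subsetI)
    fix f assume f: "f \<in> S"
    have "dist e (J f t) \<le> \<rho>" for t
      using Jb[OF f, of t] small(1) by (simp add: dist_norm norm_minus_commute)
    then show "T f \<in> S" unfolding S Tapp[OF f] by simp
  qed
  have Tlip: "\<forall>f\<in>S. \<forall>g\<in>S. dist (T f) (T g) \<le> L * C * dist f g"
  proof (intro ballI, rule dist_bound)
    fix f g and t :: real assume fg: "f \<in> S" "g \<in> S"
    let ?u = "max 0 (min 1 t)"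
    let ?D = "\<lambda>\<tau>. A (apply_bcontfun f \<tau>) (k \<tau>) - A (apply_bcontfun g \<tau>) (k \<tau>)"
    have "ess_bdd {0..1} (L * dist f g * C) ?D"
    proof (rule ess_bdd_apply[OF k, where A="\<lambda>\<tau> v. A (apply_bcontfun f \<tau>) v - A (apply_bcontfun g \<tau>) v"])
      show "continuous_on {0..1} (\<lambda>\<tau>. A (apply_bcontfun f \<tau>) v - A (apply_bcontfun g \<tau>) v)" for v
        by (intro continuous_intros continuous_on_compose2[OF contA]) (use fg S in auto)
      show "linear (\<lambda>v. A (apply_bcontfun f \<tau>) v - A (apply_bcontfun g \<tau>) v)" for \<tau>
        using fg S by (intro linear_compose_sub lin) auto
      show "norm (A (apply_bcontfun f \<tau>) v - A (apply_bcontfun g \<tau>) v) \<le> L * dist f g * norm v" for \<tau> v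
      proof -
        have "norm (A (apply_bcontfun f \<tau>) v - A (apply_bcontfun g \<tau>) v)
            \<le> L * norm (apply_bcontfun f \<tau> - apply_bcontfun g \<tau>) * norm v"
          using fg S by (intro L) auto
        also have "\<dots> \<le> L * dist f g * norm v"
          using dist_bounded[of f \<tau> g] L(1) by (intro mult_right_mono mult_left_mono) (auto simp: dist_norm)
        finally show ?thesis .
      qed
    qed (use L in auto)
    then have eD: "ess_bdd {0..?u} (L * dist f g * C) ?D" by (rule ess_bdd_subset) auto
    have i: "(\<lambda>\<tau>. A (apply_bcontfun h \<tau>) (k \<tau>)) integrable_on {0..?u}" if "h \<in> S" for h
      by (rule ess_bdd_integrable[OF ess_bdd_subset[OF eb[OF that]]]) auto
    have "dist (J f t) (J g t) = norm (integral {0..?u} ?D)"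
      unfolding J_def dist_norm by (subst Henstock_Kurzweil_Integration.integral_diff[OF i i]) (use fg in auto)
    also have "\<dots> \<le> L * dist f g * C * (?u - 0)" by (rule ess_bdd_norm_integral_le[OF eD]) auto
    also have "\<dots> \<le> L * dist f g * C * 1" using L C by (intro mult_left_mono) auto
    finally show "dist (apply_bcontfun (T f) t) (apply_bcontfun (T g) t) \<le> L * C * dist f g"
      using fg by (simp add: Tapp mult_ac)
  qed
  obtain f where f: "f \<in> S" "T f = f"
    using Banach_fix[OF cS neS _ small(2) TS Tlip[rule_format]] L C by auto
  have fJ: "apply_bcontfun f t = J f t" for t using Tapp[OF f(1)] f(2) by simp
  show thesis
  proof
    show "continuous_on {0..1} (apply_bcontfun f)" by simp
    show "apply_bcontfun f 0 = e" by (simp add: fJ) (simp add: J_def)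
    show "norm (apply_bcontfun f t - e) \<le> K * C" for t using Jb[OF f(1)] fJ by metis
    show "((\<lambda>\<tau>. A (apply_bcontfun f \<tau>) (k \<tau>)) has_integral (apply_bcontfun f b - apply_bcontfun f a)) {a..b}"
      if "0 \<le> a" "a \<le> b" "b \<le> 1" for a b
    proof -
      have "apply_bcontfun f b - apply_bcontfun f a = integral {0..b} (\<lambda>\<tau>. A (apply_bcontfun f \<tau>) (k \<tau>))
         - integral {0..a} (\<lambda>\<tau>. A (apply_bcontfun f \<tau>) (k \<tau>))"
        unfolding fJ[of a] fJ[of b] using that by (simp add: J_def)
      then show ?thesis
        using has_integral_indefinite_diff[OF ess_bdd_integrable[OF eb[OF f(1)]] that] by simp
    qed
  qed
qed

section \<open>Symmetry of mixed second derivatives\<close>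

text \<open>The mean value theorem in the direction \<open>u\<close> turns the second difference
  into an increment of \<open>\<lambda>x. f' x u\<close>, which differentiability at
  \<open>x0\<close> evaluates. The quotient is symmetric in \<open>u\<close> and \<open>v\<close>,
  whereas the limit is not visibly so.\<close>

lemma second_difference_tendsto:
  fixes f :: "'e::real_normed_vector \<Rightarrow> real"
  assumes O: "open O'" "x0 \<in> O'"
    and f: "\<And>x. x \<in> O' \<Longrightarrow> (f has_derivative f' x) (at x)"
    and Du: "((\<lambda>x. f' x u) has_derivative Du) (at x0)"
  shows "((\<lambda>h. (f (x0 + h *\<^sub>R v + h *\<^sub>R u) - f (x0 + h *\<^sub>R v) - f (x0 + h *\<^sub>R u) + f x0) / h\<^sup>2) \<longlongrightarrow> Du v) (at_right 0)"
proof (rule tendstoI)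
  fix \<epsilon> :: real assume \<epsilon>: "\<epsilon> > 0"
  interpret Du: bounded_linear Du using Du by (rule has_derivative_bounded_linear)
  \<comment> \<open>All points that occur are within \<open>h * M\<close> of \<open>x0\<close>; the
    final error is \<open>2 * \<epsilon>1 * M\<close>, that is
    \<open>\<epsilon> / 2\<close>.\<close>
  define M where "M = norm v + 2 * norm u + 1"
  have M: "M > 0" by (simp add: M_def add_nonneg_pos)
  define \<epsilon>1 where "\<epsilon>1 = \<epsilon> / (4 * M)"
  have \<epsilon>1: "\<epsilon>1 > 0" using \<epsilon> M by (simp add: \<epsilon>1_def)
  obtain r where r: "r > 0" "ball x0 r \<subseteq> O'" using O openE by blast
  obtain d where d: "d > 0" "\<And>y. norm (y - x0) < d \<Longrightarrow> norm (f' y u - f' x0 u - Du (y - x0)) \<le> \<epsilon>1 * norm (y - x0)"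
    using Du \<epsilon>1 unfolding has_derivative_at_alt by blast
  have "dist ((f (x0 + h *\<^sub>R v + h *\<^sub>R u) - f (x0 + h *\<^sub>R v) - f (x0 + h *\<^sub>R u) + f x0) / h\<^sup>2) (Du v) < \<epsilon>"
    if h: "0 < h" "h < min r d / M" for h
  proof -
    have hM: "h * M < r" "h * M < d" using h M by (auto simp: field_simps)
    have nb: "norm (a *\<^sub>R v + b *\<^sub>R u) \<le> h * M" if "0 \<le> a" "a \<le> h" "0 \<le> b" "b \<le> h" for a b
    proof -
      have "norm (a *\<^sub>R v + b *\<^sub>R u) \<le> a * norm v + b * norm u"
        using norm_triangle_ineq[of "a *\<^sub>R v" "b *\<^sub>R u"] that by simp
      also have "\<dots> \<le> h * norm v + h * norm u"
        using that by (intro add_mono mult_right_mono) auto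
      also have "\<dots> \<le> h * M" using h by (simp add: M_def algebra_simps)
      finally show ?thesis .
    qed
    \<comment> \<open>\<open>g\<close> compares \<open>f\<close> on two segments in the direction
      \<open>u\<close> that differ by the shift \<open>h v\<close>; its increment over
      \<open>[0, h]\<close> is the second difference.\<close>
    define g where "g s = f (x0 + h *\<^sub>R v + s *\<^sub>R u) - f (x0 + s *\<^sub>R u)" for s
    have inO: "x0 + (a *\<^sub>R v + b *\<^sub>R u) \<in> O'" if "0 \<le> a" "a \<le> h" "0 \<le> b" "b \<le> h" for a b
    proof -
      have "dist x0 (x0 + w) = norm w" for w by (simp add: dist_norm)
      then show ?thesis using nb[OF that] hM by (intro subsetD[OF r(2)]) simp
    qed
    have gd: "(g has_derivative (\<lambda>t. f' (x0 + h *\<^sub>R v + s *\<^sub>R u) (t *\<^sub>R u) - f' (x0 + s *\<^sub>R u) (t *\<^sub>R u))) (at s)"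
      if "0 \<le> s" "s \<le> h" for s
    proof -
      have "(f has_derivative f' (x0 + h *\<^sub>R v + s *\<^sub>R u)) (at (x0 + h *\<^sub>R v + s *\<^sub>R u))"
        using inO[of h s] that h by (intro f) (simp add: add.assoc)
      moreover have "(f has_derivative f' (x0 + s *\<^sub>R u)) (at (x0 + s *\<^sub>R u))"
        using inO[of 0 s] that h by (intro f) simp
      ultimately show ?thesis
        unfolding g_def
        by (auto intro!: derivative_eq_intros has_derivative_compose[where f="\<lambda>s. x0 + h *\<^sub>R v + s *\<^sub>R u" and g=f]
            has_derivative_compose[where f="\<lambda>s. x0 + s *\<^sub>R u" and g=f])
    qed
    have "\<exists>s\<in>{0<..<h}. g h - g 0 = (\<lambda>t. f' (x0 + h *\<^sub>R v + s *\<^sub>R u) (t *\<^sub>R u) - f' (x0 + s *\<^sub>R u) (t *\<^sub>R u)) (h - 0)"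
      by (rule mvt_simple) (use h gd in \<open>auto intro: has_derivative_at_withinI\<close>)
    then obtain s where s: "0 < s" "s < h" and
      gs: "g h - g 0 = f' (x0 + h *\<^sub>R v + s *\<^sub>R u) (h *\<^sub>R u) - f' (x0 + s *\<^sub>R u) (h *\<^sub>R u)" by auto
    have lin: "f' y (h *\<^sub>R u) = h * f' y u" if "y \<in> O'" for y
      using f[OF that] has_derivative_bounded_linear linear_simps(5) by (metis real_scaleR_def)
    have "g h - g 0 = h * (f' (x0 + h *\<^sub>R v + s *\<^sub>R u) u - f' (x0 + s *\<^sub>R u) u)"
      using inO[of h s] inO[of 0 s] s h by (subst gs, subst (1 2) lin) (auto simp: algebra_simps)
    moreover have "norm (f' (x0 + h *\<^sub>R v + s *\<^sub>R u) u - f' x0 u - Du (h *\<^sub>R v + s *\<^sub>R u)) \<le> \<epsilon>1 * (h * M)"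
      using d(2)[of "x0 + (h *\<^sub>R v + s *\<^sub>R u)"] nb[of h s] hM s h \<epsilon>1
      by (smt (verit, best) add.assoc add_diff_cancel_left' mult_left_mono)
    moreover have "norm (f' (x0 + s *\<^sub>R u) u - f' x0 u - Du (s *\<^sub>R u)) \<le> \<epsilon>1 * (h * M)"
      using d(2)[of "x0 + s *\<^sub>R u"] nb[of 0 s] hM s h \<epsilon>1
      by (smt (verit, best) add_diff_cancel_left' mult_left_mono scale_zero_left add_0)
    ultimately have "\<bar>(g h - g 0) - h * (h * Du v)\<bar> \<le> h * (2 * (\<epsilon>1 * (h * M)))"
    proof -
      assume a: "g h - g 0 = h * (f' (x0 + h *\<^sub>R v + s *\<^sub>R u) u - f' (x0 + s *\<^sub>R u) u)"
        "norm (f' (x0 + h *\<^sub>R v + s *\<^sub>R u) u - f' x0 u - Du (h *\<^sub>R v + s *\<^sub>R u)) \<le> \<epsilon>1 * (h * M)"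
        "norm (f' (x0 + s *\<^sub>R u) u - f' x0 u - Du (s *\<^sub>R u)) \<le> \<epsilon>1 * (h * M)"
      have "\<bar>(f' (x0 + h *\<^sub>R v + s *\<^sub>R u) u - f' (x0 + s *\<^sub>R u) u) - h * Du v\<bar> \<le> 2 * (\<epsilon>1 * (h * M))"
        using a(2,3) by (simp add: Du.add Du.scaleR)
      then have "h * \<bar>(f' (x0 + h *\<^sub>R v + s *\<^sub>R u) u - f' (x0 + s *\<^sub>R u) u) - h * Du v\<bar> \<le> h * (2 * (\<epsilon>1 * (h * M)))"
        using h by (intro mult_left_mono) auto
      moreover have "(g h - g 0) - h * (h * Du v) = h * ((f' (x0 + h *\<^sub>R v + s *\<^sub>R u) u - f' (x0 + s *\<^sub>R u) u) - h * Du v)"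
        unfolding a(1) by (simp add: right_diff_distrib)
      then have "\<bar>(g h - g 0) - h * (h * Du v)\<bar> = h * \<bar>(f' (x0 + h *\<^sub>R v + s *\<^sub>R u) u - f' (x0 + s *\<^sub>R u) u) - h * Du v\<bar>"
        using h by (simp only: abs_mult abs_of_pos)
      ultimately show ?thesis by simp
    qed
    then have "\<bar>(g h - g 0) / h\<^sup>2 - Du v\<bar> \<le> 2 * \<epsilon>1 * M"
    proof -
      assume a: "\<bar>(g h - g 0) - h * (h * Du v)\<bar> \<le> h * (2 * (\<epsilon>1 * (h * M)))"
      have "\<bar>(g h - g 0) / h\<^sup>2 - Du v\<bar> = \<bar>((g h - g 0) - h * (h * Du v)) / h\<^sup>2\<bar>"
        using h by (simp add: field_simps power2_eq_square)
      also have "\<dots> = \<bar>(g h - g 0) - h * (h * Du v)\<bar> / h\<^sup>2" by simp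
      also have "\<dots> \<le> h * (2 * (\<epsilon>1 * (h * M))) / h\<^sup>2" using a by (intro divide_right_mono) auto
      also have "\<dots> = 2 * \<epsilon>1 * M" using h by (simp add: power2_eq_square)
      finally show ?thesis .
    qed
    also have "2 * \<epsilon>1 * M < \<epsilon>" using M \<epsilon> by (simp add: \<epsilon>1_def)
    finally show ?thesis by (simp add: g_def dist_real_def algebra_simps)
  qed
  moreover have "0 < min r d / M" using r d M by simp
  ultimately show "\<forall>\<^sub>F h in at_right 0. dist ((f (x0 + h *\<^sub>R v + h *\<^sub>R u) - f (x0 + h *\<^sub>R v) - f (x0 + h *\<^sub>R u) + f x0) / h\<^sup>2) (Du v) < \<epsilon>"
    by (intro eventually_at_rightI[of 0 "min r d / M"]) auto
qed

lemma second_derivative_symmetric: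
  fixes f :: "'e::real_normed_vector \<Rightarrow> 'f::euclidean_space"
  assumes O: "open O'" "x0 \<in> O'"
    and f: "\<And>x. x \<in> O' \<Longrightarrow> (f has_derivative f' x) (at x)"
    and Du: "((\<lambda>x. f' x u) has_derivative Du) (at x0)"
    and Dv: "((\<lambda>x. f' x v) has_derivative Dv) (at x0)"
  shows "Du v = Dv u"
proof (rule euclidean_eqI)
  fix b :: 'f assume "b \<in> Basis"
  note der = has_derivative_inner_left[where b=b]
  have "((\<lambda>h. (f (x0 + h *\<^sub>R v + h *\<^sub>R u) \<bullet> b - f (x0 + h *\<^sub>R v) \<bullet> b - f (x0 + h *\<^sub>R u) \<bullet> b + f x0 \<bullet> b) / h\<^sup>2) \<longlongrightarrow> Du v \<bullet> b) (at_right 0)"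
    by (rule second_difference_tendsto[OF O, where f="\<lambda>x. f x \<bullet> b"]) (auto intro!: der f Du)
  moreover have "((\<lambda>h. (f (x0 + h *\<^sub>R u + h *\<^sub>R v) \<bullet> b - f (x0 + h *\<^sub>R u) \<bullet> b - f (x0 + h *\<^sub>R v) \<bullet> b + f x0 \<bullet> b) / h\<^sup>2) \<longlongrightarrow> Dv u \<bullet> b) (at_right 0)"
    by (rule second_difference_tendsto[OF O, where f="\<lambda>x. f x \<bullet> b"]) (auto intro!: der f Dv)
  then have "((\<lambda>h. (f (x0 + h *\<^sub>R v + h *\<^sub>R u) \<bullet> b - f (x0 + h *\<^sub>R v) \<bullet> b - f (x0 + h *\<^sub>R u) \<bullet> b + f x0 \<bullet> b) / h\<^sup>2) \<longlongrightarrow> Dv u \<bullet> b) (at_right 0)"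
    by (rule Lim_transform_eventually) (simp add: algebra_simps)
  ultimately show "Du v \<bullet> b = Dv u \<bullet> b"
    by (rule tendsto_unique[rotated]) simp
qed

section \<open>Charts and tangent maps\<close>

lemma smooth_on_imp_differentiable:
  assumes "smooth_on S f" "x \<in> S"
  shows "f differentiable (at x)"
proof -
  have "Ck_on (Suc 0) S f" using assms by (simp only: smooth_on_def)
  then show ?thesis using assms(2) by (auto simp: differentiable_def)
qed

lemma smooth_on_C2:
  assumes "smooth_on S f"
  obtains f' f'' where
    "\<And>x. x \<in> S \<Longrightarrow> (f has_derivative f' x) (at x)"
    "\<And>x v. x \<in> S \<Longrightarrow> ((\<lambda>x. f' x v) has_derivative f'' v x) (at x)"
    "\<And>v w. continuous_on S (\<lambda>x. f'' v x w)"
proof -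
  have "Ck_on (Suc (Suc 0)) S f" using assms by (simp only: smooth_on_def)
  then obtain f' where f': "\<forall>x\<in>S. (f has_derivative f' x) (at x)" "\<forall>v. Ck_on (Suc 0) S (\<lambda>x. f' x v)"
    by (subst (asm) (1) Ck_on.simps) blast
  then have "\<forall>v. \<exists>f''. (\<forall>x\<in>S. ((\<lambda>x. f' x v) has_derivative f'' x) (at x)) \<and> (\<forall>w. continuous_on S (\<lambda>x. f'' x w))"
    by simp
  then obtain f'' where "\<forall>v. (\<forall>x\<in>S. ((\<lambda>x. f' x v) has_derivative f'' v x) (at x)) \<and> (\<forall>w. continuous_on S (\<lambda>x. f'' v x w))"
    by metis
  with f' that show thesis by blast
qed

locale atlas =
  fixes M :: "('a, 'e::euclidean_space) manifold"
  assumes smooth_manifold: "smooth_manifold M"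
begin

lemma chart_openin: "c \<in> charts M \<Longrightarrow> openin (mtop M) (fst c)"
  and chart_open_image: "c \<in> charts M \<Longrightarrow> open (snd c ` fst c)"
  and chart_homeo: "c \<in> charts M \<Longrightarrow> homeomorphic_map (subtopology (mtop M) (fst c)) (top_of_set (snd c ` fst c)) (snd c)"
  and charts_cover: "(\<Union>c\<in>charts M. fst c) = topspace (mtop M)"
  using smooth_manifold unfolding smooth_manifold_def by auto

lemma chart_subset: "c \<in> charts M \<Longrightarrow> fst c \<subseteq> topspace (mtop M)"
  using charts_cover by blast

lemma obtain_chart:
  assumes "p \<in> topspace (mtop M)" obtains c where "c \<in> charts M" "p \<in> fst c"
  using assms charts_cover by blast

lemma chart_inj: "c \<in> charts M \<Longrightarrow> inj_on (snd c) (fst c)"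
  using homeomorphic_imp_injective_map[OF chart_homeo[of c]] chart_subset[of c]
  by (simp add: Int_absorb1)

lemma chart_inv_chart [simp]: "c \<in> charts M \<Longrightarrow> p \<in> fst c \<Longrightarrow> chart_inv c (snd c p) = p"
  by (simp add: chart_inj)

lemma limitin_in_chart:
  assumes "c \<in> charts M" "limitin (mtop M) f p F" "p \<in> fst c"
  shows "\<forall>\<^sub>F s in F. f s \<in> fst c"
  using assms chart_openin by (blast intro: limitinD)

lemma limitin_chart:
  assumes c: "c \<in> charts M" and f: "limitin (mtop M) f p F" and p: "p \<in> fst c"
  shows "((\<lambda>s. snd c (f s)) \<longlongrightarrow> snd c p) F"
proof -
  have "limitin (subtopology (mtop M) (fst c)) f p F"
    using f p limitin_in_chart[OF assms] by (simp add: limitin_subtopology)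
  from continuous_map_limit[OF homeomorphic_imp_continuous_map[OF chart_homeo[OF c]] this]
  show ?thesis by (simp add: limitin_subtopology o_def)
qed

text \<open>\<open>chart_inv\<close> agrees with a continuous inverse \<open>g\<close> of the chart
  only on the chart image. The image is open, so \<open>x\<close> is eventually inside it and the
  limit carries over.\<close>

lemma limitin_chart_inv:
  assumes c: "c \<in> charts M" and x: "(x \<longlongrightarrow> snd c p) F" and p: "p \<in> fst c"
  shows "limitin (mtop M) (\<lambda>s. chart_inv c (x s)) p F"
proof -
  let ?X = "subtopology (mtop M) (fst c)" and ?Y = "top_of_set (snd c ` fst c)"
  have topX: "topspace ?X = fst c" using chart_subset[OF c] by auto
  obtain g where g: "homeomorphic_maps ?X ?Y (snd c) g"
    using chart_homeo[OF c] homeomorphic_map_maps by blast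
  have g': "continuous_map ?Y ?X g" "\<And>p. p \<in> fst c \<Longrightarrow> g (snd c p) = p"
    using g topX unfolding homeomorphic_maps_def by auto
  have ev: "\<forall>\<^sub>F s in F. x s \<in> snd c ` fst c"
    using topological_tendstoD[OF x chart_open_image[OF c]] p by blast
  then have "limitin ?Y x (snd c p) F"
    using x p by (auto simp: limitin_subtopology)
  from continuous_map_limit[OF g'(1) this] have "limitin (mtop M) (\<lambda>s. g (x s)) p F"
    using p by (simp add: limitin_subtopology g'(2) o_def)
  moreover have "\<forall>\<^sub>F s in F. g (x s) = chart_inv c (x s)"
    using ev by eventually_elim (auto simp: g'(2) c)
  ultimately show ?thesis by (rule limitin_transform_eventually[rotated])
qed

lemma eventually_chart_inv_in:
  assumes "c \<in> charts M" "p \<in> fst c" "openin (mtop M) U" "p \<in> U"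
  shows "\<forall>\<^sub>F x in nhds (snd c p). chart_inv c x \<in> U"
  by (rule limitinD[OF limitin_chart_inv[OF assms(1) _ assms(2)]]) (use assms in \<open>auto simp: filterlim_ident\<close>)

lemma eventually_in_chart_image:
  assumes "c \<in> charts M" "p \<in> fst c"
  shows "\<forall>\<^sub>F x in nhds (snd c p). x \<in> snd c ` fst c"
  using assms chart_open_image by (intro eventually_nhds_in_open) auto

lemma tangent_map_id:
  assumes "c \<in> charts M" "p \<in> fst c"
  shows "(in_charts c c (\<lambda>x. x) has_derivative (\<lambda>v. v)) (at (snd c p))" "tangent_map c c (\<lambda>x. x) p = (\<lambda>v. v)"
proof -
  have "\<forall>\<^sub>F x in nhds (snd c p). x = in_charts c c (\<lambda>x. x) x"
    using eventually_in_chart_image[OF assms]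
    by eventually_elim (auto simp: in_charts_def assms(1))
  then show *: "(in_charts c c (\<lambda>x. x) has_derivative (\<lambda>v. v)) (at (snd c p))"
    by (intro has_derivative_transform_eventually[OF has_derivative_ident])
      (auto dest: eventually_nhds_x_imp_x simp: eventually_at_filter elim: eventually_mono)
  show "tangent_map c c (\<lambda>x. x) p = (\<lambda>v. v)"
    unfolding tangent_map_def by (rule frechet_derivative_at[OF *, symmetric])
qed

end

section \<open>Differentiable maps between manifolds\<close>

text \<open>Tangent maps need only a first derivative at each point. This property is stable under
  composition and easy to check for translations.\<close>

definition mdiff :: "('a, 'e::euclidean_space) manifold \<Rightarrow> ('b, 'f::euclidean_space) manifold \<Rightarrow> ('a \<Rightarrow> 'b) \<Rightarrow> bool" where
  "mdiff M N f \<longleftrightarrow> continuous_map (mtop M) (mtop N) f \<and>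
     (\<forall>c\<in>charts M. \<forall>d\<in>charts N. \<forall>p\<in>fst c. f p \<in> fst d \<longrightarrow> in_charts c d f differentiable (at (snd c p)))"

lemma smooth_map_imp_mdiff:
  assumes "smooth_map M N f" shows "mdiff M N f"
  unfolding mdiff_def
proof (intro conjI ballI impI)
  fix c d p assume h: "c \<in> charts M" "d \<in> charts N" "p \<in> fst c" "f p \<in> fst d"
  then have "smooth_on (snd c ` {p \<in> fst c. f p \<in> fst d}) (in_charts c d f)"
    using assms by (auto simp: smooth_map_def)
  then show "in_charts c d f differentiable (at (snd c p))"
    by (rule smooth_on_imp_differentiable) (use h in auto)
qed (use assms in \<open>simp add: smooth_map_def\<close>)

lemma mdiff_continuous: "mdiff M N f \<Longrightarrow> continuous_map (mtop M) (mtop N) f"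
  by (simp add: mdiff_def)

lemma mdiff_has_derivative:
  assumes "mdiff M N f" "c \<in> charts M" "d \<in> charts N" "p \<in> fst c" "f p \<in> fst d"
  shows "(in_charts c d f has_derivative tangent_map c d f p) (at (snd c p))"
  using assms unfolding mdiff_def tangent_map_def by (auto simp: frechet_derivative_works)

lemma mdiff_linear:
  assumes "mdiff M N f" "c \<in> charts M" "d \<in> charts N" "p \<in> fst c" "f p \<in> fst d"
  shows "linear (tangent_map c d f p)"
  using mdiff_has_derivative[OF assms] has_derivative_linear by blast

locale atlas_map = M: atlas M + N: atlas N
  for M :: "('a, 'e::euclidean_space) manifold" and N :: "('b, 'f::euclidean_space) manifold" +
  fixes f :: "'a \<Rightarrow> 'b"
  assumes mdiff: "mdiff M N f"
begin

lemma limitin_map: "limitin (mtop M) g p F \<Longrightarrow> limitin (mtop N) (\<lambda>x. f (g x)) (f p) F"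
  using continuous_map_limit[OF mdiff_continuous[OF mdiff]] by (auto simp: o_def)

lemma eventually_map_in_chart:
  assumes "c \<in> charts M" "d \<in> charts N" "p \<in> fst c" "f p \<in> fst d"
  shows "\<forall>\<^sub>F x in nhds (snd c p). f (chart_inv c x) \<in> fst d"
  by (rule N.limitin_in_chart[OF _ limitin_map[OF M.limitin_chart_inv[where x="\<lambda>x. x"]]])
    (use assms in \<open>auto simp: filterlim_ident\<close>)

lemma has_derivative_comp:
  assumes g: "(in_charts d k g has_derivative T) (at (snd d (f p)))"
    and c: "c \<in> charts M" and d: "d \<in> charts N" and p: "p \<in> fst c" "f p \<in> fst d"
  shows "(in_charts c k (\<lambda>x. g (f x)) has_derivative (\<lambda>v. T (tangent_map c d f p v))) (at (snd c p))"
proof -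
  have fp: "in_charts c d f (snd c p) = snd d (f p)" using c p by (simp add: in_charts_def)
  have 1: "((\<lambda>x. in_charts d k g (in_charts c d f x)) has_derivative (\<lambda>v. T (tangent_map c d f p v))) (at (snd c p))"
    by (rule has_derivative_compose[OF mdiff_has_derivative[OF mdiff c d p]]) (simp add: fp g)
  have "\<forall>\<^sub>F x in nhds (snd c p). in_charts d k g (in_charts c d f x) = in_charts c k (\<lambda>x. g (f x)) x"
    using eventually_map_in_chart[OF c d p] by eventually_elim (simp add: in_charts_def d)
  then show ?thesis
    by (intro has_derivative_transform_eventually[OF 1])
      (auto dest: eventually_nhds_x_imp_x simp: eventually_at_filter elim: eventually_mono)
qed

lemma tangent_map_comp:
  assumes g: "mdiff N P g" and ck: "c \<in> charts M" "d \<in> charts N" "k \<in> charts P"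
    and p: "p \<in> fst c" "f p \<in> fst d" "g (f p) \<in> fst k"
  shows "tangent_map c k (\<lambda>x. g (f x)) p v = tangent_map d k g (f p) (tangent_map c d f p v)"
proof -
  have "tangent_map c k (\<lambda>x. g (f x)) p = (\<lambda>v. tangent_map d k g (f p) (tangent_map c d f p v))"
    unfolding tangent_map_def[of c k]
    by (rule frechet_derivative_at[symmetric], rule has_derivative_comp[OF mdiff_has_derivative[OF g]]) (use ck p in auto)
  then show ?thesis by simp
qed

lemma mdiff_comp:
  assumes g: "mdiff N P g"
  shows "mdiff M P (\<lambda>x. g (f x))"
  unfolding mdiff_def
proof (intro conjI ballI impI)
  show "continuous_map (mtop M) (mtop P) (\<lambda>x. g (f x))"
    using continuous_map_compose[OF mdiff_continuous[OF mdiff] mdiff_continuous[OF g]] by (simp add: o_def)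
next
  fix c k p assume h: "c \<in> charts M" "k \<in> charts P" "p \<in> fst c" "g (f p) \<in> fst k"
  then have "p \<in> topspace (mtop M)" using M.chart_subset by blast
  then have "f p \<in> topspace (mtop N)"
    using mdiff_continuous[OF mdiff] by (auto simp: continuous_map_def)
  then obtain d where "d \<in> charts N" "f p \<in> fst d" by (rule N.obtain_chart)
  then show "in_charts c k (\<lambda>x. g (f x)) differentiable (at (snd c p))"
    unfolding differentiable_def
    using has_derivative_comp[OF mdiff_has_derivative[OF g]] h by blast
qed

text \<open>The manifold form of \<open>zero_derivative_comp\<close>; left translation, inversion
  and conjugation of curves are all treated as instances of it.\<close>

lemma zero_derivative_push:
  fixes \<gamma> :: "real \<Rightarrow> 'a"
  assumes \<gamma>: "limitin (mtop M) \<gamma> (\<gamma> t) (at t within S)" and t: "t \<in> S"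
    and der: "zero_deriv (\<lambda>s. snd c (\<gamma> s) - H s) t S"
    and H: "C-lipschitz_on S H"
    and c: "c \<in> charts M" and d: "d \<in> charts N" and p: "\<gamma> t \<in> fst c" "f (\<gamma> t) \<in> fst d"
  shows "zero_deriv (\<lambda>s. snd d (f (\<gamma> s)) - tangent_map c d f (\<gamma> t) (H s)) t S"
proof -
  have 1: "zero_deriv (\<lambda>s. in_charts c d f (snd c (\<gamma> s)) - tangent_map c d f (\<gamma> t) (H s)) t S"
    by (rule zero_derivative_comp[where x="\<lambda>s. snd c (\<gamma> s)", OF der H t mdiff_has_derivative[OF mdiff c d p]])
  show ?thesis
  proof (rule has_derivative_transform_eventually[OF 1 _ _ t])
    show "\<forall>\<^sub>F s in at t within S. in_charts c d f (snd c (\<gamma> s)) - tangent_map c d f (\<gamma> t) (H s)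
        = snd d (f (\<gamma> s)) - tangent_map c d f (\<gamma> t) (H s)"
      using M.limitin_in_chart[OF c \<gamma> p(1)] by eventually_elim (simp add: in_charts_def c)
  qed (simp add: in_charts_def c p)
qed

end

lemma in_charts_cong:
  assumes "atlas M" "c \<in> charts M" "p \<in> fst c" "\<And>x. x \<in> topspace (mtop M) \<Longrightarrow> f x = g x"
    and "(in_charts c d f has_derivative T) (at (snd c p))"
  shows "(in_charts c d g has_derivative T) (at (snd c p))"
proof -
  interpret atlas M by fact
  have "\<forall>\<^sub>F x in nhds (snd c p). in_charts c d f x = in_charts c d g x"
    using eventually_chart_inv_in[OF assms(2,3) chart_openin[OF assms(2)] assms(3)]
    by eventually_elim (use assms(4) chart_subset[OF assms(2)] in \<open>auto simp: in_charts_def\<close>)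
  then show ?thesis
    by (intro has_derivative_transform_eventually[OF assms(5)])
      (auto dest: eventually_nhds_x_imp_x simp: eventually_at_filter elim: eventually_mono)
qed

lemma tangent_map_cong:
  assumes "atlas M" "mdiff M N f" "c \<in> charts M" "d \<in> charts N" "p \<in> fst c" "f p \<in> fst d"
    "\<And>x. x \<in> topspace (mtop M) \<Longrightarrow> f x = g x"
  shows "tangent_map c d g p = tangent_map c d f p"
  unfolding tangent_map_def[of c d g]
  by (rule frechet_derivative_at[symmetric], rule in_charts_cong[OF assms(1,3,5,7) mdiff_has_derivative[OF assms(2-6)]])

lemma inv_into_map_prod:
  assumes "inj_on f A" "inj_on g B" "x \<in> f ` A" "y \<in> g ` B"
  shows "inv_into (A \<times> B) (map_prod f g) (x, y) = (inv_into A f x, inv_into B g y)"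
proof -
  obtain a b where ab: "a \<in> A" "b \<in> B" "x = f a" "y = g b" using assms by blast
  have "inj_on (map_prod f g) (A \<times> B)" using assms by (auto simp: inj_on_def)
  from inv_into_f_f[OF this, of "(a, b)"] ab assms show ?thesis by simp
qed

text \<open>Smoothness on a product manifold, unpacked into coordinates. \<open>U\<close> consists
  of coordinates at which both inverse charts are meaningful and the value stays in the chart
  \<open>k\<close>; a whole neighbourhood is required because first derivatives are differentiated
  again.\<close>

lemma smooth_map_product_C2:
  fixes M :: "('a, 'e::euclidean_space) manifold" and N :: "('b, 'f::euclidean_space) manifold"
    and P :: "('c, 'g::euclidean_space) manifold"
  assumes "atlas M" "atlas N" and f: "smooth_map (product_manifold M N) P f"
    and k: "c \<in> charts M" "d \<in> charts N" "k \<in> charts P" and open_k: "openin (mtop P) (fst k)"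
    and p: "p \<in> fst c" and q: "q \<in> fst d" and fpq: "f (p, q) \<in> fst k"
  obtains U \<mu>' \<mu>'' where "open U" "(snd c p, snd d q) \<in> U" "U \<subseteq> snd c ` fst c \<times> snd d ` fst d"
    "\<And>z. z \<in> U \<Longrightarrow> f (chart_inv c (fst z), chart_inv d (snd z)) \<in> fst k"
    "\<And>z. z \<in> U \<Longrightarrow> ((\<lambda>z. snd k (f (chart_inv c (fst z), chart_inv d (snd z)))) has_derivative \<mu>' z) (at z)"
    "\<And>z v. z \<in> U \<Longrightarrow> ((\<lambda>z. \<mu>' z v) has_derivative \<mu>'' v z) (at z)"
    "\<And>v w. continuous_on U (\<lambda>z. \<mu>'' v z w)"
proof -
  interpret M: atlas M by fact
  interpret N: atlas N by fact
  let ?I = "snd c ` fst c \<times> snd d ` fst d"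
  let ?g = "\<lambda>z. f (chart_inv c (fst z), chart_inv d (snd z))"
  let ?cd = "(fst c \<times> fst d, map_prod (snd c) (snd d))"
  have opI: "open ?I" using M.chart_open_image[OF k(1)] N.chart_open_image[OF k(2)] by (rule open_Times)
  have lim: "limitin (mtop P) ?g (f (p, q)) (nhds (snd c p, snd d q))"
  proof -
    have "limitin (mtop M) (\<lambda>z. chart_inv c (fst z)) p (nhds (snd c p, snd d q))"
      by (rule M.limitin_chart_inv[OF k(1) _ p]) (auto intro!: tendsto_eq_intros filterlim_ident)
    moreover have "limitin (mtop N) (\<lambda>z. chart_inv d (snd z)) q (nhds (snd c p, snd d q))"
      by (rule N.limitin_chart_inv[OF k(2) _ q]) (auto intro!: tendsto_eq_intros filterlim_ident)
    ultimately have "limitin (prod_topology (mtop M) (mtop N)) (\<lambda>z. (chart_inv c (fst z), chart_inv d (snd z))) (p, q) (nhds (snd c p, snd d q))"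
      by (simp add: limitin_pairwise o_def)
    moreover have "continuous_map (prod_topology (mtop M) (mtop N)) (mtop P) f"
      using f by (simp add: smooth_map_def product_manifold_def)
    ultimately show ?thesis using continuous_map_limit by (fastforce simp: o_def)
  qed
  have "\<forall>\<^sub>F z in nhds (snd c p, snd d q). ?g z \<in> fst k \<and> z \<in> ?I"
    by (intro eventually_conj limitinD[OF lim] eventually_nhds_in_open opI open_k fpq) (use p q in auto)
  then obtain U where U: "open U" "(snd c p, snd d q) \<in> U" "\<And>z. z \<in> U \<Longrightarrow> ?g z \<in> fst k" "\<And>z. z \<in> U \<Longrightarrow> z \<in> ?I"
    unfolding eventually_nhds by blast
  have eq: "in_charts ?cd k f z = snd k (?g z)" if "z \<in> U" for z
    using U(4)[OF that] inv_into_map_prod[OF M.chart_inj[OF k(1)] N.chart_inj[OF k(2)], of "fst z" "snd z"]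
    by (auto simp: in_charts_def)
  have "?cd \<in> charts (product_manifold M N)"
    unfolding product_manifold_def manifold.simps using k by blast
  then have sm: "smooth_on (snd ?cd ` {pq \<in> fst ?cd. f pq \<in> fst k}) (in_charts ?cd k f)"
    using f k(3) unfolding smooth_map_def by blast
  have sub: "z \<in> snd ?cd ` {pq \<in> fst ?cd. f pq \<in> fst k}" if z: "z \<in> U" for z
  proof -
    obtain a b where ab: "a \<in> fst c" "b \<in> fst d" "z = (snd c a, snd d b)"
      using U(4)[OF z] by (auto simp: mem_Times_iff prod_eq_iff)
    then have "f (a, b) \<in> fst k" using U(3)[OF z] k by simp
    then show ?thesis using ab by (auto intro!: image_eqI[of _ _ "(a, b)"])
  qed
  show thesis
  proof (rule smooth_on_C2[OF sm])
    fix \<mu>' \<mu>'' assume \<mu>: "\<And>x. x \<in> snd ?cd ` {pq \<in> fst ?cd. f pq \<in> fst k} \<Longrightarrow> (in_charts ?cd k f has_derivative \<mu>' x) (at x)"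
    "\<And>x v. x \<in> snd ?cd ` {pq \<in> fst ?cd. f pq \<in> fst k} \<Longrightarrow> ((\<lambda>x. \<mu>' x v) has_derivative \<mu>'' v x) (at x)"
    "\<And>v w. continuous_on (snd ?cd ` {pq \<in> fst ?cd. f pq \<in> fst k}) (\<lambda>x. \<mu>'' v x w)"
  show thesis
  proof (rule that[OF U(1,2)])
    show "U \<subseteq> ?I" using U(4) by blast
    show "((\<lambda>z. snd k (?g z)) has_derivative \<mu>' z) (at z)" if "z \<in> U" for z
      by (rule has_derivative_transform_within_open[OF \<mu>(1)[OF sub[OF that]] U(1) that]) (rule eq)
    show "((\<lambda>z. \<mu>' z v) has_derivative \<mu>'' v z) (at z)" if "z \<in> U" for z v
      by (rule \<mu>(2)[OF sub[OF that]])
    show "continuous_on U (\<lambda>z. \<mu>'' v z w)" for v w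
      by (rule continuous_on_subset[OF \<mu>(3)]) (use sub in blast)
  qed (use U in auto)
  qed
qed

section \<open>Translations and the adjoint representation\<close>

locale lie_gp = group G + atlas M
  for G :: "('a, 'z) monoid_scheme" (structure) and M :: "('a, 'e::euclidean_space) manifold" +
  assumes lie_group: "lie_group G M"

lemma lie_group_imp_lie_gp: "lie_group G M \<Longrightarrow> lie_gp G M"
  unfolding lie_gp_def lie_gp_axioms_def atlas_def lie_group_def by blast

context lie_gp
begin

abbreviation c0 :: "('a, 'e) chart" where "c0 \<equiv> id_chart G M"
abbreviation coord :: "'a \<Rightarrow> 'e" where "coord \<equiv> snd c0"
abbreviation pt :: "'e \<Rightarrow> 'a" where "pt \<equiv> chart_inv c0"
abbreviation e0 :: 'e where "e0 \<equiv> coord \<one>"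
abbreviation lf :: "('a, 'e) chart \<Rightarrow> 'a \<Rightarrow> 'e \<Rightarrow> 'e" where "lf c p v \<equiv> left_inv_field G M c v p"
abbreviation br :: "'e \<Rightarrow> 'e \<Rightarrow> 'e" where "br \<equiv> lie_bracket G M"

lemma topspace [simp]: "topspace (mtop M) = carrier G"
  and mult_smooth: "smooth_map (product_manifold M M) M (\<lambda>(x, y). x \<otimes> y)"
  and inv_smooth: "smooth_map M M (\<lambda>x. inv x)"
  using lie_group by (auto simp: lie_group_def)

lemma c0: "c0 \<in> charts M" "\<one> \<in> fst c0"
proof -
  have "\<exists>c. c \<in> charts M \<and> \<one> \<in> fst c"
    using charts_cover topspace one_closed by blast
  then have "c0 \<in> charts M \<and> \<one> \<in> fst c0" unfolding id_chart_def by (rule someI_ex)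
  then show "c0 \<in> charts M" "\<one> \<in> fst c0" by auto
qed

lemma chart_carrier: "c \<in> charts M \<Longrightarrow> p \<in> fst c \<Longrightarrow> p \<in> carrier G"
  using chart_subset topspace by blast

lemma limitin_mult:
  assumes "limitin (mtop M) f p F" "limitin (mtop M) g q F"
  shows "limitin (mtop M) (\<lambda>x. f x \<otimes> g x) (p \<otimes> q) F"
proof -
  have "limitin (prod_topology (mtop M) (mtop M)) (\<lambda>x. (f x, g x)) (p, q) F"
    using assms by (simp add: limitin_pairwise o_def)
  moreover have "continuous_map (prod_topology (mtop M) (mtop M)) (mtop M) (\<lambda>(x, y). x \<otimes> y)"
    using mult_smooth by (simp add: smooth_map_def product_manifold_def)
  ultimately show ?thesis using continuous_map_limit by (fastforce simp: o_def)
qed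

lemma mdiff_inv: "mdiff M M (\<lambda>x. inv x)"
  by (rule smooth_map_imp_mdiff[OF inv_smooth])

lemma limitin_inv: "limitin (mtop M) f p F \<Longrightarrow> limitin (mtop M) (\<lambda>x. inv (f x)) (inv p) F"
  using continuous_map_limit[OF mdiff_continuous[OF mdiff_inv]] by (auto simp: o_def)

lemma mult_C2:
  assumes "c \<in> charts M" "d \<in> charts M" "k \<in> charts M" "p \<in> fst c" "q \<in> fst d" "p \<otimes> q \<in> fst k"
  obtains U \<mu>' \<mu>'' where "open U" "(snd c p, snd d q) \<in> U" "U \<subseteq> snd c ` fst c \<times> snd d ` fst d"
    "\<And>z. z \<in> U \<Longrightarrow> chart_inv c (fst z) \<otimes> chart_inv d (snd z) \<in> fst k"
    "\<And>z. z \<in> U \<Longrightarrow> ((\<lambda>z. snd k (chart_inv c (fst z) \<otimes> chart_inv d (snd z))) has_derivative \<mu>' z) (at z)"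
    "\<And>z v. z \<in> U \<Longrightarrow> ((\<lambda>z. \<mu>' z v) has_derivative \<mu>'' v z) (at z)"
    "\<And>v w. continuous_on U (\<lambda>z. \<mu>'' v z w)"
proof (rule smooth_map_product_C2[OF atlas_axioms atlas_axioms mult_smooth assms(1,2,3) chart_openin[OF assms(3)] assms(4,5)], goal_cases)
  case 1 then show ?case using assms(6) by simp
next
  case (2 U \<mu>' \<mu>'')
  then show ?case by (intro that[of U \<mu>' \<mu>'']) simp_all
qed

text \<open>A translation is the multiplication restricted to a slice, so its derivative is a
  partial derivative of the multiplication.\<close>

lemma
  assumes p: "p \<in> carrier G"
  shows mdiff_left: "mdiff M M (\<lambda>q. p \<otimes> q)" and mdiff_right: "mdiff M M (\<lambda>q. q \<otimes> p)"
proof -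
  have lim: "continuous_map (mtop M) (prod_topology (mtop M) (mtop M)) (\<lambda>q. (p, q))"
    "continuous_map (mtop M) (prod_topology (mtop M) (mtop M)) (\<lambda>q. (q, p))"
    using p by (simp_all add: continuous_map_pairwise o_def)
  have cm: "continuous_map (prod_topology (mtop M) (mtop M)) (mtop M) (\<lambda>(x, y). x \<otimes> y)"
    using mult_smooth by (simp add: smooth_map_def product_manifold_def)
  obtain b where b: "b \<in> charts M" "p \<in> fst b" using obtain_chart[of p] p by auto
  show "mdiff M M (\<lambda>q. p \<otimes> q)"
    unfolding mdiff_def
  proof (intro conjI ballI impI)
    show "continuous_map (mtop M) (mtop M) (\<lambda>q. p \<otimes> q)"
      using continuous_map_compose[OF lim(1) cm] by (simp add: o_def)
    fix c d q assume h: "c \<in> charts M" "d \<in> charts M" "q \<in> fst c" "p \<otimes> q \<in> fst d"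
    show "in_charts c d (\<lambda>q. p \<otimes> q) differentiable (at (snd c q))"
    proof (rule mult_C2[OF b(1) h(1,2) b(2) h(3,4)])
      fix U \<mu>' assume U: "(snd b p, snd c q) \<in> U" 
        "\<And>z. z \<in> U \<Longrightarrow> ((\<lambda>z. snd d (chart_inv b (fst z) \<otimes> chart_inv c (snd z))) has_derivative \<mu>' z) (at z)"
      have 1: "((\<lambda>x. (snd b p, x)) has_derivative (\<lambda>v. (0, v))) (at (snd c q))"
        by (auto intro!: derivative_eq_intros)
      from has_derivative_compose[OF 1 U(2)[OF U(1)]]
      show ?thesis using b by (auto simp: in_charts_def o_def differentiable_def)
    qed
  qed
  show "mdiff M M (\<lambda>q. q \<otimes> p)"
    unfolding mdiff_def
  proof (intro conjI ballI impI)
    show "continuous_map (mtop M) (mtop M) (\<lambda>q. q \<otimes> p)"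
      using continuous_map_compose[OF lim(2) cm] by (simp add: o_def)
    fix c d q assume h: "c \<in> charts M" "d \<in> charts M" "q \<in> fst c" "q \<otimes> p \<in> fst d"
    show "in_charts c d (\<lambda>q. q \<otimes> p) differentiable (at (snd c q))"
    proof (rule mult_C2[OF h(1) b(1) h(2,3) b(2) h(4)])
      fix U \<mu>' assume U: "(snd c q, snd b p) \<in> U"
        "\<And>z. z \<in> U \<Longrightarrow> ((\<lambda>z. snd d (chart_inv c (fst z) \<otimes> chart_inv b (snd z))) has_derivative \<mu>' z) (at z)"
      have 1: "((\<lambda>x. (x, snd b p)) has_derivative (\<lambda>v. (v, 0))) (at (snd c q))"
        by (auto intro!: derivative_eq_intros)
      from has_derivative_compose[OF 1 U(2)[OF U(1)]]
      show ?thesis using b by (auto simp: in_charts_def o_def differentiable_def)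
    qed
  qed
qed

lemma atlas_mapI: "mdiff M M f \<Longrightarrow> atlas_map M M f"
  unfolding atlas_map_def atlas_map_axioms_def using atlas_axioms by simp

lemmas tangent_comp = atlas_map.tangent_map_comp[OF atlas_mapI]
lemmas mdiff_comp' = atlas_map.mdiff_comp[OF atlas_mapI]

lemma tangent_cong:
  assumes "mdiff M M f" "c \<in> charts M" "d \<in> charts M" "p \<in> fst c" "f p \<in> fst d"
    "\<And>x. x \<in> carrier G \<Longrightarrow> f x = g x"
  shows "tangent_map c d g p v = tangent_map c d f p v"
  by (rule fun_cong[OF tangent_map_cong[OF atlas_axioms assms(1-5)]]) (use assms(6) topspace in blast)

lemma mdiff_ident: "mdiff M M (\<lambda>x. x)"
  unfolding mdiff_def
proof (intro conjI ballI impI)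
  fix c d p assume h: "c \<in> charts M" "d \<in> charts M" "p \<in> fst c" "p \<in> fst d"
  have sm: "smooth_on (snd c ` (fst c \<inter> fst d)) (in_charts c d id)"
    using smooth_manifold h unfolding smooth_manifold_def by blast
  have "in_charts c d id differentiable (at (snd c p))"
    by (rule smooth_on_imp_differentiable[OF sm]) (use h in auto)
  then show "in_charts c d (\<lambda>x. x) differentiable (at (snd c p))"
    by (simp add: id_def)
qed simp

lemma tangent_left_inverse:
  assumes f: "mdiff M M f" and g: "mdiff M M g" and gf: "\<And>x. x \<in> carrier G \<Longrightarrow> g (f x) = x"
    and c: "c \<in> charts M" "d \<in> charts M" "p \<in> fst c" "f p \<in> fst d"
  shows "tangent_map d c g (f p) (tangent_map c d f p v) = v"
proof -
  have gfp: "g (f p) = p" using gf c chart_carrier by blast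
  have "tangent_map d c g (f p) (tangent_map c d f p v) = tangent_map c c (\<lambda>x. g (f x)) p v"
    by (rule tangent_comp[OF f g c(1,2,1,3,4), symmetric]) (simp add: gfp c)
  also have "\<dots> = tangent_map c c (\<lambda>x. x) p v"
    by (rule tangent_cong[OF mdiff_ident]) (use c gf in auto)
  finally show ?thesis by (simp add: tangent_map_id c)
qed

lemma lf_linear: "c \<in> charts M \<Longrightarrow> p \<in> fst c \<Longrightarrow> linear (lf c p)"
  unfolding left_inv_field_def
  using mdiff_linear[OF mdiff_left c0(1) _ c0(2), of p c] chart_carrier[of c p] by simp

lemma lf_left_inverse:
  assumes c: "c \<in> charts M" "p \<in> fst c"
  shows "tangent_map c c0 (\<lambda>q. inv p \<otimes> q) p (lf c p v) = v"
proof -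
  have p: "p \<in> carrier G" using c chart_carrier by blast
  have "tangent_map c c0 (\<lambda>q. inv p \<otimes> q) (p \<otimes> \<one>) (tangent_map c0 c (\<lambda>q. p \<otimes> q) \<one> v) = v"
    by (rule tangent_left_inverse[OF mdiff_left mdiff_left]) (use p c c0 in \<open>auto simp: m_assoc[symmetric]\<close>)
  then show ?thesis using p by (simp add: left_inv_field_def)
qed

section \<open>Right-invariant fields and the adjoint representation\<close>

text \<open>In the chart at the identity, the value at \<open>p\<close> of the right-invariant field
  that equals \<open>u\<close> at the identity.\<close>

definition rf :: "'a \<Rightarrow> 'e \<Rightarrow> 'e" where
  "rf p u = tangent_map c0 c0 (\<lambda>q. q \<otimes> p) \<one> u"

definition Ad :: "'a \<Rightarrow> 'e \<Rightarrow> 'e" where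
  "Ad p v = tangent_map c0 c0 (\<lambda>q. p \<otimes> q \<otimes> inv p) \<one> v"

lemma mdiff_conj: "p \<in> carrier G \<Longrightarrow> mdiff M M (\<lambda>q. p \<otimes> q \<otimes> inv p)"
  using mdiff_comp'[OF mdiff_left mdiff_right] by simp

lemma Ad_linear: "p \<in> carrier G \<Longrightarrow> linear (Ad p)"
  unfolding Ad_def[abs_def]
  using mdiff_linear[OF mdiff_conj c0(1) c0(1) c0(2)] c0 by simp

lemma Ad_one: "Ad \<one> v = v"
proof -
  have "Ad \<one> v = tangent_map c0 c0 (\<lambda>x. x) \<one> v"
    unfolding Ad_def by (rule tangent_cong[OF mdiff_ident]) (use c0 in auto)
  then show ?thesis by (simp add: tangent_map_id c0)
qed

lemma Ad_mult:
  assumes "p \<in> carrier G" "q \<in> carrier G"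
  shows "Ad (p \<otimes> q) v = Ad p (Ad q v)"
proof -
  have "Ad (p \<otimes> q) v = tangent_map c0 c0 (\<lambda>x. p \<otimes> (q \<otimes> x \<otimes> inv q) \<otimes> inv p) \<one> v"
    unfolding Ad_def
    by (rule tangent_cong[OF mdiff_comp'[OF mdiff_conj mdiff_conj]])
      (use assms c0 in \<open>auto simp: m_assoc inv_mult_group\<close>)
  also have "\<dots> = tangent_map c0 c0 (\<lambda>x. p \<otimes> x \<otimes> inv p) (q \<otimes> \<one> \<otimes> inv q) (Ad q v)"
    unfolding Ad_def by (rule tangent_comp[OF mdiff_conj mdiff_conj]) (use assms c0 in auto)
  finally show ?thesis using assms by (simp add: Ad_def)
qed

lemma Ad_inv: "p \<in> carrier G \<Longrightarrow> Ad p (Ad (inv p) v) = v" "p \<in> carrier G \<Longrightarrow> Ad (inv p) (Ad p v) = v"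
  by (simp_all add: Ad_mult[symmetric] Ad_one)

text \<open>Left translation by \<open>p\<close> is conjugation by \<open>p\<close> followed by
  right translation by \<open>p\<close>. Differentiating this identity in \<open>p\<close> is what
  later yields the derivative of \<open>Ad\<close>.\<close>

lemma lf_eq_rf_Ad:
  assumes p: "p \<in> fst c0"
  shows "lf c0 p v = rf p (Ad p v)"
proof -
  have pc: "p \<in> carrier G" using p c0 chart_carrier by blast
  have "lf c0 p v = tangent_map c0 c0 (\<lambda>x. (p \<otimes> x \<otimes> inv p) \<otimes> p) \<one> v"
    unfolding left_inv_field_def
    by (rule tangent_cong[OF mdiff_comp'[OF mdiff_conj mdiff_right]]) (use p pc c0 in \<open>auto simp: m_assoc\<close>)
  also have "\<dots> = tangent_map c0 c0 (\<lambda>x. x \<otimes> p) (p \<otimes> \<one> \<otimes> inv p) (Ad p v)"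
    unfolding Ad_def by (rule tangent_comp[OF mdiff_conj mdiff_right]) (use pc p c0 in auto)
  finally show ?thesis using pc by (simp add: rf_def)
qed

lemma lf_one: "lf c0 \<one> v = v"
proof -
  have "lf c0 \<one> v = tangent_map c0 c0 (\<lambda>x. x) \<one> v"
    unfolding left_inv_field_def by (rule tangent_cong[OF mdiff_ident]) (use c0 in auto)
  then show ?thesis by (simp add: tangent_map_id c0)
qed

lemma rf_one: "rf \<one> v = v"
proof -
  have "rf \<one> v = tangent_map c0 c0 (\<lambda>x. x) \<one> v"
    unfolding rf_def by (rule tangent_cong[OF mdiff_ident]) (use c0 in auto)
  then show ?thesis by (simp add: tangent_map_id c0)
qed

lemma pt_e0 [simp]: "pt e0 = \<one>"
  using c0 by simp

lemma
  assumes c: "c \<in> charts M" and mu: "((\<lambda>z. snd c (chart_inv c (fst z) \<otimes> pt (snd z))) has_derivative \<mu>') (at (x, e0))"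
  shows lf_eq_partial: "lf c (chart_inv c x) v = \<mu>' (0, v)"
proof -
  have 1: "((\<lambda>y. (x, y)) has_derivative (\<lambda>v. (0, v))) (at e0)"
    by (auto intro!: derivative_eq_intros)
  have "(in_charts c0 c (\<lambda>q. chart_inv c x \<otimes> q) has_derivative (\<lambda>v. \<mu>' (0, v))) (at e0)"
    using has_derivative_compose[OF 1 mu] by (simp add: in_charts_def o_def)
  from fun_cong[OF frechet_derivative_at[OF this], of v] show ?thesis
    by (simp add: left_inv_field_def tangent_map_def)
qed

lemma rf_eq_partial:
  assumes mu: "((\<lambda>z. coord (pt (fst z) \<otimes> pt (snd z))) has_derivative \<mu>') (at (e0, x))"
  shows "rf (pt x) v = \<mu>' (v, 0)"
proof -
  have 1: "((\<lambda>y. (y, x)) has_derivative (\<lambda>v. (v, 0))) (at e0)"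
    by (auto intro!: derivative_eq_intros)
  have "(in_charts c0 c0 (\<lambda>q. q \<otimes> pt x) has_derivative (\<lambda>v. \<mu>' (v, 0))) (at e0)"
    using has_derivative_compose[OF 1 mu] by (simp add: in_charts_def o_def)
  from fun_cong[OF frechet_derivative_at[OF this], of v] show ?thesis
    by (simp add: rf_def tangent_map_def)
qed

text \<open>The field is a partial derivative of the multiplication in its second argument, so two
  derivatives of the multiplication make it continuously differentiable.\<close>

lemma lf_C1:
  assumes c: "c \<in> charts M" and p: "p \<in> fst c"
  obtains U D where "open U" "snd c p \<in> U" "U \<subseteq> snd c ` fst c"
    "\<And>x v. x \<in> U \<Longrightarrow> ((\<lambda>x. lf c (chart_inv c x) v) has_derivative D v x) (at x)"
    "\<And>v w. continuous_on U (\<lambda>x. D v x w)"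
proof (rule mult_C2[OF c c0(1) c p c0(2)])
  show "p \<otimes> \<one> \<in> fst c" using c p chart_carrier by auto
  fix U \<mu>' \<mu>'' assume U: "open U" "(snd c p, e0) \<in> U" "U \<subseteq> snd c ` fst c \<times> coord ` fst c0"
    "\<And>z. z \<in> U \<Longrightarrow> ((\<lambda>z. snd c (chart_inv c (fst z) \<otimes> pt (snd z))) has_derivative \<mu>' z) (at z)"
    "\<And>z v. z \<in> U \<Longrightarrow> ((\<lambda>z. \<mu>' z v) has_derivative \<mu>'' v z) (at z)"
    "\<And>v w. continuous_on U (\<lambda>z. \<mu>'' v z w)"
  define V where "V = (\<lambda>x. (x, e0)) -` U"
  have V: "open V" unfolding V_def by (intro open_vimage U continuous_intros)
  have inU: "(x, e0) \<in> U" if "x \<in> V" for x using that by (simp add: V_def)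
  show thesis
  proof (rule that[of V "\<lambda>v x w. \<mu>'' (0, v) (x, e0) (w, 0)"])
    show "((\<lambda>x. lf c (chart_inv c x) v) has_derivative (\<lambda>w. \<mu>'' (0, v) (x, e0) (w, 0))) (at x)" if x: "x \<in> V" for x v
    proof (rule has_derivative_transform_within_open[OF _ V x])
      have 1: "((\<lambda>x. (x, e0)) has_derivative (\<lambda>v. (v, 0))) (at x)"
        by (auto intro!: derivative_eq_intros)
      show "((\<lambda>x. \<mu>' (x, e0) (0, v)) has_derivative (\<lambda>w. \<mu>'' (0, v) (x, e0) (w, 0))) (at x)"
        by (rule has_derivative_compose[OF 1 U(5)[OF inU[OF x]]])
      show "\<mu>' (y, e0) (0, v) = lf c (chart_inv c y) v" if "y \<in> V" for y
        using lf_eq_partial[OF c U(4)[OF inU[OF that]]] by simp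
    qed
    show "continuous_on V (\<lambda>x. \<mu>'' (0, v) (x, e0) (w, 0))" for v w
      by (rule continuous_on_compose2[OF U(6)]) (use inU in \<open>auto intro!: continuous_intros\<close>)
  qed (use V U in \<open>auto simp: V_def\<close>)
qed

lemma tendsto_lf:
  assumes c: "c \<in> charts M" and p: "p \<in> fst c" and g: "limitin (mtop M) g p F"
  shows "((\<lambda>s. lf c (g s) v) \<longlongrightarrow> lf c p v) F"
proof (rule lf_C1[OF c p])
  fix U D assume U: "snd c p \<in> U" "\<And>x v. x \<in> U \<Longrightarrow> ((\<lambda>x. lf c (chart_inv c x) v) has_derivative D v x) (at x)"
  have "isCont (\<lambda>x. lf c (chart_inv c x) v) (snd c p)"
    using U by (intro has_derivative_continuous) auto
  from isCont_tendsto_compose[OF this limitin_chart[OF c g p]]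
  have "((\<lambda>s. lf c (chart_inv c (snd c (g s))) v) \<longlongrightarrow> lf c p v) F" using c p by simp
  moreover have "\<forall>\<^sub>F s in F. lf c (chart_inv c (snd c (g s))) v = lf c (g s) v"
    using limitin_in_chart[OF c g p] by eventually_elim (simp add: c)
  ultimately show ?thesis by (rule Lim_transform_eventually)
qed

text \<open>\<open>B\<close> is the mixed second derivative of the multiplication at
  \<open>(e0, e0)\<close>. The same \<open>B\<close> serves both families of fields because the
  order of differentiation can be exchanged.\<close>

lemma local_second_order:
  obtains B where
    "\<And>v. ((\<lambda>x. lf c0 (pt x) v) has_derivative (\<lambda>w. B w v)) (at e0)"
    "\<And>u. ((\<lambda>x. rf (pt x) u) has_derivative (\<lambda>w. B u w)) (at e0)"
proof (rule mult_C2[OF c0(1) c0(1) c0(1) c0(2) c0(2)])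
  show "\<one> \<otimes> \<one> \<in> fst c0" using c0 by simp
  fix U \<mu>' \<mu>'' assume U: "open U" "(e0, e0) \<in> U"
    "\<And>z. z \<in> U \<Longrightarrow> ((\<lambda>z. coord (pt (fst z) \<otimes> pt (snd z))) has_derivative \<mu>' z) (at z)"
    "\<And>z v. z \<in> U \<Longrightarrow> ((\<lambda>z. \<mu>' z v) has_derivative \<mu>'' v z) (at z)"
  define B where "B w v = \<mu>'' (0, v) (e0, e0) (w, 0)" for w v
  have B': "\<mu>'' (u, 0) (e0, e0) (0, w) = B u w" for u w
    unfolding B_def by (rule second_derivative_symmetric[OF U(1,2,3) U(4)[OF U(2)] U(4)[OF U(2)]])
  show thesis
  proof (rule that[of B])
    fix v
    show "((\<lambda>x. lf c0 (pt x) v) has_derivative (\<lambda>w. B w v)) (at e0)"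
    proof (rule has_derivative_transform_within_open[where f="\<lambda>x. \<mu>' (x, e0) (0, v)" and s="(\<lambda>x. (x, e0)) -` U"])
      have 1: "((\<lambda>x. (x, e0)) has_derivative (\<lambda>v. (v, 0))) (at e0)"
        by (auto intro!: derivative_eq_intros)
      show "((\<lambda>x. \<mu>' (x, e0) (0, v)) has_derivative (\<lambda>w. B w v)) (at e0)"
        unfolding B_def by (rule has_derivative_compose[OF 1 U(4)[OF U(2)]])
      show "open ((\<lambda>x. (x, e0)) -` U)" by (intro open_vimage U continuous_intros)
      show "e0 \<in> (\<lambda>x. (x, e0)) -` U" using U(2) by simp
      show "\<mu>' (y, e0) (0, v) = lf c0 (pt y) v" if "y \<in> (\<lambda>x. (x, e0)) -` U" for y
        by (rule lf_eq_partial[OF c0(1) U(3), symmetric]) (use that in simp)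
    qed
  next
    fix u
    show "((\<lambda>x. rf (pt x) u) has_derivative (\<lambda>w. B u w)) (at e0)"
    proof (rule has_derivative_transform_within_open[where f="\<lambda>x. \<mu>' (e0, x) (u, 0)" and s="(\<lambda>x. (e0, x)) -` U"])
      have 1: "((\<lambda>x. (e0, x)) has_derivative (\<lambda>v. (0, v))) (at e0)"
        by (auto intro!: derivative_eq_intros)
      show "((\<lambda>x. \<mu>' (e0, x) (u, 0)) has_derivative (\<lambda>w. B u w)) (at e0)"
        unfolding B'[symmetric] by (rule has_derivative_compose[OF 1 U(4)[OF U(2)]])
      show "open ((\<lambda>x. (e0, x)) -` U)" by (intro open_vimage U continuous_intros)
      show "e0 \<in> (\<lambda>x. (e0, x)) -` U" using U(2) by simp
      show "\<mu>' (e0, y) (u, 0) = rf (pt y) u" if "y \<in> (\<lambda>x. (e0, x)) -` U" for y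
        by (rule rf_eq_partial[OF U(3), symmetric]) (use that in simp)
    qed
  qed
qed

lemma rf_linear: "p \<in> fst c0 \<Longrightarrow> linear (rf p)"
  unfolding rf_def[abs_def]
  using mdiff_linear[OF mdiff_right c0(1) c0(1) c0(2), of p] c0 chart_carrier by simp

text \<open>Solve \<open>lf = rf \<circ> Ad\<close> for \<open>Ad\<close>. Near the identity
  \<open>rf\<close> is uniformly close to the identity map, which first bounds
  \<open>Ad (pt x) v\<close> and then brings it close to \<open>lf\<close>, hence to
  \<open>v\<close>. The derivative of \<open>Ad\<close> rests on this, since the product rule used
  there needs the continuity of one factor.\<close>

lemma tendsto_Ad_pt: "((\<lambda>x. Ad (pt x) v) \<longlongrightarrow> v) (at e0)"
proof (rule local_second_order)
  fix B assume L: "\<And>v. ((\<lambda>x. lf c0 (pt x) v) has_derivative (\<lambda>w. B w v)) (at e0)"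
    and R: "\<And>u. ((\<lambda>x. rf (pt x) u) has_derivative (\<lambda>w. B u w)) (at e0)"
  have lL: "((\<lambda>x. lf c0 (pt x) v) \<longlongrightarrow> v) (at e0)"
    using has_derivative_continuous[OF L, of v] by (simp add: isCont_def lf_one)
  have lR: "((\<lambda>x. rf (pt x) u) \<longlongrightarrow> u) (at e0)" for u
    using has_derivative_continuous[OF R, of u] by (simp add: isCont_def rf_one)
  have inc: "\<forall>\<^sub>F x in at e0. pt x \<in> fst c0"
    using eventually_chart_inv_in[OF c0 chart_openin[OF c0(1)] c0(2)] by (simp add: eventually_at_filter eventually_mono)
  have close: "\<forall>\<^sub>F x in at e0. \<forall>u. norm (rf (pt x) u - u) \<le> \<epsilon> * norm u" if "\<epsilon> > 0" for \<epsilon>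
    by (rule eventually_linear_close[OF lR _ _ that])
      (use inc in \<open>auto intro: linear_ident rf_linear elim: eventually_mono\<close>)
  show ?thesis
  proof (rule tendstoI)
    fix \<epsilon> :: real assume \<epsilon>: "\<epsilon> > 0"
    \<comment> \<open>The entry \<open>1/2\<close> gives the a priori bound
      \<open>2 * (norm v + 1)\<close> for \<open>Ad (pt x) v\<close>; the other entry makes
      \<open>\<delta>\<close> times this bound at most \<open>\<epsilon> / 2\<close>.\<close>
    define \<delta> where "\<delta> = min (1/2) (\<epsilon> / (4 * (norm v + 1)))"
    have \<delta>: "\<delta> > 0" "\<delta> \<le> 1/2"
      using \<epsilon> unfolding \<delta>_def by (simp_all only: min.cobounded1) (simp add: add_nonneg_pos)
    have \<delta>': "\<delta> * (2 * (norm v + 1)) \<le> \<epsilon> / 2"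
    proof -
      have "\<delta> * (2 * (norm v + 1)) \<le> \<epsilon> / (4 * (norm v + 1)) * (2 * (norm v + 1))"
        by (intro mult_right_mono) (auto simp: \<delta>_def)
      also have "\<dots> = \<epsilon> / 2" by (simp add: field_simps add_nonneg_eq_0_iff)
      finally show ?thesis .
    qed
    have "\<forall>\<^sub>F x in at e0. dist (lf c0 (pt x) v) v < min 1 (\<epsilon> / 2)"
      by (rule tendstoD[OF lL]) (use \<epsilon> in simp)
    with close[OF \<delta>(1)] inc show "\<forall>\<^sub>F x in at e0. dist (Ad (pt x) v) v < \<epsilon>"
    proof eventually_elim
      case (elim x)
      let ?a = "Ad (pt x) v" and ?l = "lf c0 (pt x) v"
      have l: "?l = rf (pt x) ?a" by (rule lf_eq_rf_Ad[OF elim(2)])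
      have 1: "norm (?l - ?a) \<le> \<delta> * norm ?a" using elim(1) l by metis
      also have "\<dots> \<le> 1/2 * norm ?a" using \<delta> by (intro mult_right_mono) auto
      finally have "norm ?a \<le> 2 * norm ?l"
        using norm_triangle_sub[of ?a ?l] by (simp add: norm_minus_commute)
      also have "norm ?l \<le> norm v + 1"
        using elim(3) norm_triangle_sub[of ?l v] by (simp add: dist_norm)
      finally have "norm ?a \<le> 2 * (norm v + 1)" by simp
      then have "\<delta> * norm ?a \<le> \<epsilon> / 2" using \<delta>' \<delta>(1) by (meson less_imp_le mult_left_mono order_trans)
      then have "norm (?l - ?a) \<le> \<epsilon> / 2" using 1 by simp
      moreover have "norm (?l - v) < \<epsilon> / 2" using elim(3) by (simp add: dist_norm)
      ultimately show ?case
        using norm_triangle_ineq4[of "?l - v" "?l - ?a"] by (simp add: dist_norm)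
    qed
  qed
qed

text \<open>Differentiate \<open>lf = rf \<circ> Ad\<close> at the identity; the two mixed second derivatives of the
  multiplication coincide, which turns the difference into the bracket.\<close>

lemma Ad_has_derivative: "((\<lambda>x. Ad (pt x) v) has_derivative (\<lambda>w. br w v)) (at e0)"
  and bracket_linear: "linear (br v)" "linear (\<lambda>w. br w v)"
  and bracket_antisym: "br w v = - br v w"
proof -
  obtain B where L: "\<And>v. ((\<lambda>x. lf c0 (pt x) v) has_derivative (\<lambda>w. B w v)) (at e0)"
    and R: "\<And>u. ((\<lambda>x. rf (pt x) u) has_derivative (\<lambda>w. B u w)) (at e0)"
    using local_second_order by blast
  \<comment> \<open>At the identity \<open>lf\<close> is the identity map, so the bracket of the two
    fields is \<open>B\<close> made antisymmetric.\<close>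
  have br: "br v w = B v w - B w v" for v w
    unfolding lie_bracket_def Let_def vf_bracket_def
    using frechet_derivative_at[OF L, of v, symmetric] frechet_derivative_at[OF L, of w, symmetric]
    by (simp add: lf_one)
  have lin: "linear (\<lambda>w. B w v)" "linear (B v)" for v
    using has_derivative_linear[OF L] has_derivative_linear[OF R] by auto
  show "linear (br v)" "linear (\<lambda>w. br w v)"
    unfolding br by (intro linear_compose_sub lin)+
  show "br w v = - br v w" by (simp add: br)
  have inc: "\<forall>\<^sub>F x in at e0. pt x \<in> fst c0"
    using eventually_chart_inv_in[OF c0 chart_openin[OF c0(1)] c0(2)] by (simp add: eventually_at_filter eventually_mono)
  \<comment> \<open>\<open>Ad\<close> is so far only known to be continuous at the identity. The
    product is still differentiable there because its other factor vanishes at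
    \<open>e0\<close>.\<close>
  have prod: "((\<lambda>x. (Ad (pt x) v \<bullet> b) *\<^sub>R (rf (pt x) b - b)) has_derivative (\<lambda>w. (v \<bullet> b) *\<^sub>R B b w)) (at e0)" for b
  proof -
    have lR: "(\<lambda>x. rf (pt x) b - b) = (\<lambda>x. rf (pt x) b - rf (pt e0) b)" by (simp add: rf_one)
    have "((\<lambda>x. rf (pt x) b - b) has_derivative (\<lambda>w. B b w)) (at e0)"
      by (auto intro!: derivative_eq_intros R)
    then have d: "((\<lambda>y. ((rf (pt y) b - b) - (rf (pt e0) b - b) - B b (y - e0)) /\<^sub>R norm (y - e0)) \<longlongrightarrow> 0) (at e0)"
      and bl: "bounded_linear (B b)" by (auto simp: has_derivative_at_within)
    obtain K where K: "\<And>w. norm (B b w) \<le> norm w * K" using bl bounded_linear.bounded by blast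
    have a: "((\<lambda>x. Ad (pt x) v \<bullet> b) \<longlongrightarrow> v \<bullet> b) (at e0)" by (intro tendsto_intros tendsto_Ad_pt)
    have a0: "((\<lambda>x. Ad (pt x) v \<bullet> b - v \<bullet> b) \<longlongrightarrow> 0) (at e0)" using a by (simp add: LIM_zero)
    have z: "((\<lambda>y. (Ad (pt y) v \<bullet> b - v \<bullet> b) *\<^sub>R (B b (y - e0) /\<^sub>R norm (y - e0))) \<longlongrightarrow> 0) (at e0)"
    proof (rule Lim_null_comparison)
      show "((\<lambda>y. \<bar>Ad (pt y) v \<bullet> b - v \<bullet> b\<bar> * K) \<longlongrightarrow> 0) (at e0)"
        using tendsto_mult_left_zero[OF tendsto_rabs_zero[OF a0]] .
      show "\<forall>\<^sub>F y in at e0. norm ((Ad (pt y) v \<bullet> b - v \<bullet> b) *\<^sub>R (B b (y - e0) /\<^sub>R norm (y - e0))) \<le> \<bar>Ad (pt y) v \<bullet> b - v \<bullet> b\<bar> * K"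
        unfolding eventually_at_filter
      proof (intro always_eventually allI impI)
        fix y assume "y \<noteq> e0"
        then have N: "norm (B b (y - e0) /\<^sub>R norm (y - e0)) \<le> K"
          using K[of "y - e0"] by (simp add: divide_simps mult.commute)
        show "norm ((Ad (pt y) v \<bullet> b - v \<bullet> b) *\<^sub>R (B b (y - e0) /\<^sub>R norm (y - e0))) \<le> \<bar>Ad (pt y) v \<bullet> b - v \<bullet> b\<bar> * K"
          unfolding norm_scaleR[of _ "B b (y - e0) /\<^sub>R norm (y - e0)"]
          by (rule mult_left_mono[OF N abs_ge_zero])
      qed
    qed
    have "((\<lambda>y. (Ad (pt y) v \<bullet> b) *\<^sub>R (((rf (pt y) b - b) - (rf (pt e0) b - b) - B b (y - e0)) /\<^sub>R norm (y - e0))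
          + (Ad (pt y) v \<bullet> b - v \<bullet> b) *\<^sub>R (B b (y - e0) /\<^sub>R norm (y - e0))) \<longlongrightarrow> (v \<bullet> b) *\<^sub>R 0 + 0) (at e0)"
      by (intro tendsto_add tendsto_scaleR a d z)
    moreover have "(\<lambda>y. (Ad (pt y) v \<bullet> b) *\<^sub>R (((rf (pt y) b - b) - (rf (pt e0) b - b) - B b (y - e0)) /\<^sub>R norm (y - e0))
          + (Ad (pt y) v \<bullet> b - v \<bullet> b) *\<^sub>R (B b (y - e0) /\<^sub>R norm (y - e0)))
        = (\<lambda>y. (((Ad (pt y) v \<bullet> b) *\<^sub>R (rf (pt y) b - b) - (Ad (pt e0) v \<bullet> b) *\<^sub>R (rf (pt e0) b - b)) - (v \<bullet> b) *\<^sub>R B b (y - e0)) /\<^sub>R norm (y - e0))"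
      by (rule ext) (simp add: rf_one algebra_simps)
    ultimately show ?thesis
      using bounded_linear_const_scaleR[OF bl, of "v \<bullet> b"] by (simp add: has_derivative_at_within)
  qed
  \<comment> \<open>The sum is \<open>rf - id\<close> applied to \<open>Ad (pt x) v\<close>,
    expanded in the basis. Subtracting it from \<open>lf\<close> leaves \<open>Ad (pt x) v\<close>
    near the identity, with derivative \<open>B w v - B v w\<close>.\<close>
  have "((\<lambda>x. lf c0 (pt x) v - (\<Sum>b\<in>Basis. (Ad (pt x) v \<bullet> b) *\<^sub>R (rf (pt x) b - b)))
      has_derivative (\<lambda>w. B w v - (\<Sum>b\<in>Basis. (v \<bullet> b) *\<^sub>R B b w))) (at e0)"
    by (intro has_derivative_diff has_derivative_sum L prod)
  moreover have "B w v - (\<Sum>b\<in>Basis. (v \<bullet> b) *\<^sub>R B b w) = br w v" for w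
    using linear_expand_Basis[OF lin(1)[of w], of v] by (simp add: br)
  ultimately have D: "((\<lambda>x. lf c0 (pt x) v - (\<Sum>b\<in>Basis. (Ad (pt x) v \<bullet> b) *\<^sub>R (rf (pt x) b - b))) has_derivative (\<lambda>w. br w v)) (at e0)"
    by simp
  have eq: "lf c0 (pt x) v - (\<Sum>b\<in>Basis. (Ad (pt x) v \<bullet> b) *\<^sub>R (rf (pt x) b - b)) = Ad (pt x) v" if "pt x \<in> fst c0" for x
  proof -
    have "(\<Sum>b\<in>Basis. (Ad (pt x) v \<bullet> b) *\<^sub>R (rf (pt x) b - b))
        = (\<Sum>b\<in>Basis. (Ad (pt x) v \<bullet> b) *\<^sub>R rf (pt x) b) - (\<Sum>b\<in>Basis. (Ad (pt x) v \<bullet> b) *\<^sub>R b)"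
      by (simp add: scaleR_diff_right sum_subtractf)
    also have "\<dots> = rf (pt x) (Ad (pt x) v) - Ad (pt x) v"
      using linear_expand_Basis[OF rf_linear[OF that], of "Ad (pt x) v"] by (simp add: euclidean_representation)
    finally show ?thesis using lf_eq_rf_Ad[OF that] by simp
  qed
  show "((\<lambda>x. Ad (pt x) v) has_derivative (\<lambda>w. br w v)) (at e0)"
    by (rule has_derivative_transform_eventually[OF D]) (use inc eq[of e0] eq c0 in \<open>auto simp: lf_one rf_one Ad_one elim: eventually_mono\<close>)
qed

end

section \<open>Curves driven by a control\<close>

lemma continuous_map_imp_limitin:
  fixes \<gamma> :: "'x::topological_space \<Rightarrow> 'a"
  assumes "continuous_map (top_of_set S) X \<gamma>" "t \<in> S"
  shows "limitin X \<gamma> (\<gamma> t) (at t within S)"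
  unfolding limitin_def
proof (intro conjI allI impI)
  show "\<gamma> t \<in> topspace X" using assms by (auto simp: continuous_map_def)
  fix U assume U: "openin X U \<and> \<gamma> t \<in> U"
  then have "openin (top_of_set S) {x \<in> S. \<gamma> x \<in> U}"
    using assms(1) by (auto simp: continuous_map_def)
  then obtain T where T: "open T" "{x \<in> S. \<gamma> x \<in> U} = S \<inter> T" unfolding openin_open by blast
  with U assms(2) have "t \<in> T" by blast
  with T show "\<forall>\<^sub>F x in at t within S. \<gamma> x \<in> U"
    unfolding eventually_at_topological by blast
qed

lemma limitin_imp_continuous_map:
  fixes \<gamma> :: "'x::topological_space \<Rightarrow> 'a"
  assumes "\<And>t. t \<in> S \<Longrightarrow> limitin X \<gamma> (\<gamma> t) (at t within S)"
  shows "continuous_map (top_of_set S) X \<gamma>"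
  unfolding continuous_map_def
proof (intro conjI allI impI)
  show "\<gamma> \<in> topspace (top_of_set S) \<rightarrow> topspace X"
    using limitin_topspace[OF assms] by simp
  fix U assume U: "openin X U"
  show "openin (top_of_set S) {x \<in> topspace (top_of_set S). \<gamma> x \<in> U}"
  proof (subst openin_subopen, intro ballI)
    fix t assume t: "t \<in> {x \<in> topspace (top_of_set S). \<gamma> x \<in> U}"
    then have "\<forall>\<^sub>F x in at t within S. \<gamma> x \<in> U"
      using assms[of t] U by (intro limitinD[of X]) auto
    then obtain T where T: "open T" "t \<in> T" "\<forall>x\<in>T. x \<noteq> t \<longrightarrow> x \<in> S \<longrightarrow> \<gamma> x \<in> U"
      unfolding eventually_at_topological by blast
    show "\<exists>T. openin (top_of_set S) T \<and> t \<in> T \<and> T \<subseteq> {x \<in> topspace (top_of_set S). \<gamma> x \<in> U}"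
      by (rule exI[of _ "S \<inter> T"]) (use T t in \<open>auto intro: openin_open_Int\<close>)
  qed
qed

lemma lipschitz_on_linear_image:
  fixes L :: "'e::euclidean_space \<Rightarrow> 'f::real_normed_vector"
  assumes "C-lipschitz_on S H" "linear L"
  obtains C' where "C'-lipschitz_on S (\<lambda>s. L (H s))"
proof -
  obtain B where B: "0 \<le> B" "\<And>v. norm (L v) \<le> B * norm v"
    using bounded_linear.nonneg_bounded assms(2) linear_conv_bounded_linear by (metis mult.commute)
  have "(B * C)-lipschitz_on S (\<lambda>s. L (H s))"
  proof (rule lipschitz_onI)
    show "0 \<le> B * C" using B(1) lipschitz_on_nonneg[OF assms(1)] by simp
    fix x y assume "x \<in> S" "y \<in> S"
    then have "norm (H x - H y) \<le> C * dist x y" using lipschitz_onD[OF assms(1)] by (simp add: dist_norm)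
    then have "B * norm (H x - H y) \<le> B * (C * dist x y)" using B(1) by (rule mult_left_mono)
    then show "dist (L (H x)) (L (H y)) \<le> B * C * dist x y"
      using B(2)[of "H x - H y"] by (simp add: dist_norm linear_diff[OF assms(2)] mult.assoc)
  qed
  then show thesis by (rule that)
qed

lemma scaleR_lipschitz: "(norm v)-lipschitz_on S (\<lambda>t. t *\<^sub>R v)"
  by (rule lipschitz_onI) (simp_all add: dist_norm mult.commute flip: scaleR_left_diff_distrib)

lemma at_within_Icc_shrink:
  fixes t r :: real
  assumes "t \<in> {0..1}" "r > 0"
  shows "at t within {max 0 (t - r)..min 1 (t + r)} = at t within {0..1}"
  by (rule at_within_nhd[of _ "{t - r<..<t + r}"]) (use assms in auto)

context lie_gp
begin

text \<open>The control of \<open>\<gamma>\<close> is represented by a Lipschitz primitive \<open>H\<close>. This makes the equation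
  \<open>\<gamma>\<^sup>-\<^sup>1 \<gamma>' = H'\<close> meaningful at every time, not only almost everywhere, and free of integrals and of
  charts other than the one at the identity.\<close>

definition driven :: "real set \<Rightarrow> (real \<Rightarrow> 'a) \<Rightarrow> (real \<Rightarrow> 'e) \<Rightarrow> bool" where
  "driven S \<gamma> H \<longleftrightarrow> continuous_map (top_of_set S) (mtop M) \<gamma> \<and> (\<exists>C. C-lipschitz_on S H) \<and>
     (\<forall>t\<in>S. zero_deriv (\<lambda>s. coord (inv (\<gamma> t) \<otimes> \<gamma> s) - H s) t S)"

lemma driven_carrier: "driven S \<gamma> H \<Longrightarrow> t \<in> S \<Longrightarrow> \<gamma> t \<in> carrier G"
  unfolding driven_def continuous_map_def by auto

lemma driven_limitin: "driven S \<gamma> H \<Longrightarrow> t \<in> S \<Longrightarrow> limitin (mtop M) \<gamma> (\<gamma> t) (at t within S)"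
  unfolding driven_def by (intro continuous_map_imp_limitin) auto

lemma driven_limitin_increment:
  assumes "driven S \<gamma> H" "t \<in> S"
  shows "limitin (mtop M) (\<lambda>s. inv (\<gamma> t) \<otimes> \<gamma> s) (inv (\<gamma> t) \<otimes> \<gamma> t) (at t within S)"
  using driven_carrier[OF assms] by (intro limitin_mult driven_limitin[OF assms]) simp

lemma driven_derivative:
  "driven S \<gamma> H \<Longrightarrow> t \<in> S \<Longrightarrow> zero_deriv (\<lambda>s. coord (inv (\<gamma> t) \<otimes> \<gamma> s) - H s) t S"
  by (simp add: driven_def)

text \<open>Translating the increment back by \<open>\<gamma> t\<close> recovers the curve, and the
  tangent map of this translation at the identity is \<open>lf c (\<gamma> t)\<close>.\<close>

lemma driven_chart:
  assumes d: "driven S \<gamma> H" and t: "t \<in> S" and c: "c \<in> charts M" "\<gamma> t \<in> fst c"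
  shows "zero_deriv (\<lambda>s. snd c (\<gamma> s) - lf c (\<gamma> t) (H s)) t S"
proof -
  have g: "\<gamma> s \<in> carrier G" if "s \<in> S" for s by (rule driven_carrier[OF d that])
  obtain C where C: "C-lipschitz_on S H" using d by (auto simp: driven_def)
  have one: "inv (\<gamma> t) \<otimes> \<gamma> t = \<one>" using g[OF t] by simp
  have "zero_deriv (\<lambda>s. snd c (\<gamma> t \<otimes> (inv (\<gamma> t) \<otimes> \<gamma> s)) - tangent_map c0 c (\<lambda>q. \<gamma> t \<otimes> q) (inv (\<gamma> t) \<otimes> \<gamma> t) (H s)) t S"
    by (rule atlas_map.zero_derivative_push[OF atlas_mapI[OF mdiff_left], OF _ driven_limitin_increment[OF d t] t driven_derivative[OF d t] C])
      (use c c0 g[OF t] in auto)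
  then show ?thesis
    by (rule has_derivative_transform[OF t, rotated])
      (use g t one in \<open>simp add: m_assoc[symmetric] left_inv_field_def\<close>)
qed

text \<open>The way back: one chart at each time is enough, and translation by
  \<open>inv (\<gamma> t)\<close> undoes \<open>lf\<close>.\<close>

lemma drivenI_chart:
  assumes \<gamma>: "continuous_map (top_of_set S) (mtop M) \<gamma>" and C: "C-lipschitz_on S H"
    and der: "\<And>t. t \<in> S \<Longrightarrow> \<exists>c\<in>charts M. \<gamma> t \<in> fst c \<and>
      zero_deriv (\<lambda>s. snd c (\<gamma> s) - lf c (\<gamma> t) (H s)) t S"
  shows "driven S \<gamma> H"
  unfolding driven_def
proof (intro conjI ballI)
  show "continuous_map (top_of_set S) (mtop M) \<gamma>" "\<exists>C. C-lipschitz_on S H" using \<gamma> C by auto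
  fix t assume t: "t \<in> S"
  have g: "\<gamma> s \<in> carrier G" if "s \<in> S" for s using \<gamma> that by (auto simp: continuous_map_def)
  obtain c where c: "c \<in> charts M" "\<gamma> t \<in> fst c"
    and d: "zero_deriv (\<lambda>s. snd c (\<gamma> s) - lf c (\<gamma> t) (H s)) t S"
    using der[OF t] by blast
  obtain C' where C': "C'-lipschitz_on S (\<lambda>s. lf c (\<gamma> t) (H s))"
    using lipschitz_on_linear_image[OF C lf_linear[OF c]] by blast
  have "zero_deriv (\<lambda>s. coord (inv (\<gamma> t) \<otimes> \<gamma> s) - tangent_map c c0 (\<lambda>q. inv (\<gamma> t) \<otimes> q) (\<gamma> t) (lf c (\<gamma> t) (H s))) t S"
    by (rule atlas_map.zero_derivative_push[OF atlas_mapI[OF mdiff_left], OF _ continuous_map_imp_limitin[OF \<gamma> t] t d C'])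
      (use c c0 g[OF t] in auto)
  then show "zero_deriv (\<lambda>s. coord (inv (\<gamma> t) \<otimes> \<gamma> s) - H s) t S"
    by (simp add: lf_left_inverse[OF c])
qed

lemma driven_cong:
  assumes d: "driven S \<gamma> H" and "\<And>s. s \<in> S \<Longrightarrow> \<gamma> s = \<gamma>' s" "\<And>s. s \<in> S \<Longrightarrow> H s = H' s"
  shows "driven S \<gamma>' H'"
  unfolding driven_def
proof (intro conjI ballI)
  show "continuous_map (top_of_set S) (mtop M) \<gamma>'"
    by (rule continuous_map_eq[of _ _ \<gamma>]) (use d assms(2) in \<open>auto simp: driven_def\<close>)
  show "\<exists>C. C-lipschitz_on S H'"
    using d assms(3) unfolding driven_def by (metis lipschitz_on_transform)
  fix t assume t: "t \<in> S"
  show "zero_deriv (\<lambda>s. coord (inv (\<gamma>' t) \<otimes> \<gamma>' s) - H' s) t S"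
    by (rule has_derivative_transform[OF t _ driven_derivative[OF d t]]) (use assms t in simp)
qed

lemma driven_subset:
  assumes d: "driven S \<gamma> H" and "T \<subseteq> S"
  shows "driven T \<gamma> H"
  using assms unfolding driven_def
  by (metis (no_types, lifting) continuous_map_from_subtopology_mono has_derivative_subset lipschitz_on_subset subset_iff)

lemma driven_scaleR_rescale:
  assumes "driven UNIV \<gamma> (\<lambda>t. t *\<^sub>R v)"
  shows "driven UNIV (\<lambda>t. \<gamma> (a * t)) (\<lambda>t. t *\<^sub>R (a *\<^sub>R v))"
  unfolding driven_def
proof (intro conjI ballI)
  have "continuous_map euclideanreal (mtop M) (\<gamma> \<circ> (\<lambda>t. a * t))"
    by (rule continuous_map_compose[of _ euclideanreal]) (use assms in \<open>auto simp: driven_def intro!: continuous_intros\<close>)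
  then show "continuous_map (top_of_set UNIV) (mtop M) (\<lambda>t. \<gamma> (a * t))" by (simp add: o_def)
  show "\<exists>C. C-lipschitz_on UNIV (\<lambda>t. t *\<^sub>R a *\<^sub>R v)"
    using scaleR_lipschitz by blast
  fix t :: real
  have 1: "((\<lambda>s. a * s) has_derivative (\<lambda>h. a * h)) (at t)" by (auto intro!: derivative_eq_intros)
  from has_derivative_compose[OF 1 driven_derivative[OF assms, of "a * t"]]
  show "zero_deriv (\<lambda>s. coord (inv \<gamma> (a * t) \<otimes> \<gamma> (a * s)) - s *\<^sub>R a *\<^sub>R v) t UNIV"
    by (simp add: mult.commute)
qed

section \<open>First-order calculus of products, inverses and conjugates\<close>

text \<open>The derivative is determined by its values on the two slices through the identity, where
  the multiplication is the identity map.\<close>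

lemma mult_has_derivative_one:
  "((\<lambda>z. coord (pt (fst z) \<otimes> pt (snd z))) has_derivative (\<lambda>z. fst z + snd z)) (at (e0, e0))"
proof (rule mult_C2[OF c0(1) c0(1) c0(1) c0(2) c0(2)])
  show "\<one> \<otimes> \<one> \<in> fst c0" using c0 by simp
  fix U \<mu>' assume U: "(e0, e0) \<in> U"
    "\<And>z. z \<in> U \<Longrightarrow> ((\<lambda>z. coord (pt (fst z) \<otimes> pt (snd z))) has_derivative \<mu>' z) (at z)"
  have "\<mu>' (e0, e0) z = fst z + snd z" for z
  proof -
    have "\<mu>' (e0, e0) ((fst z, 0) + (0, snd z)) = \<mu>' (e0, e0) (fst z, 0) + \<mu>' (e0, e0) (0, snd z)"
      by (rule linear_add[OF has_derivative_linear[OF U(2)[OF U(1)]]])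
    then show ?thesis
      using lf_eq_partial[OF c0(1) U(2)[OF U(1)], of "snd z"] rf_eq_partial[OF U(2)[OF U(1)], of "fst z"]
      by (simp add: lf_one rf_one)
  qed
  then show ?thesis using U(2)[OF U(1)] by presburger
qed

lemma mult_zero_derivative:
  fixes u w :: "real \<Rightarrow> 'a"
  assumes u: "limitin (mtop M) u \<one> (at t within S)" "u t = \<one>" "zero_deriv (\<lambda>s. coord (u s) - A s) t S" "C-lipschitz_on S A"
    and w: "limitin (mtop M) w \<one> (at t within S)" "w t = \<one>" "zero_deriv (\<lambda>s. coord (w s) - B s) t S" "C'-lipschitz_on S B"
    and t: "t \<in> S"
  shows "zero_deriv (\<lambda>s. coord (u s \<otimes> w s) - (A s + B s)) t S"
proof -
  have 1: "zero_deriv (\<lambda>s. (coord (u s), coord (w s)) - (A s, B s)) t S"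
    using has_derivative_Pair[OF u(3) w(3)] by (simp add: zero_prod_def)
  have 2: "zero_deriv (\<lambda>s. coord (pt (coord (u s)) \<otimes> pt (coord (w s))) - (A s + B s)) t S"
    using zero_derivative_comp[where x="\<lambda>s. (coord (u s), coord (w s))", OF 1 lipschitz_on_Pair[OF u(4) w(4)] t, of "\<lambda>z. coord (pt (fst z) \<otimes> pt (snd z))" "\<lambda>z. fst z + snd z"]
      mult_has_derivative_one u(2) w(2) by simp
  show ?thesis
    by (rule has_derivative_transform_eventually[OF 2 _ _ t])
      (use limitin_in_chart[OF c0(1) u(1) c0(2)] limitin_in_chart[OF c0(1) w(1) c0(2)] u(2) w(2) c0 in
        \<open>auto elim: eventually_elim2\<close>)
qed

text \<open>Differentiate the constant \<open>pt x \<otimes> inv (pt x)\<close>; at the identity the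
  derivative of a product is the sum of the derivatives.\<close>

lemma tangent_inv_one: "tangent_map c0 c0 (\<lambda>x. inv x) \<one> v = - v"
proof -
  interpret I: atlas_map M M "\<lambda>x. inv x" by (rule atlas_mapI[OF mdiff_inv])
  let ?T = "tangent_map c0 c0 (\<lambda>x. inv x) \<one>" and ?i = "in_charts c0 c0 (\<lambda>x. inv x)"
  have i: "(?i has_derivative ?T) (at e0)"
    by (rule mdiff_has_derivative[OF mdiff_inv]) (use c0 in auto)
  have ie: "?i e0 = e0" using c0 by (simp add: in_charts_def)
  have p: "((\<lambda>x. (x, ?i x)) has_derivative (\<lambda>v. (v, ?T v))) (at e0)"
    by (rule has_derivative_Pair[OF has_derivative_ident i])
  have m: "((\<lambda>z. coord (pt (fst z) \<otimes> pt (snd z))) has_derivative (\<lambda>z. fst z + snd z)) (at (e0, ?i e0))"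
    using mult_has_derivative_one ie by simp
  have c: "((\<lambda>x. coord (pt x \<otimes> pt (?i x))) has_derivative (\<lambda>v. v + ?T v)) (at e0)"
    using has_derivative_compose[OF p m] by simp
  have "\<forall>\<^sub>F x in nhds e0. pt x \<in> fst c0" 
    by (rule eventually_chart_inv_in[OF c0 chart_openin[OF c0(1)] c0(2)])
  moreover have "\<forall>\<^sub>F x in nhds e0. inv (pt x) \<in> fst c0"
    by (rule I.eventually_map_in_chart[OF c0(1) c0(1) c0(2)]) (use c0 in simp)
  ultimately have ev: "\<forall>\<^sub>F x in nhds e0. coord (pt x \<otimes> pt (?i x)) = e0"
  proof eventually_elim
    case (elim x)
    then show ?case using c0 chart_carrier[OF c0(1), of "pt x"] by (simp add: in_charts_def)
  qed
  have "((\<lambda>x. e0) has_derivative (\<lambda>v. v + ?T v)) (at e0)"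
    by (rule has_derivative_transform_eventually[OF c])
      (use ev in \<open>auto dest: eventually_nhds_x_imp_x simp: eventually_at_filter elim: eventually_mono\<close>)
  from has_derivative_unique[OF this has_derivative_const] have "v + ?T v = 0" by metis
  then show ?thesis by (simp add: eq_neg_iff_add_eq_0 add.commute)
qed

lemma inv_zero_derivative:
  fixes u :: "real \<Rightarrow> 'a"
  assumes u: "limitin (mtop M) u \<one> (at t within S)" "u t = \<one>" "zero_deriv (\<lambda>s. coord (u s) - A s) t S" "C-lipschitz_on S A"
    and t: "t \<in> S"
  shows "zero_deriv (\<lambda>s. coord (inv (u s)) - (- A s)) t S"
proof -
  have "zero_deriv (\<lambda>s. coord (inv (u s)) - tangent_map c0 c0 (\<lambda>x. inv x) (u t) (A s)) t S"
    by (rule atlas_map.zero_derivative_push[OF atlas_mapI[OF mdiff_inv] _ t u(3,4)]) (use u c0 in auto)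
  then show ?thesis by (simp add: u(2) tangent_inv_one)
qed

lemma conj_zero_derivative:
  fixes u :: "real \<Rightarrow> 'a"
  assumes p: "p \<in> carrier G" and u: "limitin (mtop M) u \<one> (at t within S)" "u t = \<one>" "zero_deriv (\<lambda>s. coord (u s) - A s) t S" "C-lipschitz_on S A"
    and t: "t \<in> S"
  shows "zero_deriv (\<lambda>s. coord (p \<otimes> u s \<otimes> inv p) - Ad p (A s)) t S"
proof -
  have "zero_deriv (\<lambda>s. coord (p \<otimes> u s \<otimes> inv p) - tangent_map c0 c0 (\<lambda>x. p \<otimes> x \<otimes> inv p) (u t) (A s)) t S"
    by (rule atlas_map.zero_derivative_push[OF atlas_mapI[OF mdiff_conj[OF p]] _ t u(3,4)]) (use u c0 p in auto)
  then show ?thesis by (simp add: u(2) Ad_def)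
qed

lemma mult_inv_cancel:
  assumes "x \<in> carrier G" "y \<in> carrier G"
  shows "x \<otimes> (inv x \<otimes> y) = y" "inv x \<otimes> (x \<otimes> y) = y"
  using assms by (simp_all add: m_assoc[symmetric])

text \<open>The increment of the product is the increment of \<open>\<alpha>\<close>, conjugated by
  \<open>inv (\<beta> t)\<close>, times that of \<open>\<beta>\<close>. The coefficient
  \<open>Ad (inv (\<beta> t))\<close> is frozen at a time that varies, so the new primitive is not
  given by a formula in \<open>H\<close> and \<open>K\<close>; \<open>J\<close> may be any Lipschitz
  function with the right first-order behaviour at each time.\<close>

lemma driven_mult:
  assumes a: "driven S \<alpha> H" and b: "driven S \<beta> K" and J: "C-lipschitz_on S J"
    and der: "\<And>t. t \<in> S \<Longrightarrow> zero_deriv (\<lambda>s. J s - (Ad (inv (\<beta> t)) (H s) + K s)) t S"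
  shows "driven S (\<lambda>s. \<alpha> s \<otimes> \<beta> s) J"
  unfolding driven_def
proof (intro conjI ballI)
  have ac: "\<alpha> s \<in> carrier G" "\<beta> s \<in> carrier G" if "s \<in> S" for s
    using driven_carrier a b that by auto
  show "continuous_map (top_of_set S) (mtop M) (\<lambda>s. \<alpha> s \<otimes> \<beta> s)"
    by (intro limitin_imp_continuous_map limitin_mult driven_limitin[OF a] driven_limitin[OF b])
  show "\<exists>C. C-lipschitz_on S J" using J by blast
  fix t assume t: "t \<in> S"
  define u where "u = (\<lambda>s. inv (\<alpha> t) \<otimes> \<alpha> s)"
  define w where "w = (\<lambda>s. inv (\<beta> t) \<otimes> \<beta> s)"
  have one: "u t = \<one>" "w t = \<one>" using ac[OF t] by (auto simp: u_def w_def)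
  have lu: "limitin (mtop M) u \<one> (at t within S)" and lw: "limitin (mtop M) w \<one> (at t within S)"
    using driven_limitin_increment[OF a t] driven_limitin_increment[OF b t] one by (auto simp: u_def w_def)
  obtain CH CK where C: "CH-lipschitz_on S H" "CK-lipschitz_on S K" using a b by (auto simp: driven_def)
  have ib: "inv (\<beta> t) \<in> carrier G" using ac[OF t] by simp
  have du: "zero_deriv (\<lambda>s. coord (u s) - H s) t S"
    and dw: "zero_deriv (\<lambda>s. coord (w s) - K s) t S"
    using driven_derivative[OF a t] driven_derivative[OF b t] by (auto simp: u_def w_def)
  define v where "v = (\<lambda>s. inv (\<beta> t) \<otimes> u s \<otimes> inv (inv (\<beta> t)))"
  have lv: "limitin (mtop M) v \<one> (at t within S)"
    unfolding v_def using limitin_mult[OF limitin_mult[OF _ lu, of "\<lambda>_. inv (\<beta> t)" "inv (\<beta> t)"], of "\<lambda>_. inv (inv (\<beta> t))" "inv (inv (\<beta> t))"] ib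
    by simp
  have v1: "v t = \<one>" using ib by (simp add: v_def one)
  have dv: "zero_deriv (\<lambda>s. coord (v s) - Ad (inv (\<beta> t)) (H s)) t S"
    unfolding v_def by (rule conj_zero_derivative[OF ib lu one(1) du C(1) t])
  obtain C' where C': "C'-lipschitz_on S (\<lambda>s. Ad (inv (\<beta> t)) (H s))"
    using lipschitz_on_linear_image[OF C(1) Ad_linear[OF ib]] by blast
  have "zero_deriv (\<lambda>s. coord (v s \<otimes> w s) - (Ad (inv (\<beta> t)) (H s) + K s)) t S"
    by (rule mult_zero_derivative[OF lv v1 dv C' lw one(2) dw C(2) t])
  from has_derivative_diff[OF this der[OF t]]
  have 1: "zero_deriv (\<lambda>s. coord (v s \<otimes> w s) - J s) t S" by simp
  show "zero_deriv (\<lambda>s. coord (inv (\<alpha> t \<otimes> \<beta> t) \<otimes> (\<alpha> s \<otimes> \<beta> s)) - J s) t S"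
  proof (rule has_derivative_transform[OF t _ 1])
    fix s assume s: "s \<in> S"
    have "v s \<otimes> w s = inv (\<beta> t) \<otimes> (inv (\<alpha> t) \<otimes> \<alpha> s) \<otimes> \<beta> t \<otimes> (inv (\<beta> t) \<otimes> \<beta> s)"
      using ac[OF t] by (simp add: v_def w_def u_def)
    also have "\<dots> = inv (\<alpha> t \<otimes> \<beta> t) \<otimes> (\<alpha> s \<otimes> \<beta> s)"
      using ac[OF t] ac[OF s] by (simp add: m_assoc inv_mult_group mult_inv_cancel)
    finally show "coord (inv (\<alpha> t \<otimes> \<beta> t) \<otimes> (\<alpha> s \<otimes> \<beta> s)) - J s = coord (v s \<otimes> w s) - J s" by simp
  qed
qed

text \<open>The curve need not stay in one chart, so constancy is proved locally and spreads by
  connectedness.\<close>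

lemma driven_zero_constant:
  assumes d: "driven S \<gamma> (\<lambda>_. 0)" and S: "convex S" and t: "t \<in> S" "t' \<in> S"
  shows "\<gamma> t = \<gamma> t'"
proof -
  have "\<gamma> constant_on S"
  proof (rule locally_constant_imp_constant[OF convex_connected[OF S]])
    fix a assume a: "a \<in> S"
    then have "\<gamma> a \<in> topspace (mtop M)" using driven_carrier[OF d] by simp
    then obtain c where c: "c \<in> charts M" "\<gamma> a \<in> fst c" by (rule obtain_chart)
    from limitin_in_chart[OF c(1) driven_limitin[OF d a] c(2)]
    obtain r where r: "r > 0" "\<And>x. x \<in> S \<Longrightarrow> x \<noteq> a \<Longrightarrow> dist x a < r \<Longrightarrow> \<gamma> x \<in> fst c"
      unfolding eventually_at by blast
    let ?T = "S \<inter> ball a r"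
    have inc: "\<gamma> x \<in> fst c" if "x \<in> ?T" for x
      using r(2)[of x] that c by (cases "x = a") (auto simp: dist_commute)
    have eq: "\<gamma> x = \<gamma> a" if x: "x \<in> ?T" for x
    proof -
      have "snd c (\<gamma> x) = snd c (\<gamma> a)"
      proof (rule has_derivative_zero_unique[where s="?T"])
        show "convex ?T" using S by (intro convex_Int) auto
        show "((\<lambda>x. snd c (\<gamma> x)) has_derivative (\<lambda>h. 0)) (at y within ?T)" if y: "y \<in> ?T" for y
        proof -
          have "zero_deriv (\<lambda>s. snd c (\<gamma> s) - lf c (\<gamma> y) 0) y S"
            using driven_chart[OF d _ c(1) inc[OF y]] y by blast
          then show ?thesis
            using linear_0[OF lf_linear[OF c(1) inc[OF y]]] by (auto intro: has_derivative_subset)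
        qed
      qed (use x a r in auto)
      then show ?thesis using inc[OF x] c chart_inj[OF c(1)] by (simp add: inj_on_eq_iff)
    qed
    show "\<exists>T. openin (top_of_set S) T \<and> a \<in> T \<and> (\<forall>x\<in>T. \<gamma> x = \<gamma> a)"
    proof (intro exI conjI ballI)
      show "openin (top_of_set S) ?T" by (rule openin_open_Int) simp
      show "a \<in> ?T" using a r(1) by simp
    qed (rule eq)
  qed
  then obtain y where "\<And>x. x \<in> S \<Longrightarrow> \<gamma> x = y" unfolding constant_on_def by blast
  then show ?thesis using t by simp
qed

text \<open>With equal controls the increments of \<open>\<alpha>\<close> and \<open>\<beta>\<close>
  cancel to first order, so \<open>\<alpha> s \<otimes> inv (\<beta> s)\<close> has control zero and
  is constant. This takes the place of a Gronwall estimate.\<close>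

lemma driven_unique:
  assumes a: "driven S \<alpha> H" and b: "driven S \<beta> H" and S: "convex S"
    and t0: "t0 \<in> S" "\<alpha> t0 = \<beta> t0" and t: "t \<in> S"
  shows "\<alpha> t = \<beta> t"
proof -
  have ac: "\<alpha> s \<in> carrier G" "\<beta> s \<in> carrier G" if "s \<in> S" for s
    using driven_carrier a b that by auto
  obtain C where C: "C-lipschitz_on S H" using a by (auto simp: driven_def)
  let ?d = "\<lambda>s. \<alpha> s \<otimes> inv (\<beta> s)"
  have "driven S ?d (\<lambda>_. 0)"
    unfolding driven_def
  proof (intro conjI ballI)
    show "continuous_map (top_of_set S) (mtop M) ?d"
      by (intro limitin_imp_continuous_map limitin_mult limitin_inv driven_limitin[OF a] driven_limitin[OF b])
    show "\<exists>C. C-lipschitz_on S (\<lambda>_. 0::'e)" using lipschitz_on_constant by blast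
    fix t assume t: "t \<in> S"
    define u where "u = (\<lambda>s. inv (\<alpha> t) \<otimes> \<alpha> s)"
    define w where "w = (\<lambda>s. inv (\<beta> t) \<otimes> \<beta> s)"
    have one: "u t = \<one>" "w t = \<one>" using ac[OF t] by (auto simp: u_def w_def)
    have lu: "limitin (mtop M) u \<one> (at t within S)" and lw: "limitin (mtop M) w \<one> (at t within S)"
      using driven_limitin_increment[OF a t] driven_limitin_increment[OF b t] one by (auto simp: u_def w_def)
    have du: "zero_deriv (\<lambda>s. coord (u s) - H s) t S"
      and dw: "zero_deriv (\<lambda>s. coord (w s) - H s) t S"
      using driven_derivative[OF a t] driven_derivative[OF b t] by (auto simp: u_def w_def)
    have li: "limitin (mtop M) (\<lambda>s. inv (w s)) \<one> (at t within S)" using limitin_inv[OF lw] by simp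
    have Cm: "C-lipschitz_on S (\<lambda>s. - H s)" using C by (rule lipschitz_on_minus)
    have "zero_deriv (\<lambda>s. coord (u s \<otimes> inv (w s)) - (H s + - H s)) t S"
      by (rule mult_zero_derivative[OF lu one(1) du C li _ inv_zero_derivative[OF lw one(2) dw C t] Cm t]) (simp add: one)
    then have 1: "zero_deriv (\<lambda>s. coord (u s \<otimes> inv (w s)) - 0) t S" by simp
    have l: "limitin (mtop M) (\<lambda>s. u s \<otimes> inv (w s)) \<one> (at t within S)" using limitin_mult[OF lu li] by simp
    \<comment> \<open>The increment of \<open>?d\<close> from time \<open>t\<close> is
      \<open>u s \<otimes> inv (w s)\<close> conjugated by \<open>\<beta> t\<close>.\<close>
    have 2: "zero_deriv (\<lambda>s. coord (\<beta> t \<otimes> (u s \<otimes> inv (w s)) \<otimes> inv (\<beta> t)) - Ad (\<beta> t) 0) t S"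
      by (rule conj_zero_derivative[OF _ l _ 1 lipschitz_on_constant t]) (use ac[OF t] one in auto)
    show "zero_deriv (\<lambda>s. coord (inv (?d t) \<otimes> ?d s) - 0) t S"
    proof (rule has_derivative_transform[OF t _ 2])
      fix s assume s: "s \<in> S"
      have "inv (w s) = inv (\<beta> s) \<otimes> \<beta> t" using ac[OF t] ac[OF s] by (simp add: w_def inv_mult_group)
      then have "\<beta> t \<otimes> (u s \<otimes> inv (w s)) \<otimes> inv (\<beta> t) = \<beta> t \<otimes> inv (\<alpha> t) \<otimes> \<alpha> s \<otimes> inv (\<beta> s)"
        using ac[OF t] ac[OF s] by (simp add: u_def m_assoc)
      also have "\<dots> = inv (?d t) \<otimes> ?d s"
        using ac[OF t] ac[OF s] by (simp add: m_assoc inv_mult_group mult_inv_cancel)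
      finally show "coord (inv (?d t) \<otimes> ?d s) - 0 = coord (\<beta> t \<otimes> (u s \<otimes> inv (w s)) \<otimes> inv (\<beta> t)) - Ad (\<beta> t) 0"
        using linear_0[OF Ad_linear] ac[OF t] by simp
    qed
  qed
  from driven_zero_constant[OF this S t t0(1)] have "\<alpha> t \<otimes> inv (\<beta> t) = \<one>"
    using t0 ac by simp
  then show ?thesis using ac[OF t] by (metis inv_closed inv_equality inv_inv)
qed

text \<open>From integrals to \<open>driven\<close>, the coefficient
  \<open>lf c (\<gamma> t)\<close> is frozen on a short interval inside a chart. Conversely, the
  chart coordinate of the curve and the integral follow the same frozen primitive at every time, so
  their difference has derivative zero.\<close>

lemma curve_with_control_iff_driven:
  assumes h: "ess_bdd {0..1} C h"
  shows "curve_with_control G M h \<gamma> \<longleftrightarrow> \<gamma> 0 = \<one> \<and> driven {0..1} \<gamma> (\<lambda>t. integral {0..t} h)"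
proof
  let ?H = "\<lambda>t. integral {0..t} h"
  have H: "(h has_integral (?H s - ?H t)) {t..s}" if "0 \<le> t" "t \<le> s" "s \<le> 1" for s t
    using has_integral_indefinite_diff[OF ess_bdd_integrable[OF h] that] .
  have contA: "continuous_on {a..b} (\<lambda>t. lf c (\<gamma> t) v)"
    if \<gamma>: "continuous_map (top_of_set {0..1}) (mtop M) \<gamma>" and ab: "0 \<le> a" "b \<le> 1" "\<gamma> ` {a..b} \<subseteq> fst c" and c: "c \<in> charts M" for a b c v
    unfolding continuous_on_def
  proof
    fix t assume t: "t \<in> {a..b}"
    have "limitin (mtop M) \<gamma> (\<gamma> t) (at t within {0..1})" using t ab by (intro continuous_map_imp_limitin[OF \<gamma>]) auto
    then have "((\<lambda>s. lf c (\<gamma> s) v) \<longlongrightarrow> lf c (\<gamma> t) v) (at t within {0..1})"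
      by (rule tendsto_lf[OF c, rotated]) (use t ab in auto)
    then show "((\<lambda>s. lf c (\<gamma> s) v) \<longlongrightarrow> lf c (\<gamma> t) v) (at t within {a..b})"
      by (rule tendsto_within_subset) (use ab in auto)
  qed
  {
    assume cw: "curve_with_control G M h \<gamma>"
    then have \<gamma>: "continuous_map (top_of_set {0..1}) (mtop M) \<gamma>" by (simp add: curve_with_control_def)
    have "driven {0..1} \<gamma> ?H"
    proof (rule drivenI_chart[OF \<gamma> ess_bdd_indefinite_lipschitz[OF h]])
      fix t :: real assume t: "t \<in> {0..1}"
      then have "\<gamma> t \<in> topspace (mtop M)" using \<gamma> by (auto simp: continuous_map_def)
      then obtain c where c: "c \<in> charts M" "\<gamma> t \<in> fst c" by (rule obtain_chart)
      from limitin_in_chart[OF c(1) continuous_map_imp_limitin[OF \<gamma> t] c(2)]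
      obtain r where r: "r > 0" "\<And>x. x \<in> {0..1} \<Longrightarrow> x \<noteq> t \<Longrightarrow> dist x t < r \<Longrightarrow> \<gamma> x \<in> fst c"
        unfolding eventually_at by blast
      \<comment> \<open>Half of \<open>r\<close> keeps the closed interval strictly within the
        radius; the clamping keeps it in \<open>[0,1]\<close>.\<close>
      define a b where "a = max 0 (t - r/2)" and "b = min 1 (t + r/2)"
      have ab: "0 \<le> a" "b \<le> 1" "t \<in> {a..b}" using r(1) t by (auto simp: a_def b_def)
      have sub: "\<gamma> ` {a..b} \<subseteq> fst c"
      proof (rule image_subsetI)
        fix x assume "x \<in> {a..b}"
        then show "\<gamma> x \<in> fst c"
          using r(2)[of x] r(1) c(2) t by (cases "x = t") (auto simp: a_def b_def dist_real_def)
      qed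
      have "zero_deriv (\<lambda>s. snd c (\<gamma> s) - lf c (\<gamma> t) (?H s)) t {a..b}"
      proof (rule ess_bdd_freeze_derivative[where A="\<lambda>t. lf c (\<gamma> t)"])
        show "ess_bdd {a..b} C h" by (rule ess_bdd_subset[OF h]) (use ab in auto)
        show "continuous_on {a..b} (\<lambda>t. lf c (\<gamma> t) v)" for v by (rule contA[OF \<gamma> ab(1,2) sub c(1)])
        show "linear (lf c (\<gamma> t))" if "t \<in> {a..b}" for t using that sub by (intro lf_linear c) auto
        show "((\<lambda>\<tau>. lf c (\<gamma> \<tau>) (h \<tau>)) has_integral (snd c (\<gamma> s) - snd c (\<gamma> t))) {t..s}"
          if "a \<le> t" "t \<le> s" "s \<le> b" for s t
        proof -
          have "\<gamma> ` {t..s} \<subseteq> fst c" using that sub by (auto simp: image_subset_iff)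
          then show ?thesis using cw c(1) that ab unfolding curve_with_control_def by auto
        qed
      qed (use H ab in auto)
      then have "zero_deriv (\<lambda>s. snd c (\<gamma> s) - lf c (\<gamma> t) (?H s)) t {0..1}"
        using at_within_Icc_shrink[OF t, of "r/2"] r(1) by (simp add: a_def b_def)
      then show "\<exists>c\<in>charts M. \<gamma> t \<in> fst c \<and> zero_deriv (\<lambda>s. snd c (\<gamma> s) - lf c (\<gamma> t) (?H s)) t {0..1}"
        using c by blast
    qed
    then show "\<gamma> 0 = \<one> \<and> driven {0..1} \<gamma> ?H" using cw by (simp add: curve_with_control_def)
  next
    assume d': "\<gamma> 0 = \<one> \<and> driven {0..1} \<gamma> ?H"
    then have d: "driven {0..1} \<gamma> ?H" by simp
    then have \<gamma>: "continuous_map (top_of_set {0..1}) (mtop M) \<gamma>" by (simp add: driven_def)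
    show "curve_with_control G M h \<gamma>"
      unfolding curve_with_control_def
    proof (intro conjI ballI allI impI)
      fix c a b assume c: "c \<in> charts M" and ab': "0 \<le> a \<and> a \<le> b \<and> b \<le> 1 \<and> \<gamma> ` {a..b} \<subseteq> fst c"
      then have ab: "0 \<le> a" "a \<le> b" "b \<le> 1" and sub: "\<gamma> ` {a..b} \<subseteq> fst c" by auto
      let ?A = "\<lambda>t. lf c (\<gamma> t)"
      have cont: "continuous_on {a..b} (\<lambda>t. ?A t v)" for v by (rule contA[OF \<gamma> ab(1,3) sub c])
      have lin: "linear (?A t)" if "t \<in> {a..b}" for t using that sub by (intro lf_linear c) auto
      obtain K where K: "K > 0" "\<And>t v. t \<in> {a..b} \<Longrightarrow> norm (?A t v) \<le> K * norm v"
        using linear_family_bound[of "{a..b}" ?A, OF compact_Icc cont lin] by blast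
      have hab: "ess_bdd {a..b} C h" by (rule ess_bdd_subset[OF h]) (use ab in auto)
      have eb: "ess_bdd {a..b} (K * C) (\<lambda>t. ?A t (h t))"
        by (rule ess_bdd_apply[OF hab _ cont lin]) (use K in auto)
      let ?I = "\<lambda>s. integral {a..s} (\<lambda>t. ?A t (h t))"
      have "snd c (\<gamma> b) - ?I b = snd c (\<gamma> a) - ?I a"
      proof (rule has_derivative_zero_unique[where s="{a..b}"])
        fix t assume t: "t \<in> {a..b}"
        have 1: "zero_deriv (\<lambda>s. ?I s - ?A t (?H s)) t {a..b}"
        proof (rule ess_bdd_freeze_derivative[where A="?A"])
          show "((\<lambda>\<tau>. ?A \<tau> (h \<tau>)) has_integral (?I s - ?I t)) {t..s}" if "a \<le> t" "t \<le> s" "s \<le> b" for s t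
            by (rule has_integral_indefinite_diff[OF ess_bdd_integrable[OF eb] that])
        qed (use hab cont lin H ab t in auto)
        have "zero_deriv (\<lambda>s. snd c (\<gamma> s) - ?A t (?H s)) t {0..1}"
          by (rule driven_chart[OF d _ c]) (use t ab sub in auto)
        then have 2: "zero_deriv (\<lambda>s. snd c (\<gamma> s) - ?A t (?H s)) t {a..b}"
          by (rule has_derivative_subset) (use ab in auto)
        show "((\<lambda>s. snd c (\<gamma> s) - ?I s) has_derivative (\<lambda>h. 0)) (at t within {a..b})"
          using has_derivative_diff[OF 2 1] by simp
      qed (use ab in auto)
      then have "snd c (\<gamma> b) - snd c (\<gamma> a) = ?I b" by (simp add: algebra_simps)
      then show "((\<lambda>t. lf c (\<gamma> t) (h t)) has_integral snd c (\<gamma> b) - snd c (\<gamma> a)) {a..b}"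
        using integrable_integral[OF ess_bdd_integrable[OF eb]] by simp
    qed (use d' \<gamma> in auto)
  }
qed

end

section \<open>Small controls and the exponential\<close>

context lie_gp
begin

text \<open>These are the constants that \<open>picard_controlled\<close> asks for. The Lipschitz
  constant in the point comes from the mean value inequality, applied to each basis vector on a
  compact ball.\<close>

lemma lf_lipschitz_ball:
  obtains r K L where "r > 0" "K > 0" "L > 0" "cball e0 r \<subseteq> coord ` fst c0"
    "\<And>x v. x \<in> cball e0 r \<Longrightarrow> norm (lf c0 (pt x) v) \<le> K * norm v"
    "\<And>x y v. x \<in> cball e0 r \<Longrightarrow> y \<in> cball e0 r \<Longrightarrow>
       norm (lf c0 (pt x) v - lf c0 (pt y) v) \<le> L * norm (x - y) * norm v"
proof (rule lf_C1[OF c0])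
  fix U D assume U: "open U" "e0 \<in> U" "U \<subseteq> coord ` fst c0"
    "\<And>x v. x \<in> U \<Longrightarrow> ((\<lambda>x. lf c0 (pt x) v) has_derivative D v x) (at x)"
    "\<And>v w. continuous_on U (\<lambda>x. D v x w)"
  obtain r where r: "r > 0" "cball e0 r \<subseteq> U" using U(1,2) open_contains_cball by blast
  let ?B = "cball e0 r"
  have inc: "pt x \<in> fst c0" if "x \<in> ?B" for x
    using that r U(3) inv_into_into[of x coord "fst c0"] by blast
  have lin: "linear (\<lambda>v. lf c0 (pt x) v)" if "x \<in> ?B" for x by (rule lf_linear[OF c0(1) inc[OF that]])
  have "continuous_on ?B (\<lambda>x. lf c0 (pt x) v)" for v
    using r(2) U(4) by (intro continuous_at_imp_continuous_on ballI has_derivative_continuous) blast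
  then obtain K where K: "K > 0" "\<And>x v. x \<in> ?B \<Longrightarrow> norm (lf c0 (pt x) v) \<le> K * norm v"
    using linear_family_bound[of ?B "\<lambda>x v. lf c0 (pt x) v", OF compact_cball _ lin] by blast
  have "\<exists>L>0. \<forall>x\<in>?B. \<forall>y\<in>?B. norm (lf c0 (pt x) b - lf c0 (pt y) b) \<le> L * norm (x - y)" for b
  proof -
    have "continuous_on ?B (\<lambda>x. D b x w)" for w using U(5) r(2) continuous_on_subset by blast
    moreover have "linear (D b x)" if "x \<in> ?B" for x
      using U(4)[of x b] that r(2) has_derivative_linear by blast
    ultimately obtain L where L: "L > 0" "\<And>x w. x \<in> ?B \<Longrightarrow> norm (D b x w) \<le> L * norm w"
      using linear_family_bound[of ?B "D b", OF compact_cball] by blast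
    have "norm (lf c0 (pt x) b - lf c0 (pt y) b) \<le> L * norm (x - y)" if "x \<in> ?B" "y \<in> ?B" for x y
    proof (rule differentiable_bound[OF convex_cball _ _ that])
      show "((\<lambda>x. lf c0 (pt x) b) has_derivative D b z) (at z within ?B)" if "z \<in> ?B" for z
        using U(4)[of z b] that r(2) has_derivative_at_withinI by blast
      show "onorm (D b z) \<le> L" if "z \<in> ?B" for z
        by (rule onorm_le) (rule L(2)[OF that])
    qed
    with L(1) show ?thesis by blast
  qed
  then obtain Lb where Lb: "\<And>b. Lb b > 0"
    "\<And>b x y. x \<in> ?B \<Longrightarrow> y \<in> ?B \<Longrightarrow> norm (lf c0 (pt x) b - lf c0 (pt y) b) \<le> Lb b * norm (x - y)" by metis
  define L where "L = (\<Sum>b\<in>Basis. Lb b) + 1"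
  have L: "L > 0" unfolding L_def using Lb(1) by (intro add_nonneg_pos sum_nonneg) (auto simp: less_imp_le)
  show thesis
  proof (rule that[OF r(1) K(1) L])
    show "?B \<subseteq> coord ` fst c0" using r U by blast
    fix x y v assume xy: "x \<in> ?B" "y \<in> ?B"
    have "norm (lf c0 (pt x) v - lf c0 (pt y) v) \<le> (\<Sum>b\<in>Basis. norm (lf c0 (pt x) b - lf c0 (pt y) b)) * norm v"
      by (rule norm_linear_le_sum_Basis[OF linear_compose_sub[OF lin lin]]) (use xy in auto)
    also have "\<dots> \<le> (\<Sum>b\<in>Basis. Lb b * norm (x - y)) * norm v"
      using Lb(2)[OF xy] by (intro mult_right_mono sum_mono) auto
    also have "\<dots> \<le> L * norm (x - y) * norm v"
      unfolding L_def by (intro mult_right_mono) (auto simp: sum_distrib_right algebra_simps)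
    finally show "norm (lf c0 (pt x) v - lf c0 (pt y) v) \<le> L * norm (x - y) * norm v" .
  qed (use K in auto)
qed

text \<open>The solution stays within \<open>K * C\<close> of the identity, and there the field
  differs from the identity map by at most \<open>L * (K * C)\<close>. Integrated against a control
  bounded by \<open>C\<close>, this leaves a quadratic error.\<close>

lemma small_control_exists:
  obtains \<rho> B where "\<rho> > 0" "B > 0"
    "\<And>k C. ess_bdd {0..1} C k \<Longrightarrow> C \<le> \<rho> \<Longrightarrow> \<exists>\<eta>. driven {0..1} \<eta> (\<lambda>t. integral {0..t} k) \<and> \<eta> 0 = \<one> \<and>
       \<eta> 1 \<in> fst c0 \<and> norm (coord (\<eta> 1) - e0 - integral {0..1} k) \<le> B * C\<^sup>2 \<and> norm (coord (\<eta> 1) - e0) \<le> B * C"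
proof (rule lf_lipschitz_ball)
  fix r K L :: real assume r: "r > 0" "K > 0" "L > 0" "cball e0 r \<subseteq> coord ` fst c0"
    and K: "\<And>x v. x \<in> cball e0 r \<Longrightarrow> norm (lf c0 (pt x) v) \<le> K * norm v"
    and L: "\<And>x y v. x \<in> cball e0 r \<Longrightarrow> y \<in> cball e0 r \<Longrightarrow>
       norm (lf c0 (pt x) v - lf c0 (pt y) v) \<le> L * norm (x - y) * norm v"
  have inc: "pt x \<in> fst c0" "coord (pt x) = x" if "x \<in> cball e0 r" for x
    using that r(4) inv_into_into[of x coord "fst c0"] f_inv_into_f[of x coord "fst c0"] by blast+
  have lin: "linear (\<lambda>v. lf c0 (pt x) v)" if "x \<in> cball e0 r" for x by (rule lf_linear[OF c0(1) inc(1)[OF that]])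
  \<comment> \<open>\<open>\<rho>\<close> makes the iteration preserve the ball
    (\<open>K * C \<le> r\<close>) and contract (\<open>L * C \<le> 1/2\<close>). \<open>B\<close>
    covers the displacement \<open>K * C\<close> as well as the remainder
    \<open>L * K * C\<^sup>2\<close>.\<close>
  define \<rho> where "\<rho> = min (r / K) (1 / (2 * L))"
  define B where "B = K + L * K"
  show thesis
  proof (rule that)
    show "\<rho> > 0" "B > 0" using r by (auto simp: \<rho>_def B_def add_pos_pos)
    fix k :: "real \<Rightarrow> 'e" and C assume k: "ess_bdd {0..1} C k" and C: "C \<le> \<rho>"
    have C0: "0 \<le> C" using k by (simp add: ess_bdd_def)
    have small: "K * C \<le> r" "L * C < 1"
    proof -
      have "C \<le> r / K" "C \<le> 1 / (2 * L)" using C by (auto simp: \<rho>_def)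
      then have "K * C \<le> r" "L * C \<le> 1 / 2" using r by (auto simp: field_simps)
      then show "K * C \<le> r" "L * C < 1" by auto
    qed
    show "\<exists>\<eta>. driven {0..1} \<eta> (\<lambda>t. integral {0..t} k) \<and> \<eta> 0 = \<one> \<and> \<eta> 1 \<in> fst c0 \<and>
       norm (coord (\<eta> 1) - e0 - integral {0..1} k) \<le> B * C\<^sup>2 \<and> norm (coord (\<eta> 1) - e0) \<le> B * C"
    proof (rule picard_controlled[OF k lin less_imp_le[OF r(2)] K less_imp_le[OF r(3)] L small])
      fix x assume x: "continuous_on {0..1} x" "x 0 = e0" "\<And>t. t \<in> {0..1} \<Longrightarrow> norm (x t - e0) \<le> K * C"
        and xi: "\<And>a b. 0 \<le> a \<Longrightarrow> a \<le> b \<Longrightarrow> b \<le> 1 \<Longrightarrow> ((\<lambda>\<tau>. lf c0 (pt (x \<tau>)) (k \<tau>)) has_integral (x b - x a)) {a..b}"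
      have xin: "x t \<in> cball e0 r" if "t \<in> {0..1}" for t
        using x(3)[OF that] small(1) by (simp add: dist_norm norm_minus_commute)
      define \<eta> where "\<eta> t = pt (x t)" for t
      have \<eta>c: "\<eta> t \<in> fst c0" "coord (\<eta> t) = x t" if "t \<in> {0..1}" for t
        using inc[OF xin[OF that]] by (auto simp: \<eta>_def)
      have cont: "continuous_map (top_of_set {0..1}) (mtop M) \<eta>"
      proof (rule limitin_imp_continuous_map)
        fix t :: real assume t: "t \<in> {0..1}"
        have "(x \<longlongrightarrow> coord (\<eta> t)) (at t within {0..1})" using x(1) t \<eta>c(2)[OF t] by (simp add: continuous_on_def)
        from limitin_chart_inv[OF c0(1) this \<eta>c(1)[OF t]] show "limitin (mtop M) \<eta> (\<eta> t) (at t within {0..1})"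
          by (simp add: \<eta>_def[abs_def])
      qed
      have contA: "continuous_on {0..1} (\<lambda>t. lf c0 (\<eta> t) v)" for v
        unfolding continuous_on_def
        by (intro ballI tendsto_lf[OF c0(1) \<eta>c(1)] continuous_map_imp_limitin[OF cont])
      have linA: "linear (lf c0 (\<eta> t))" if "t \<in> {0..1}" for t by (rule lf_linear[OF c0(1) \<eta>c(1)[OF that]])
      have ki: "k integrable_on {0..1}" by (rule ess_bdd_integrable[OF k])
      have "driven {0..1} \<eta> (\<lambda>t. integral {0..t} k)"
      proof (rule drivenI_chart[OF cont ess_bdd_indefinite_lipschitz[OF k]])
        fix t :: real assume t: "t \<in> {0..1}"
        have "zero_deriv (\<lambda>s. x s - lf c0 (\<eta> t) (integral {0..s} k)) t {0..1}"
          by (rule ess_bdd_freeze_derivative[OF k contA linA])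
            (use has_integral_indefinite_diff[OF ki] xi t in \<open>auto simp: \<eta>_def\<close>)
        then have "zero_deriv (\<lambda>s. coord (\<eta> s) - lf c0 (\<eta> t) (integral {0..s} k)) t {0..1}"
          by (rule has_derivative_transform[OF t, rotated]) (simp add: \<eta>c)
        then show "\<exists>c\<in>charts M. \<eta> t \<in> fst c \<and> zero_deriv (\<lambda>s. snd c (\<eta> s) - lf c (\<eta> t) (integral {0..s} k)) t {0..1}"
          using c0(1) \<eta>c(1)[OF t] by blast
      qed
      moreover have "\<eta> 0 = \<one>" by (simp add: \<eta>_def x(2))
      moreover have "\<eta> 1 \<in> fst c0" by (rule \<eta>c) simp
      moreover have "norm (coord (\<eta> 1) - e0) \<le> B * C"
      proof -
        have "norm (coord (\<eta> 1) - e0) \<le> K * C" using x(3)[of 1] \<eta>c(2)[of 1] by simp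
        also have "\<dots> \<le> B * C" using r C0 by (intro mult_right_mono) (auto simp: B_def)
        finally show ?thesis .
      qed
      moreover have "norm (coord (\<eta> 1) - e0 - integral {0..1} k) \<le> B * C\<^sup>2"
      proof -
        have e: "e0 \<in> cball e0 r" using r by simp
        have hi: "((\<lambda>\<tau>. lf c0 (\<eta> \<tau>) (k \<tau>) - k \<tau>) has_integral ((x 1 - x 0) - integral {0..1} k)) {0..1}"
          unfolding \<eta>_def by (intro has_integral_diff xi integrable_integral ki) auto
        have "ess_bdd {0..1} (L * (K * C) * C) (\<lambda>\<tau>. lf c0 (\<eta> \<tau>) (k \<tau>) - k \<tau>)"
        proof (rule ess_bdd_apply[OF k, where A="\<lambda>\<tau> v. lf c0 (\<eta> \<tau>) v - v"])
          show "continuous_on {0..1} (\<lambda>t. lf c0 (\<eta> t) v - v)" for v by (intro continuous_intros contA)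
          show "linear (\<lambda>v. lf c0 (\<eta> t) v - v)" if "t \<in> {0..1}" for t
            by (intro linear_compose_sub linA that linear_ident)
          show "norm (lf c0 (\<eta> t) v - v) \<le> L * (K * C) * norm v" if t: "t \<in> {0..1}" for t v
          proof -
            have "norm (lf c0 (\<eta> t) v - v) \<le> L * norm (x t - e0) * norm v"
              using L[OF xin[OF t] e, of v] by (simp add: \<eta>_def lf_one)
            also have "\<dots> \<le> L * (K * C) * norm v"
              using x(3)[OF t] r by (intro mult_right_mono mult_left_mono) auto
            finally show ?thesis .
          qed
        qed (use r C0 in auto)
        from ess_bdd_norm_integral_le[OF this]
        have "norm (x 1 - e0 - integral {0..1} k) \<le> L * (K * C) * C"
          using integral_unique[OF hi] x(2) by simp
        also have "\<dots> \<le> B * C\<^sup>2" using r C0 by (simp add: B_def power2_eq_square algebra_simps)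
        finally show ?thesis using \<eta>c(2)[of 1] by simp
      qed
      ultimately show ?thesis by blast
    qed
  qed
qed

section \<open>One-parameter curves and the exponential\<close>

text \<open>For a constant control, left translation and a shift of time preserve the equation, so a
  solution on \<open>[0,1]\<close> can be copied to every unit interval.\<close>

lemma driven_translate_shift:
  assumes d: "driven {0..1} \<eta> (\<lambda>t. t *\<^sub>R v)" and p: "p \<in> carrier G"
  shows "driven {k..k + 1} (\<lambda>t. p \<otimes> \<eta> (t - k)) (\<lambda>t. t *\<^sub>R v)"
  unfolding driven_def
proof (intro conjI ballI)
  have "continuous_map (top_of_set {k..k + 1}) (mtop M) (\<eta> \<circ> (\<lambda>t. t - k))"
  proof (rule continuous_map_compose)
    show "continuous_map (top_of_set {k..k + 1}) (top_of_set {0..1}) (\<lambda>t. t - k)"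
      by (auto simp: continuous_map_in_subtopology intro!: continuous_intros)
    show "continuous_map (top_of_set {0..1}) (mtop M) \<eta>" using d by (simp add: driven_def)
  qed
  from continuous_map_compose[OF this mdiff_continuous[OF mdiff_left[OF p]]]
  show "continuous_map (top_of_set {k..k + 1}) (mtop M) (\<lambda>t. p \<otimes> \<eta> (t - k))" by (simp add: o_def)
  show "\<exists>C. C-lipschitz_on {k..k + 1} (\<lambda>t. t *\<^sub>R v)" using scaleR_lipschitz by blast
  have g: "\<eta> t \<in> carrier G" if "t \<in> {0..1}" for t by (rule driven_carrier[OF d that])
  fix t assume t: "t \<in> {k..k + 1}"
  then have t': "t - k \<in> {0..1}" by auto
  have 1: "((\<lambda>s. s - k) has_derivative (\<lambda>h. h)) (at t within {k..k + 1})"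
    by (auto intro!: derivative_eq_intros)
  have im: "(\<lambda>s. s - k) ` {k..k + 1} = {0..1}" by simp
  have "zero_deriv (\<lambda>s. coord (inv (\<eta> (t - k)) \<otimes> \<eta> (s - k)) - (s - k) *\<^sub>R v) t {k..k + 1}"
    by (rule has_derivative_in_compose[OF 1, unfolded im, OF driven_derivative[OF d t']])
  from has_derivative_diff[OF this has_derivative_const[of "k *\<^sub>R v"]]
  have "zero_deriv (\<lambda>s. (coord (inv (\<eta> (t - k)) \<otimes> \<eta> (s - k)) - (s - k) *\<^sub>R v) - k *\<^sub>R v) t {k..k + 1}"
    by simp
  then show "zero_deriv (\<lambda>s. coord (inv (p \<otimes> \<eta> (t - k)) \<otimes> (p \<otimes> \<eta> (s - k))) - s *\<^sub>R v) t {k..k + 1}"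
  proof (rule has_derivative_transform[OF t, rotated])
    fix s assume "s \<in> {k..k + 1}"
    then have gs: "\<eta> (s - k) \<in> carrier G" by (intro g) auto
    have "inv (p \<otimes> \<eta> (t - k)) \<otimes> (p \<otimes> \<eta> (s - k)) = inv (\<eta> (t - k)) \<otimes> \<eta> (s - k)"
      using p gs g[OF t'] by (simp add: inv_mult_group m_assoc mult_inv_cancel)
    then show "coord (inv (p \<otimes> \<eta> (t - k)) \<otimes> (p \<otimes> \<eta> (s - k))) - s *\<^sub>R v
        = coord (inv (\<eta> (t - k)) \<otimes> \<eta> (s - k)) - (s - k) *\<^sub>R v - k *\<^sub>R v"
      by (simp add: algebra_simps)
  qed
qed

lemma driven_union:
  assumes "driven S \<gamma> H" "driven T \<gamma> H" and t: "t \<in> S" "t \<in> T"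
  shows "limitin (mtop M) \<gamma> (\<gamma> t) (at t within (S \<union> T))"
    "zero_deriv (\<lambda>s. coord (inv (\<gamma> t) \<otimes> \<gamma> s) - H s) t (S \<union> T)"
proof -
  show "limitin (mtop M) \<gamma> (\<gamma> t) (at t within (S \<union> T))"
    using driven_limitin[OF assms(1) t(1)] driven_limitin[OF assms(2) t(2)]
    by (auto simp: limitin_def at_within_union eventually_sup)
  show "zero_deriv (\<lambda>s. coord (inv (\<gamma> t) \<otimes> \<gamma> s) - H s) t (S \<union> T)"
    using driven_derivative[OF assms(1) t(1)] driven_derivative[OF assms(2) t(2)]
    unfolding has_derivative_at_within by (auto simp: at_within_union intro: filterlim_sup)
qed

text \<open>At an integer two one-sided statements are joined; at other times the unit interval is a
  neighbourhood.\<close>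

lemma driven_UNIV_glue:
  assumes d: "\<And>k::int. driven {of_int k..of_int k + 1} \<gamma> (\<lambda>t. t *\<^sub>R v)"
  shows "driven UNIV \<gamma> (\<lambda>t. t *\<^sub>R v)"
proof -
  have "limitin (mtop M) \<gamma> (\<gamma> t) (at t) \<and> ((\<lambda>s. coord (inv (\<gamma> t) \<otimes> \<gamma> s) - s *\<^sub>R v) has_derivative (\<lambda>_. 0)) (at t)" for t
  proof (cases "t = of_int \<lfloor>t\<rfloor>")
    case True
    define k where "k = \<lfloor>t\<rfloor>"
    have t: "t = of_int k" using True by (simp add: k_def)
    have S: "driven {of_int k - 1..of_int k} \<gamma> (\<lambda>t. t *\<^sub>R v)" using d[of "k - 1"] by simp
    have "{of_int k - 1..of_int k} \<union> {of_int k..of_int k + 1} = {of_int k - 1..of_int k + 1::real}" by auto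
    moreover have "at t within {of_int k - 1..of_int k + 1} = at t"
      using t by (intro at_within_Icc_at) auto
    ultimately show ?thesis
      using driven_union[OF S d[of k], of t] t by simp
  next
    case False
    define k where "k = \<lfloor>t\<rfloor>"
    have k: "of_int k < t" "t < of_int k + 1" using False floor_correct[of t] unfolding k_def by linarith+
    then have "at t within {of_int k..of_int k + 1} = at t" by (intro at_within_Icc_at)
    with driven_limitin[OF d[of k], of t] driven_derivative[OF d[of k], of t] k show ?thesis by simp
  qed
  then show ?thesis
    unfolding driven_def using limitin_imp_continuous_map[of UNIV "mtop M" \<gamma>] scaleR_lipschitz by blast
qed

text \<open>Picard iteration only covers small vectors. So \<open>v\<close> is scaled down to
  \<open>w\<close>, the solution is continued over unit intervals by the powers of its end point,
  and time is scaled back.\<close>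

lemma exp_curve_exists: "\<exists>\<gamma>. driven UNIV \<gamma> (\<lambda>t. t *\<^sub>R v) \<and> \<gamma> 0 = \<one>"
proof (rule small_control_exists)
  fix \<rho> B :: real assume \<rho>: "\<rho> > 0"
    and ex: "\<And>k C. ess_bdd {0..1} C k \<Longrightarrow> C \<le> \<rho> \<Longrightarrow> \<exists>\<eta>. driven {0..1} \<eta> (\<lambda>t. integral {0..t} k) \<and> \<eta> 0 = \<one> \<and>
       \<eta> 1 \<in> fst c0 \<and> norm (coord (\<eta> 1) - e0 - integral {0..1} k) \<le> B * C\<^sup>2 \<and> norm (coord (\<eta> 1) - e0) \<le> B * C"
  \<comment> \<open>This gives \<open>norm w = \<rho> * norm v / (norm v + 1) \<le> \<rho>\<close>;
    the summand \<open>1\<close> keeps \<open>a\<close> positive for \<open>v = 0\<close>.\<close>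
  define a where "a = (norm v + 1) / \<rho>"
  have a: "a > 0" using \<rho> by (simp add: a_def add_nonneg_pos)
  define w where "w = v /\<^sub>R a"
  have aw: "a *\<^sub>R w = v" using a by (simp add: w_def)
  have "norm w \<le> \<rho>" using \<rho> a by (simp add: w_def a_def field_simps)
  moreover have "ess_bdd {0..1} (norm w) (\<lambda>_. w)" by (simp add: ess_bdd_def)
  ultimately obtain \<eta> where \<eta>: "driven {0..1} \<eta> (\<lambda>t. integral {0..t} (\<lambda>_. w))" "\<eta> 0 = \<one>"
    using ex by blast
  have d: "driven {0..1} \<eta> (\<lambda>t. t *\<^sub>R w)" by (rule driven_cong[OF \<eta>(1)]) auto
  have g1: "\<eta> 1 \<in> carrier G" by (rule driven_carrier[OF d]) simp
  define \<gamma> where "\<gamma> t = \<eta> 1 [^] \<lfloor>t\<rfloor> \<otimes> \<eta> (t - of_int \<lfloor>t\<rfloor>)" for t :: real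
  have "driven {of_int k..of_int k + 1} \<gamma> (\<lambda>t. t *\<^sub>R w)" for k :: int
  proof (rule driven_cong[OF driven_translate_shift[OF d, of "\<eta> 1 [^] k" "of_int k"]])
    show "\<eta> 1 [^] k \<in> carrier G" using g1 by simp
    fix s :: real assume s: "s \<in> {of_int k..of_int k + 1}"
    \<comment> \<open>At the right end of the interval the floor jumps; the two formulas agree there
      because \<open>\<eta> 0 = \<one>\<close>.\<close>
    show "\<eta> 1 [^] k \<otimes> \<eta> (s - of_int k) = \<gamma> s"
    proof (cases "s = of_int k + 1")
      case True
      then have "\<lfloor>s\<rfloor> = k + 1" by simp
      then show ?thesis using True g1 by (simp add: \<gamma>_def \<eta>(2) int_pow_mult)
    next
      case False
      then have "\<lfloor>s\<rfloor> = k" using s by (intro floor_unique) auto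
      then show ?thesis by (simp add: \<gamma>_def)
    qed
  qed simp
  then have "driven UNIV \<gamma> (\<lambda>t. t *\<^sub>R w)" by (rule driven_UNIV_glue)
  from driven_scaleR_rescale[OF this, of a] have "driven UNIV (\<lambda>t. \<gamma> (a * t)) (\<lambda>t. t *\<^sub>R v)" by (simp only: aw)
  moreover have "\<gamma> (a * 0) = \<one>" by (simp add: \<gamma>_def \<eta>(2))
  ultimately show ?thesis by blast
qed

definition exp_curve :: "'e \<Rightarrow> real \<Rightarrow> 'a" where
  "exp_curve v = (SOME \<gamma>. driven UNIV \<gamma> (\<lambda>t. t *\<^sub>R v) \<and> \<gamma> 0 = \<one>)"

lemma exp_curve: "driven UNIV (exp_curve v) (\<lambda>t. t *\<^sub>R v)" "exp_curve v 0 = \<one>"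
  using someI_ex[OF exp_curve_exists[of v]] by (auto simp: exp_curve_def)

lemma exp_curve_carrier: "exp_curve v t \<in> carrier G"
  using driven_carrier[OF exp_curve(1)] by simp

lemma chart_velocity_iff:
  assumes c: "c \<in> charts M" "\<gamma> t \<in> fst c"
  shows "((snd c \<circ> \<gamma>) has_vector_derivative lf c (\<gamma> t) v) (at t) \<longleftrightarrow>
    ((\<lambda>s. snd c (\<gamma> s) - lf c (\<gamma> t) (s *\<^sub>R v)) has_derivative (\<lambda>_. 0)) (at t)"
proof
  have eq: "lf c (\<gamma> t) (s *\<^sub>R v) = s *\<^sub>R lf c (\<gamma> t) v" for s by (rule linear_scale[OF lf_linear[OF c]])
  have d: "((\<lambda>s. s *\<^sub>R lf c (\<gamma> t) v) has_derivative (\<lambda>h. h *\<^sub>R lf c (\<gamma> t) v)) (at t)"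
    by (auto intro!: derivative_eq_intros)
  show "((\<lambda>s. snd c (\<gamma> s) - lf c (\<gamma> t) (s *\<^sub>R v)) has_derivative (\<lambda>_. 0)) (at t)"
    if "((snd c \<circ> \<gamma>) has_vector_derivative lf c (\<gamma> t) v) (at t)"
    using has_derivative_diff[OF that[unfolded has_vector_derivative_def] d] by (simp add: eq)
  show "((snd c \<circ> \<gamma>) has_vector_derivative lf c (\<gamma> t) v) (at t)"
    if "((\<lambda>s. snd c (\<gamma> s) - lf c (\<gamma> t) (s *\<^sub>R v)) has_derivative (\<lambda>_. 0)) (at t)"
    using has_derivative_add[OF that d] by (simp add: eq has_vector_derivative_def o_def)
qed

lemma driven_exp_iff:
  "driven UNIV \<gamma> (\<lambda>t. t *\<^sub>R v) \<longleftrightarrow> continuous_map euclideanreal (mtop M) \<gamma> \<and>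
    (\<forall>t. \<forall>c\<in>charts M. \<gamma> t \<in> fst c \<longrightarrow> ((snd c \<circ> \<gamma>) has_vector_derivative lf c (\<gamma> t) v) (at t))"
proof (intro iffI conjI allI ballI impI; (elim conjE)?)
  assume d: "driven UNIV \<gamma> (\<lambda>t. t *\<^sub>R v)"
  then show "continuous_map euclideanreal (mtop M) \<gamma>" by (simp add: driven_def)
  fix t c assume c: "c \<in> charts M" "\<gamma> t \<in> fst c"
  show "((snd c \<circ> \<gamma>) has_vector_derivative lf c (\<gamma> t) v) (at t)"
    using driven_chart[OF d UNIV_I c] by (simp add: chart_velocity_iff[where \<gamma>=\<gamma>, OF c])
next
  assume cont: "continuous_map euclideanreal (mtop M) \<gamma>"
    and der: "\<forall>t. \<forall>c\<in>charts M. \<gamma> t \<in> fst c \<longrightarrow> ((snd c \<circ> \<gamma>) has_vector_derivative lf c (\<gamma> t) v) (at t)"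
  show "driven UNIV \<gamma> (\<lambda>t. t *\<^sub>R v)"
  proof (rule drivenI_chart[OF _ scaleR_lipschitz])
    show "continuous_map (top_of_set UNIV) (mtop M) \<gamma>" using cont by simp
    fix t
    have "\<gamma> t \<in> topspace (mtop M)" using cont by (auto simp: continuous_map_def)
    then obtain c where c: "c \<in> charts M" "\<gamma> t \<in> fst c" by (rule obtain_chart)
    then show "\<exists>c\<in>charts M. \<gamma> t \<in> fst c \<and> zero_deriv (\<lambda>s. snd c (\<gamma> s) - lf c (\<gamma> t) (s *\<^sub>R v)) t UNIV"
      using der chart_velocity_iff[where \<gamma>=\<gamma>, OF c] by auto
  qed
qed

text \<open>\<open>exp_curve v\<close> run at speed \<open>t\<close> solves the equation for
  \<open>t *\<^sub>R v\<close> and passes through \<open>exp_curve v t\<close> at time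
  \<open>1\<close>; uniqueness determines the definite description.\<close>

lemma lie_exp_eq_exp_curve: "lie_exp G M (t *\<^sub>R v) = exp_curve v t"
proof -
  have "lie_exp G M (t *\<^sub>R v) = (THE p. \<exists>\<gamma>. driven UNIV \<gamma> (\<lambda>s. s *\<^sub>R (t *\<^sub>R v)) \<and> \<gamma> 0 = \<one> \<and> \<gamma> 1 = p)"
    unfolding lie_exp_def driven_exp_iff by (rule arg_cong[where f=The]) (auto simp: fun_eq_iff)
  also have "\<dots> = exp_curve v t"
  proof (rule the_equality)
    have "driven UNIV (\<lambda>s. exp_curve v (t * s)) (\<lambda>s. s *\<^sub>R (t *\<^sub>R v))"
      by (rule driven_scaleR_rescale[OF exp_curve(1)])
    then show ex: "\<exists>\<gamma>. driven UNIV \<gamma> (\<lambda>s. s *\<^sub>R (t *\<^sub>R v)) \<and> \<gamma> 0 = \<one> \<and> \<gamma> 1 = exp_curve v t"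
      by (rule exI[of _ "\<lambda>s. exp_curve v (t * s)", OF conjI]) (simp add: exp_curve(2))
    fix p assume "\<exists>\<gamma>. driven UNIV \<gamma> (\<lambda>s. s *\<^sub>R (t *\<^sub>R v)) \<and> \<gamma> 0 = \<one> \<and> \<gamma> 1 = p"
    with ex show "p = exp_curve v t" using driven_unique[OF _ _ convex_UNIV UNIV_I _ UNIV_I] by metis
  qed
  finally show ?thesis .
qed

text \<open>Factor out \<open>?\<gamma> t\<close>: the remaining increment \<open>u\<close> passes
  through the identity at time \<open>t\<close>, where the derivative of \<open>Ad\<close> is the
  bracket.\<close>

lemma Ad_exp_curve_derivative:
  "((\<lambda>s. Ad (exp_curve X s) v) has_vector_derivative Ad (exp_curve X t) (br X v)) (at t)"
proof -
  let ?\<gamma> = "exp_curve X"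
  note gc = exp_curve_carrier[of X]
  define u where "u = (\<lambda>s. inv (?\<gamma> t) \<otimes> ?\<gamma> s)"
  have lu: "limitin (mtop M) u \<one> (at t)"
    using driven_limitin_increment[OF exp_curve(1) UNIV_I, of X t] gc by (simp add: u_def)
  have ut: "u t = \<one>" using gc by (simp add: u_def)
  have du: "((\<lambda>s. coord (u s) - s *\<^sub>R X) has_derivative (\<lambda>_. 0)) (at t)"
    using driven_derivative[OF exp_curve(1) UNIV_I, of X t] by (simp add: u_def)
  have lin: "linear (\<lambda>w. br w v)" by (rule bracket_linear)
  have "((\<lambda>s. Ad (pt (coord (u s))) v - br (s *\<^sub>R X) v) has_derivative (\<lambda>_. 0)) (at t)"
    by (rule zero_derivative_comp[where F="\<lambda>x. Ad (pt x) v" and F'="\<lambda>w. br w v", OF du scaleR_lipschitz UNIV_I])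
      (simp add: ut Ad_has_derivative)
  then have "((\<lambda>s. Ad (pt (coord (u s))) v - s *\<^sub>R br X v + s *\<^sub>R br X v) has_derivative (\<lambda>h. 0 + h *\<^sub>R br X v)) (at t)"
    by (intro has_derivative_add) (auto intro!: derivative_eq_intros simp: linear_scale[OF lin])
  then have "((\<lambda>s. Ad (pt (coord (u s))) v) has_derivative (\<lambda>h. h *\<^sub>R br X v)) (at t)" by simp
  then have "((\<lambda>s. Ad (u s) v) has_derivative (\<lambda>h. h *\<^sub>R br X v)) (at t)"
    by (rule has_derivative_transform_eventually)
      (use limitin_in_chart[OF c0(1) lu c0(2)] ut c0 in \<open>auto elim: eventually_mono\<close>)
  then have "((\<lambda>s. Ad (?\<gamma> t) (Ad (u s) v)) has_derivative (\<lambda>h. Ad (?\<gamma> t) (h *\<^sub>R br X v))) (at t)"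
    by (rule bounded_linear.has_derivative[rotated]) (simp add: Ad_linear[OF gc] linear_conv_bounded_linear[symmetric])
  moreover have "Ad (?\<gamma> t) (Ad (u s) v) = Ad (?\<gamma> s) v" for s
    using gc[of t] gc[of s] by (simp add: u_def Ad_mult[symmetric] mult_inv_cancel)
  ultimately show ?thesis
    by (simp add: has_vector_derivative_def linear_scale[OF Ad_linear[OF gc]])
qed

lemma continuous_on_Ad_exp_curve: "continuous_on S (\<lambda>t. Ad (exp_curve X t) v)"
  using Ad_exp_curve_derivative
  by (intro continuous_at_imp_continuous_on ballI) (rule has_vector_derivative_continuous)

end

section \<open>The differential of the end-point map\<close>

lemma AE_lebesgue_on_iff_negligible:
  assumes S: "S \<in> sets lebesgue"
  shows "(AE t in lebesgue_on S. Q t) \<longleftrightarrow> negligible {t \<in> S. \<not> Q t}"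
proof -
  have "(AE t in lebesgue_on S. Q t) \<longleftrightarrow> (AE t in lebesgue. t \<in> S \<longrightarrow> Q t)"
    using S by (simp add: AE_restrict_space_iff)
  also have "\<dots> \<longleftrightarrow> negligible {t \<in> S. \<not> Q t}"
  proof
    assume "AE t in lebesgue. t \<in> S \<longrightarrow> Q t"
    then obtain N where N: "N \<in> null_sets lebesgue" "{t \<in> space lebesgue. \<not> (t \<in> S \<longrightarrow> Q t)} \<subseteq> N"
      by (auto simp: eventually_ae_filter)
    then have "negligible N" by (simp add: negligible_iff_null_sets)
    then show "negligible {t \<in> S. \<not> Q t}" by (rule negligible_subset) (use N in auto)
  next
    assume "negligible {t \<in> S. \<not> Q t}"
    then have "AE t in lebesgue. t \<notin> {t \<in> S. \<not> Q t}"
      by (intro AE_not_in) (simp add: negligible_iff_null_sets)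
    then show "AE t in lebesgue. t \<in> S \<longrightarrow> Q t" by eventually_elim auto
  qed
  finally show ?thesis .
qed

section \<open>The space of essentially bounded controls\<close>

lemma linf_esssup_nonneg: "h \<in> borel_measurable (lebesgue_on {0..1}) \<Longrightarrow> 0 \<le> linf_esssup h"
proof -
  have "esssup (lebesgue_on {0..1::real}) (\<lambda>_::real. 0::ereal) = 0"
    by (rule esssup_const) (simp add: emeasure_restrict_space)
  moreover assume "h \<in> borel_measurable (lebesgue_on {0..1})"
  have "esssup (lebesgue_on {0..1}) (\<lambda>_::real. 0::ereal) \<le> linf_esssup h"
    unfolding linf_esssup_def by (rule esssup_mono) auto
  ultimately show ?thesis by simp
qed

text \<open>The essential supremum is itself a bound off a null set, so \<open>linf_norm\<close> is
  an admissible constant for \<open>ess_bdd\<close>.\<close>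

lemma linf_imp_ess_bdd:
  assumes "h \<in> linf W"
  shows "ess_bdd {0..1} (linf_norm h) h"
proof -
  have m: "h \<in> borel_measurable (lebesgue_on {0..1})" and fin: "linf_esssup h < \<infinity>"
    using assms by (auto simp: linf_def)
  have nn: "0 \<le> linf_esssup h" by (rule linf_esssup_nonneg[OF m])
  then have eq: "ereal (linf_norm h) = linf_esssup h"
    using fin by (cases "linf_esssup h") (auto simp: linf_norm_def)
  have "AE t in lebesgue_on {0..1}. ereal (norm (h t)) \<le> linf_esssup h"
    unfolding linf_esssup_def by (rule esssup_AE)
  then have "AE t in lebesgue_on {0..1}. norm (h t) \<le> linf_norm h"
    by eventually_elim (simp add: eq[symmetric])
  then have "negligible {t \<in> {0..1}. \<not> norm (h t) \<le> linf_norm h}"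
    by (subst (asm) AE_lebesgue_on_iff_negligible) auto
  then show ?thesis using m nn eq by (auto simp: ess_bdd_def not_le simp flip: ereal_less_eq(5))
qed

lemma ess_bdd_imp_linf:
  assumes h: "ess_bdd {0..1} C h" and W: "\<And>t. t \<in> {0..1} \<Longrightarrow> h t \<in> W"
  shows "h \<in> linf W" "linf_norm h \<le> C"
proof -
  have m: "h \<in> borel_measurable (lebesgue_on {0..1})" and C: "0 \<le> C"
    and n: "negligible {t \<in> {0..1}. \<not> norm (h t) \<le> C}"
    using h by (auto simp: ess_bdd_def not_le)
  have "AE t in lebesgue_on {0..1}. norm (h t) \<le> C"
    by (subst AE_lebesgue_on_iff_negligible) (use n in auto)
  then have "linf_esssup h \<le> ereal C"
    unfolding linf_esssup_def by (intro esssup_I) (use m in auto)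
  moreover have "0 \<le> linf_esssup h" by (rule linf_esssup_nonneg[OF m])
  ultimately show "h \<in> linf W" "linf_norm h \<le> C"
    using m W by (cases "linf_esssup h"; auto simp: linf_def linf_norm_def)+
qed

lemma linf_norm_nonneg: "h \<in> linf W \<Longrightarrow> 0 \<le> linf_norm h"
  using linf_imp_ess_bdd by (auto simp: ess_bdd_def)

lemma ess_bdd_add:
  assumes "ess_bdd S C h" "ess_bdd S D k"
  shows "ess_bdd S (C + D) (\<lambda>t. h t + k t)"
proof -
  have "negligible ({t \<in> S. C < norm (h t)} \<union> {t \<in> S. D < norm (k t)})"
    using assms by (simp add: ess_bdd_def)
  then have "negligible {t \<in> S. C + D < norm (h t + k t)}"
  proof (rule negligible_subset, intro subsetI)
    fix t assume "t \<in> {t \<in> S. C + D < norm (h t + k t)}"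
    then show "t \<in> {t \<in> S. C < norm (h t)} \<union> {t \<in> S. D < norm (k t)}"
      using norm_triangle_ineq[of "h t" "k t"] by auto
  qed
  then show ?thesis using assms by (auto simp: ess_bdd_def)
qed

lemma ess_bdd_scaleR:
  assumes "ess_bdd S C h"
  shows "ess_bdd S (\<bar>a\<bar> * C) (\<lambda>t. a *\<^sub>R h t)"
proof -
  have "negligible {t \<in> S. C < norm (h t)}" using assms by (simp add: ess_bdd_def)
  then have "negligible {t \<in> S. \<bar>a\<bar> * C < norm (a *\<^sub>R h t)}"
    by (rule negligible_subset) (auto simp: not_le[symmetric] intro: mult_left_mono)
  then show ?thesis using assms by (auto simp: ess_bdd_def)
qed

lemma linf_add: "subspace W \<Longrightarrow> h \<in> linf W \<Longrightarrow> k \<in> linf W \<Longrightarrow> (\<lambda>t. h t + k t) \<in> linf W"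
  by (rule ess_bdd_imp_linf[OF ess_bdd_add[OF linf_imp_ess_bdd linf_imp_ess_bdd]])
    (auto simp: linf_def subspace_add)

lemma
  assumes "subspace W" "h \<in> linf W"
  shows linf_scaleR: "(\<lambda>t. a *\<^sub>R h t) \<in> linf W"
    and linf_norm_scaleR_le: "linf_norm (\<lambda>t. a *\<^sub>R h t) \<le> \<bar>a\<bar> * linf_norm h"
  by (rule ess_bdd_imp_linf[where W=W, OF ess_bdd_scaleR[OF linf_imp_ess_bdd[OF assms(2)]]];
      use assms in \<open>auto simp: linf_def subspace_scale\<close>)+

text \<open>Evaluate both expansions at \<open>a *\<^sub>R k\<close> for a small \<open>a\<close>
  and divide by \<open>a\<close>. Full rank is stated for some differential; uniqueness lets it be
  compared with the explicit one.\<close>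

lemma end_differential_unique:
  assumes W: "subspace W" and D: "end_differential G M W h c D" "end_differential G M W h c D'" and k: "k \<in> linf W"
  shows "D k = D' k"
proof -
  let ?n = "linf_norm k"
  have n: "0 \<le> ?n" by (rule linf_norm_nonneg[OF k])
  have "norm (D k - D' k) \<le> 0 + \<epsilon>" if "\<epsilon> > 0" for \<epsilon>
  proof -
    define \<epsilon>' where "\<epsilon>' = \<epsilon> / (2 * (?n + 1))"
    have \<epsilon>': "\<epsilon>' > 0" using that n by (simp add: \<epsilon>'_def)
    obtain d where d: "d > 0" "\<And>k. k \<in> linf W \<Longrightarrow> linf_norm k < d \<Longrightarrow>
        norm (snd c (end_point G M (\<lambda>t. h t + k t)) - snd c (end_point G M h) - D k) \<le> \<epsilon>' * linf_norm k"
      using D(1) \<epsilon>' unfolding end_differential_def by blast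
    obtain d' where d': "d' > 0" "\<And>k. k \<in> linf W \<Longrightarrow> linf_norm k < d' \<Longrightarrow>
        norm (snd c (end_point G M (\<lambda>t. h t + k t)) - snd c (end_point G M h) - D' k) \<le> \<epsilon>' * linf_norm k"
      using D(2) \<epsilon>' unfolding end_differential_def by blast
    \<comment> \<open>The scaled control must have norm strictly below both radii; the summand
      \<open>1\<close> covers controls of norm zero.\<close>
    define a where "a = min d d' / (2 * (?n + 1))"
    have a: "a > 0" using d d' n by (simp add: a_def)
    let ?k = "\<lambda>t. a *\<^sub>R k t"
    have lk: "?k \<in> linf W" "linf_norm ?k \<le> a * ?n"
      using linf_scaleR[OF W k] linf_norm_scaleR_le[OF W k, of a] a by auto
    have "a * ?n \<le> a * (?n + 1)" using a by simp
    also have "\<dots> = min d d' / 2" using n by (simp add: a_def field_simps add_nonneg_eq_0_iff)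
    also have "\<dots> < min d d'" using d(1) d'(1) by (simp add: min_def)
    finally have sm: "linf_norm ?k < d" "linf_norm ?k < d'" using lk(2) by auto
    have "D ?k = a *\<^sub>R D k" "D' ?k = a *\<^sub>R D' k" using D k unfolding end_differential_def by blast+
    then have "a * norm (D k - D' k) = norm (D ?k - D' ?k)"
      using a by (simp flip: scaleR_diff_right)
    also have "\<dots> \<le> \<epsilon>' * linf_norm ?k + \<epsilon>' * linf_norm ?k"
      using norm_triangle_mono[OF d'(2)[OF lk(1) sm(2)] d(2)[OF lk(1) sm(1), unfolded norm_minus_commute[of _ "D ?k"]]]
      by (simp add: algebra_simps)
    also have "\<dots> \<le> \<epsilon>' * (a * ?n) + \<epsilon>' * (a * ?n)" using lk(2) \<epsilon>' by (intro add_mono mult_left_mono) auto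
    also have "\<dots> = a * (\<epsilon>' * (2 * ?n))" by simp
    finally have "norm (D k - D' k) \<le> \<epsilon>' * (2 * ?n)" using a by simp
    also have "\<dots> \<le> \<epsilon>' * (2 * (?n + 1))" using \<epsilon>' by simp
    also have "\<dots> = \<epsilon>" using n by (simp add: \<epsilon>'_def field_simps add_nonneg_eq_0_iff)
    finally show ?thesis by simp
  qed
  then have "norm (D k - D' k) \<le> 0" by (rule field_le_epsilon)
  then show ?thesis by simp
qed

context lie_gp
begin

lemma end_point_eqI:
  assumes h: "ess_bdd {0..1} C h" and \<gamma>: "driven {0..1} \<gamma> (\<lambda>t. integral {0..t} h)" "\<gamma> 0 = \<one>"
  shows "end_point G M h = \<gamma> 1"
  unfolding end_point_def curve_with_control_iff_driven[OF h]
proof (rule the_equality)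
  show "\<exists>\<gamma>'. (\<gamma>' 0 = \<one> \<and> driven {0..1} \<gamma>' (\<lambda>t. integral {0..t} h)) \<and> \<gamma>' 1 = \<gamma> 1" using \<gamma> by blast
  fix p assume "\<exists>\<gamma>'. (\<gamma>' 0 = \<one> \<and> driven {0..1} \<gamma>' (\<lambda>t. integral {0..t} h)) \<and> \<gamma>' 1 = p"
  then obtain \<gamma>' where g: "\<gamma>' 0 = \<one>" "driven {0..1} \<gamma>' (\<lambda>t. integral {0..t} h)" "\<gamma>' 1 = p" by blast
  have "\<gamma>' 1 = \<gamma> 1" by (rule driven_unique[OF g(2) \<gamma>(1), of 0]) (use g \<gamma> in auto)
  then show "p = \<gamma> 1" using g by simp
qed

text \<open>Up to right translation by \<open>exp X\<close>, this is the differential of the end-point map at the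
  constant control \<open>X\<close>.\<close>

definition end_var :: "'e \<Rightarrow> (real \<Rightarrow> 'e) \<Rightarrow> 'e" where
  "end_var X k = integral {0..1} (\<lambda>t. Ad (exp_curve X t) (k t))"

lemma Ad_exp_bound:
  obtains K where "K > 0" "\<And>t v. t \<in> {0..1} \<Longrightarrow> norm (Ad (exp_curve X t) v) \<le> K * norm v"
  using linear_family_bound[of "{0..1::real}" "\<lambda>t. Ad (exp_curve X t)", OF compact_Icc continuous_on_Ad_exp_curve Ad_linear[OF exp_curve_carrier]]
  by blast

lemma ess_bdd_Ad_exp:
  assumes "ess_bdd {0..1} C k" "0 \<le> K" "\<And>t v. t \<in> {0..1} \<Longrightarrow> norm (Ad (exp_curve X t) v) \<le> K * norm v"
  shows "ess_bdd {0..1} (K * C) (\<lambda>t. Ad (exp_curve X t) (k t))"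
  by (rule ess_bdd_apply[OF assms(1) _ continuous_on_Ad_exp_curve Ad_linear[OF exp_curve_carrier] assms(2,3)]) auto

lemma Ad_exp_integrable:
  assumes "ess_bdd {0..1} C k"
  shows "(\<lambda>t. Ad (exp_curve X t) (k t)) integrable_on {0..1}"
proof -
  obtain K where "K > 0" "\<And>t v. t \<in> {0..1} \<Longrightarrow> norm (Ad (exp_curve X t) v) \<le> K * norm v"
    using Ad_exp_bound by metis
  then show ?thesis using ess_bdd_integrable[OF ess_bdd_Ad_exp[OF assms]] by (meson less_imp_le)
qed

text \<open>The perturbed curve is sought as \<open>\<eta> \<otimes> exp_curve X\<close>. By
  \<open>driven_mult\<close> it has the control \<open>h + k\<close> when \<open>\<eta>\<close> has
  the control \<open>Ad(exp tX) k(t)\<close>, which is small, so \<open>small_control_exists\<close>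
  applies to \<open>\<eta>\<close>. \<open>h\<close> is any control with primitive
  \<open>t *\<^sub>R X\<close>, because the curve fixes its control only through the
  primitive.\<close>

lemma end_expansion:
  obtains \<rho> B where "\<rho> > 0" "B > 0"
    "\<And>h Ch k C. ess_bdd {0..1} Ch h \<Longrightarrow> (\<And>t. t \<in> {0..1} \<Longrightarrow> integral {0..t} h = t *\<^sub>R X) \<Longrightarrow>
       ess_bdd {0..1} C k \<Longrightarrow> C \<le> \<rho> \<Longrightarrow>
       \<exists>q\<in>fst c0. end_point G M (\<lambda>t. h t + k t) = q \<otimes> exp_curve X 1 \<and>
         norm (coord q - e0 - end_var X k) \<le> B * C\<^sup>2 \<and> norm (coord q - e0) \<le> B * C"
proof (rule small_control_exists)
  fix \<rho> B :: real assume \<rho>: "\<rho> > 0" "B > 0"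
    and ex: "\<And>k C. ess_bdd {0..1} C k \<Longrightarrow> C \<le> \<rho> \<Longrightarrow> \<exists>\<eta>. driven {0..1} \<eta> (\<lambda>t. integral {0..t} k) \<and> \<eta> 0 = \<one> \<and>
       \<eta> 1 \<in> fst c0 \<and> norm (coord (\<eta> 1) - e0 - integral {0..1} k) \<le> B * C\<^sup>2 \<and> norm (coord (\<eta> 1) - e0) \<le> B * C"
  obtain K where K: "K > 0" "\<And>t v. t \<in> {0..1} \<Longrightarrow> norm (Ad (exp_curve X t) v) \<le> K * norm v"
    using Ad_exp_bound by metis
  show thesis
  proof (rule that)
    \<comment> \<open>\<open>K\<close> bounds \<open>Ad\<close> along the curve, so the control of
      \<open>\<eta>\<close> is bounded by \<open>K * C\<close>: the linear estimate needs
      \<open>K\<close>, the quadratic one \<open>K\<^sup>2\<close>.\<close>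
    show "\<rho> / K > 0" "B * (K + K\<^sup>2) > 0" using \<rho> K by (auto intro!: mult_pos_pos add_pos_pos)
    fix h k :: "real \<Rightarrow> 'e" and Ch C :: real
    assume h: "ess_bdd {0..1} Ch h" "\<And>t. t \<in> {0..1} \<Longrightarrow> integral {0..t} h = t *\<^sub>R X"
      and k: "ess_bdd {0..1} C k" and C: "C \<le> \<rho> / K"
    have C0: "0 \<le> C" using k by (simp add: ess_bdd_def)
    define \<kappa> where "\<kappa> t = Ad (exp_curve X t) (k t)" for t
    have \<kappa>: "ess_bdd {0..1} (K * C) \<kappa>"
      unfolding \<kappa>_def[abs_def] by (rule ess_bdd_Ad_exp[OF k less_imp_le[OF K(1)] K(2)])
    have "K * C \<le> \<rho>" using C K by (simp add: field_simps)
    from ex[OF \<kappa> this] obtain \<eta> where \<eta>: "driven {0..1} \<eta> (\<lambda>t. integral {0..t} \<kappa>)" "\<eta> 0 = \<one>" "\<eta> 1 \<in> fst c0"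
      "norm (coord (\<eta> 1) - e0 - integral {0..1} \<kappa>) \<le> B * (K * C)\<^sup>2" "norm (coord (\<eta> 1) - e0) \<le> B * (K * C)" by blast
    let ?\<gamma> = "exp_curve X"
    have \<gamma>: "driven {0..1} ?\<gamma> (\<lambda>t. t *\<^sub>R X)" by (rule driven_subset[OF exp_curve(1)]) simp
    have hk: "ess_bdd {0..1} (Ch + C) (\<lambda>t. h t + k t)" by (rule ess_bdd_add[OF h(1) k])
    have J: "integral {0..t} (\<lambda>t. h t + k t) = t *\<^sub>R X + integral {0..t} k" if "t \<in> {0..1}" for t
    proof -
      have "h integrable_on {0..t}" "k integrable_on {0..t}"
        using that by (auto intro!: ess_bdd_integrable ess_bdd_subset[OF h(1)] ess_bdd_subset[OF k])
      then show ?thesis by (simp add: Henstock_Kurzweil_Integration.integral_add h(2)[OF that])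
    qed
    have "driven {0..1} (\<lambda>s. \<eta> s \<otimes> ?\<gamma> s) (\<lambda>t. integral {0..t} (\<lambda>t. h t + k t))"
    proof (rule driven_mult[OF \<eta>(1) \<gamma> ess_bdd_indefinite_lipschitz[OF hk]])
      fix t :: real assume t: "t \<in> {0..1}"
      let ?A = "Ad (inv (?\<gamma> t))"
      have gt: "inv (?\<gamma> t) \<in> carrier G" "?\<gamma> t \<in> carrier G" using exp_curve_carrier by auto
      have "zero_deriv (\<lambda>s. integral {0..s} \<kappa> - Ad (?\<gamma> t) (integral {0..s} k)) t {0..1}"
        by (rule ess_bdd_freeze_derivative[OF k continuous_on_Ad_exp_curve Ad_linear[OF exp_curve_carrier]])
          (use has_integral_indefinite_diff[OF ess_bdd_integrable[OF k]]
            has_integral_indefinite_diff[OF ess_bdd_integrable[OF \<kappa>]] t in \<open>auto simp: \<kappa>_def[abs_def]\<close>)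
      then have "((\<lambda>s. ?A (integral {0..s} \<kappa> - Ad (?\<gamma> t) (integral {0..s} k))) has_derivative (\<lambda>_. ?A 0)) (at t within {0..1})"
        by (rule bounded_linear.has_derivative[rotated]) (simp add: Ad_linear[OF gt(1)] linear_conv_bounded_linear[symmetric])
      then have 1: "zero_deriv (\<lambda>s. ?A (integral {0..s} \<kappa>) - integral {0..s} k) t {0..1}"
        by (simp add: linear_diff[OF Ad_linear[OF gt(1)]] linear_0[OF Ad_linear[OF gt(1)]] Ad_inv(2)[OF gt(2)])
      show "zero_deriv (\<lambda>s. integral {0..s} (\<lambda>t. h t + k t) - (?A (integral {0..s} \<kappa>) + s *\<^sub>R X)) t {0..1}"
        by (rule has_derivative_transform[OF t _ has_derivative_minus[OF 1, simplified]]) (simp add: J)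
    qed
    from end_point_eqI[OF hk this] \<eta>(2) have "end_point G M (\<lambda>t. h t + k t) = \<eta> 1 \<otimes> ?\<gamma> 1"
      by (simp add: exp_curve(2))
    moreover have "norm (coord (\<eta> 1) - e0 - end_var X k) \<le> B * (K + K\<^sup>2) * C\<^sup>2"
    proof -
      have "norm (coord (\<eta> 1) - e0 - end_var X k) \<le> B * (K * C)\<^sup>2"
        using \<eta>(4) by (simp add: end_var_def \<kappa>_def[abs_def])
      also have "\<dots> \<le> B * (K + K\<^sup>2) * C\<^sup>2" using \<rho> K by (simp add: power_mult_distrib algebra_simps)
      finally show ?thesis .
    qed
    moreover have "norm (coord (\<eta> 1) - e0) \<le> B * (K + K\<^sup>2) * C"
    proof -
      have "B * (K * C) \<le> B * (K + K\<^sup>2) * C" using \<rho> K C0 by (simp add: algebra_simps)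
      then show ?thesis using \<eta>(5) by simp
    qed
    ultimately show "\<exists>q\<in>fst c0. end_point G M (\<lambda>t. h t + k t) = q \<otimes> exp_curve X 1 \<and>
         norm (coord q - e0 - end_var X k) \<le> B * (K + K\<^sup>2) * C\<^sup>2 \<and> norm (coord q - e0) \<le> B * (K + K\<^sup>2) * C"
      using \<eta>(3) by blast
  qed
qed

lemma end_var_add:
  assumes "k \<in> linf W" "l \<in> linf W'"
  shows "end_var X (\<lambda>t. k t + l t) = end_var X k + end_var X l"
  using Ad_exp_integrable[OF linf_imp_ess_bdd[OF assms(1)], of X] Ad_exp_integrable[OF linf_imp_ess_bdd[OF assms(2)], of X]
  by (simp add: end_var_def linear_add[OF Ad_linear[OF exp_curve_carrier]] Henstock_Kurzweil_Integration.integral_add)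

lemma end_var_scaleR: "end_var X (\<lambda>t. a *\<^sub>R k t) = a *\<^sub>R end_var X k"
  by (simp add: end_var_def linear_scale[OF Ad_linear[OF exp_curve_carrier]])

lemma end_point_constant:
  assumes h: "h \<in> linf W" "\<And>t. t \<in> {0..1} \<Longrightarrow> integral {0..t} h = t *\<^sub>R X"
  shows "end_point G M h = exp_curve X 1"
proof (rule end_point_eqI[OF linf_imp_ess_bdd[OF h(1)]])
  show "driven {0..1} (exp_curve X) (\<lambda>t. integral {0..t} h)"
    by (rule driven_cong[OF driven_subset[OF exp_curve(1)]]) (auto simp: h(2))
qed (rule exp_curve)

abbreviation right_diff :: "('a, 'e) chart \<Rightarrow> 'a \<Rightarrow> 'e \<Rightarrow> 'e" where
  "right_diff c p \<equiv> tangent_map c0 c (\<lambda>q. q \<otimes> p) \<one>"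

text \<open>Hence the rank of the differential can be read off from \<open>end_var\<close>
  alone.\<close>

lemma right_diff_bij:
  assumes "c \<in> charts M" "p \<in> fst c"
  shows "linear (right_diff c p)" "bij (right_diff c p)"
proof -
  have p: "p \<in> carrier G" using assms chart_carrier by blast
  show lin: "linear (right_diff c p)"
    by (rule mdiff_linear[OF mdiff_right[OF p]]) (use assms c0 p in auto)
  have "tangent_map c c0 (\<lambda>q. q \<otimes> inv p) (\<one> \<otimes> p) (right_diff c p v) = v" for v
    by (rule tangent_left_inverse[OF mdiff_right mdiff_right]) (use p assms c0 in \<open>auto simp: m_assoc\<close>)
  then have "inj (right_diff c p)" by (rule inj_on_inverseI)
  then show "bij (right_diff c p)" using linear_injective_imp_surjective[OF lin] by (simp add: bij_def)
qed

text \<open>The end point is \<open>q \<otimes> exp_curve X 1\<close>, where \<open>q\<close>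
  differs from the identity by \<open>end_var X k\<close> up to a quadratic error. Composing with
  the derivative of right translation at the identity gives the differential.\<close>

lemma end_differential_constant:
  assumes W: "subspace W" and h: "h \<in> linf W" "\<And>t. t \<in> {0..1} \<Longrightarrow> integral {0..t} h = t *\<^sub>R X"
    and c: "c \<in> charts M" "exp_curve X 1 \<in> fst c"
  shows "end_differential G M W h c (\<lambda>k. right_diff c (exp_curve X 1) (end_var X k))"
proof -
  let ?g = "exp_curve X 1" and ?R = "right_diff c (exp_curve X 1)"
  have g: "?g \<in> carrier G" by (rule exp_curve_carrier)
  have Rlin: "linear ?R" by (rule right_diff_bij[OF c])
  obtain r where r: "r > 0" "\<And>v. norm (?R v) \<le> r * norm v"
    using bounded_linear.pos_bounded[of ?R] Rlin linear_conv_bounded_linear by (metis mult.commute)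
  obtain K where K: "K > 0" "\<And>t v. t \<in> {0..1} \<Longrightarrow> norm (Ad (exp_curve X t) v) \<le> K * norm v"
    using Ad_exp_bound by metis
  have bound: "norm (?R (end_var X k)) \<le> (r * K) * linf_norm k" if "k \<in> linf W" for k
  proof -
    have "norm (end_var X k) \<le> K * linf_norm k * (1 - 0)"
      unfolding end_var_def
      by (rule ess_bdd_norm_integral_le[OF ess_bdd_Ad_exp[OF linf_imp_ess_bdd[OF that] less_imp_le[OF K(1)] K(2)]]) simp_all
    then have "r * norm (end_var X k) \<le> r * (K * linf_norm k)" using r(1) by simp
    then show ?thesis using r(2)[of "end_var X k"] by (simp add: mult.assoc)
  qed
  show ?thesis
    unfolding end_differential_def
  proof (intro conjI)
    show "\<forall>k\<in>linf W. \<forall>l\<in>linf W. ?R (end_var X (\<lambda>t. k t + l t)) = ?R (end_var X k) + ?R (end_var X l)"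
      by (simp add: end_var_add linear_add[OF Rlin])
    show "\<forall>k\<in>linf W. \<forall>a. ?R (end_var X (\<lambda>t. a *\<^sub>R k t)) = a *\<^sub>R ?R (end_var X k)"
      by (simp add: end_var_scaleR linear_scale[OF Rlin])
    show "\<exists>C. \<forall>k\<in>linf W. norm (?R (end_var X k)) \<le> C * linf_norm k" using bound by blast
    show "\<forall>\<epsilon>>0. \<exists>\<delta>>0. \<forall>k\<in>linf W. linf_norm k < \<delta> \<longrightarrow>
        end_point G M (\<lambda>t. h t + k t) \<in> fst c \<and>
        norm (snd c (end_point G M (\<lambda>t. h t + k t)) - snd c (end_point G M h) - ?R (end_var X k)) \<le> \<epsilon> * linf_norm k"
    proof (intro allI impI)
      fix \<epsilon> :: real assume \<epsilon>: "\<epsilon> > 0"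
      obtain \<rho> B where \<rho>: "\<rho> > 0" "B > 0"
        and ex: "\<And>h Ch k C. ess_bdd {0..1} Ch h \<Longrightarrow> (\<And>t. t \<in> {0..1} \<Longrightarrow> integral {0..t} h = t *\<^sub>R X) \<Longrightarrow>
       ess_bdd {0..1} C k \<Longrightarrow> C \<le> \<rho> \<Longrightarrow>
       \<exists>q\<in>fst c0. end_point G M (\<lambda>t. h t + k t) = q \<otimes> exp_curve X 1 \<and>
         norm (coord q - e0 - end_var X k) \<le> B * C\<^sup>2 \<and> norm (coord q - e0) \<le> B * C"
        by (rule end_expansion[of X]) blast
      let ?F = "in_charts c0 c (\<lambda>q. q \<otimes> ?g)"
      have Fe: "?F e0 = snd c ?g" using g by (simp add: in_charts_def)
      have "(?F has_derivative ?R) (at e0)"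
        by (rule mdiff_has_derivative[OF mdiff_right[OF g]]) (use c c0 g in auto)
      moreover define \<epsilon>1 where "\<epsilon>1 = \<epsilon> / (2 * B)"
      have \<epsilon>1: "\<epsilon>1 > 0" using \<epsilon> \<rho> by (simp add: \<epsilon>1_def)
      ultimately obtain d where d: "d > 0" "\<And>x. norm (x - e0) < d \<Longrightarrow> norm (?F x - ?F e0 - ?R (x - e0)) \<le> \<epsilon>1 * norm (x - e0)"
        unfolding has_derivative_at_alt by blast
      have "\<forall>\<^sub>F x in nhds e0. pt x \<otimes> ?g \<in> fst c"
        by (rule atlas_map.eventually_map_in_chart[OF atlas_mapI[OF mdiff_right[OF g]]]) (use c c0 g in auto)
      then obtain d' where d': "d' > 0" "\<And>x. dist x e0 < d' \<Longrightarrow> pt x \<otimes> ?g \<in> fst c"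
        unfolding eventually_nhds_metric by blast
      \<comment> \<open>In this order the entries guarantee the expansion of the end point, the
        derivative estimate of right translation, that the end point stays in \<open>c\<close>, and
        that the quadratic remainder is at most half of the allowed error.\<close>
      define \<delta> where "\<delta> = min \<rho> (min (d / B) (min (d' / B) (\<epsilon> / (2 * r * B))))"
      have "\<delta> > 0" using \<rho> d d' r \<epsilon> by (simp add: \<delta>_def)
      moreover have "end_point G M (\<lambda>t. h t + k t) \<in> fst c \<and>
        norm (snd c (end_point G M (\<lambda>t. h t + k t)) - snd c (end_point G M h) - ?R (end_var X k)) \<le> \<epsilon> * linf_norm k"
        if k: "k \<in> linf W" "linf_norm k < \<delta>" for k
      proof -
        let ?n = "linf_norm k"
        have n0: "0 \<le> ?n" by (rule linf_norm_nonneg[OF k(1)])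
        have n: "?n \<le> \<rho>" "B * ?n < d" "B * ?n < d'" "r * (B * ?n) \<le> \<epsilon> / 2"
          using k(2) \<rho> r by (auto simp: \<delta>_def field_simps)
        obtain q where q: "q \<in> fst c0" "end_point G M (\<lambda>t. h t + k t) = q \<otimes> ?g"
          "norm (coord q - e0 - end_var X k) \<le> B * ?n\<^sup>2" "norm (coord q - e0) \<le> B * ?n"
          using ex[OF linf_imp_ess_bdd[OF h(1)] h(2) linf_imp_ess_bdd[OF k(1)] n(1)] by blast
        have ptq: "pt (coord q) = q" using q(1) c0 by simp
        have "q \<otimes> ?g \<in> fst c" using d'(2)[of "coord q"] q(4) n(3) ptq by (simp add: dist_norm)
        moreover have "norm (snd c (q \<otimes> ?g) - snd c ?g - ?R (end_var X k)) \<le> \<epsilon> * ?n"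
        proof -
          have Fq: "?F (coord q) = snd c (q \<otimes> ?g)" using ptq by (simp add: in_charts_def)
          have "norm (?F (coord q) - ?F e0 - ?R (coord q - e0)) \<le> \<epsilon>1 * norm (coord q - e0)"
            by (rule d(2)) (use q(4) n(2) in simp)
          also have "\<dots> \<le> \<epsilon>1 * (B * ?n)" using q(4) \<epsilon>1 by simp
          also have "\<dots> = \<epsilon> / 2 * ?n" using \<rho> by (simp add: \<epsilon>1_def)
          finally have 1: "norm (snd c (q \<otimes> ?g) - snd c ?g - ?R (coord q - e0)) \<le> \<epsilon> / 2 * ?n"
            unfolding Fe Fq .
          have "norm (?R (coord q - e0 - end_var X k)) \<le> r * norm (coord q - e0 - end_var X k)" by (rule r(2))
          also have "\<dots> \<le> r * (B * ?n\<^sup>2)" using q(3) r(1) by simp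
          also have "\<dots> = (r * (B * ?n)) * ?n" by (simp add: power2_eq_square)
          also have "\<dots> \<le> \<epsilon> / 2 * ?n" using n(4) n0 by (rule mult_right_mono)
          finally have 2: "norm (?R (coord q - e0 - end_var X k)) \<le> \<epsilon> / 2 * ?n" .
          have eq: "snd c (q \<otimes> ?g) - snd c ?g - ?R (end_var X k)
              = (snd c (q \<otimes> ?g) - snd c ?g - ?R (coord q - e0)) + ?R (coord q - e0 - end_var X k)"
            by (simp add: linear_diff[OF Rlin])
          show ?thesis unfolding eq using norm_triangle_mono[OF 1 2] by linarith
        qed
        moreover have "end_point G M h = ?g" by (rule end_point_constant[OF h])
        ultimately show ?thesis unfolding q(2) by simp
      qed
      ultimately show "\<exists>\<delta>>0. \<forall>k\<in>linf W. linf_norm k < \<delta> \<longrightarrow>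
        end_point G M (\<lambda>t. h t + k t) \<in> fst c \<and>
        norm (snd c (end_point G M (\<lambda>t. h t + k t)) - snd c (end_point G M h) - ?R (end_var X k)) \<le> \<epsilon> * linf_norm k"
        by blast
    qed
  qed
qed

lemma lie_exp_curve: "(\<lambda>t. lie_exp G M (t *\<^sub>R X)) = exp_curve X"
  by (rule ext) (rule lie_exp_eq_exp_curve)

text \<open>Recovers the primitive from the curve, so that every control producing
  \<open>exp_curve X\<close> integrates to \<open>t *\<^sub>R X\<close>.\<close>

lemma driven_primitive_unique:
  assumes "driven {a..b} \<gamma> H" "driven {a..b} \<gamma> K" "t \<in> {a..b}" "H a = K a"
  shows "H t = K t"
proof -
  have "H t - K t = H a - K a"
  proof (rule has_derivative_zero_unique[where s="{a..b}"])
    show "((\<lambda>s. H s - K s) has_derivative (\<lambda>h. 0)) (at s within {a..b})" if "s \<in> {a..b}" for s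
      using has_derivative_diff[OF driven_derivative[OF assms(2) that] driven_derivative[OF assms(1) that]] by simp
  qed (use assms in auto)
  then show ?thesis using assms by simp
qed

text \<open>From here on only \<open>end_var\<close> matters. One direction compares the given
  differential with the explicit one by uniqueness, the other uses the constant control
  \<open>X\<close>.\<close>

lemma nonabnormal_direction_iff:
  assumes W: "subspace W"
  shows "nonabnormal_direction G M W X \<longleftrightarrow> X \<in> W \<and> X \<noteq> 0 \<and> end_var X ` linf W = UNIV"
proof -
  let ?g = "exp_curve X 1"
  have \<gamma>: "driven {0..1} (exp_curve X) (\<lambda>t. t *\<^sub>R X)" by (rule driven_subset[OF exp_curve(1)]) simp
  have surj_iff: "(\<lambda>k. right_diff c ?g (end_var X k)) ` linf W = UNIV \<longleftrightarrow> end_var X ` linf W = UNIV"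
    if "c \<in> charts M" "?g \<in> fst c" for c
  proof -
    have "(\<lambda>k. right_diff c ?g (end_var X k)) ` linf W = right_diff c ?g ` (end_var X ` linf W)" by (simp add: image_image)
    moreover have "bij (right_diff c ?g)" by (rule right_diff_bij[OF that])
    ultimately show ?thesis by (metis bij_def inj_image_eq_iff)
  qed
  have "nonabnormal_curve G M W (exp_curve X) \<longleftrightarrow> end_var X ` linf W = UNIV" if X: "X \<in> W"
  proof
    assume "nonabnormal_curve G M W (exp_curve X)"
    then obtain h c D where h: "h \<in> linf W" "curve_with_control G M h (exp_curve X)"
      and c: "c \<in> charts M" "end_point G M h \<in> fst c" and D: "end_differential G M W h c D" "D ` linf W = UNIV"
      unfolding nonabnormal_curve_def end_full_rank_def by blast
    have "driven {0..1} (exp_curve X) (\<lambda>t. integral {0..t} h)"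
      using h curve_with_control_iff_driven[OF linf_imp_ess_bdd[OF h(1)]] by blast
    from driven_primitive_unique[OF this \<gamma>]
    have hX: "integral {0..t} h = t *\<^sub>R X" if "t \<in> {0..1}" for t using that by simp
    have g: "?g \<in> fst c" using c(2) end_point_constant[OF h(1) hX] by simp
    have "D k = right_diff c ?g (end_var X k)" if "k \<in> linf W" for k
      by (rule end_differential_unique[OF W D(1) end_differential_constant[OF W h(1) hX c(1) g] that])
    then have "(\<lambda>k. right_diff c ?g (end_var X k)) ` linf W = UNIV" using D(2) by (metis (no_types, lifting) image_cong)
    then show "end_var X ` linf W = UNIV" using surj_iff[OF c(1) g] by simp
  next
    assume s: "end_var X ` linf W = UNIV"
    let ?h = "\<lambda>_::real. X"
    have eb: "ess_bdd {0..1} (norm X) ?h" by (simp add: ess_bdd_def)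
    have h: "?h \<in> linf W" by (rule ess_bdd_imp_linf[OF eb]) (use X in simp)
    have hX: "integral {0..t} ?h = t *\<^sub>R X" if "t \<in> {0..1}" for t using that by simp
    have cw: "curve_with_control G M ?h (exp_curve X)"
      unfolding curve_with_control_iff_driven[OF eb]
      by (intro conjI exp_curve(2) driven_cong[OF \<gamma>]) auto
    have "?g \<in> topspace (mtop M)" using exp_curve_carrier by simp
    then obtain c where c: "c \<in> charts M" "?g \<in> fst c" by (rule obtain_chart)
    have "end_full_rank G M W ?h"
      unfolding end_full_rank_def
      using end_differential_constant[OF W h hX c] surj_iff[OF c] s end_point_constant[OF h hX] c by force
    then show "nonabnormal_curve G M W (exp_curve X)"
      unfolding nonabnormal_curve_def using h cw by blast
  qed
  then show ?thesis unfolding nonabnormal_direction_def lie_exp_curve by blast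
qed

section \<open>Surjectivity of the differential as a spanning condition\<close>

text \<open>If \<open>a\<close> is orthogonal to all \<open>ad_X^j w\<close>, then
  \<open>a \<bullet> Ad(exp tX) w\<close> vanishes for all \<open>t\<close>, so \<open>a\<close> is
  orthogonal to the range of \<open>end_var X\<close>, which contains \<open>a\<close>.\<close>

lemma end_var_surj_imp_ad_spanning:
  assumes surj: "end_var X ` linf W = UNIV" and nil: "\<And>w. w \<in> W \<Longrightarrow> \<exists>n. (br X ^^ n) w = 0"
    and a: "\<And>j w. w \<in> W \<Longrightarrow> a \<bullet> (br X ^^ j) w = 0"
  shows "a = 0"
proof -
  have Ad0: "Ad (exp_curve X t) 0 = 0" for t using linear_0[OF Ad_linear[OF exp_curve_carrier]] .
  \<comment> \<open>Induction on the number of further brackets that kill the vector. The derivative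
    in \<open>t\<close> is the same expression with one more bracket and vanishes by induction; the
    value at time \<open>0\<close> vanishes by the choice of \<open>a\<close>.\<close>
  have *: "a \<bullet> Ad (exp_curve X t) ((br X ^^ j) w) = 0" if w: "w \<in> W" and n: "(br X ^^ (j + n)) w = 0" for w n j t
    using n
  proof (induction n arbitrary: j t)
    case 0 then show ?case by (simp add: Ad0)
  next
    case (Suc n)
    have IH: "a \<bullet> Ad (exp_curve X t) (br X ((br X ^^ j) w)) = 0" for t
      using Suc.IH[of "Suc j" t] Suc.prems by simp
    have "a \<bullet> Ad (exp_curve X t) ((br X ^^ j) w) = a \<bullet> Ad (exp_curve X 0) ((br X ^^ j) w)"
    proof (rule has_derivative_zero_unique[where s=UNIV and f="\<lambda>t. a \<bullet> Ad (exp_curve X t) ((br X ^^ j) w)"])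
      show "((\<lambda>t. a \<bullet> Ad (exp_curve X t) ((br X ^^ j) w)) has_derivative (\<lambda>h. 0)) (at t within UNIV)" for t
        using has_derivative_inner_right[OF Ad_exp_curve_derivative[of X "(br X ^^ j) w" t, unfolded has_vector_derivative_def], of a] IH by simp
    qed auto
    then show ?case using a[OF w] by (simp add: exp_curve(2) Ad_one)
  qed
  have "a \<bullet> end_var X k = 0" if k: "k \<in> linf W" for k
  proof -
    have "a \<bullet> end_var X k = integral {0..1} (\<lambda>t. a \<bullet> Ad (exp_curve X t) (k t))"
      unfolding end_var_def
      using integral_linear[OF Ad_exp_integrable[OF linf_imp_ess_bdd[OF k]] bounded_linear_inner_right[of a], of X]
      by (simp add: o_def)
    also have "\<dots> = integral {0..1} (\<lambda>t::real. 0::real)"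
    proof (rule integral_cong)
      fix t :: real assume "t \<in> {0..1}"
      then have "k t \<in> W" using k by (simp add: linf_def)
      then show "a \<bullet> Ad (exp_curve X t) (k t) = 0" using *[of "k t" 0] nil by fastforce
    qed
    finally show ?thesis by simp
  qed
  moreover obtain k where "k \<in> linf W" "end_var X k = a" using surj by (metis UNIV_I imageE)
  ultimately have "a \<bullet> a = 0" by metis
  then show ?thesis by simp
qed

text \<open>Take \<open>a\<close> orthogonal to the range. Then
  \<open>a \<bullet> Ad(exp tX) w\<close> vanishes on \<open>[0,1]\<close>, and repeated
  differentiation, read at time \<open>0\<close>, makes \<open>a\<close> orthogonal to every
  \<open>ad_X^j w\<close>.\<close>

lemma ad_spanning_imp_end_var_surj:
  assumes W: "subspace W" and span: "\<And>a. (\<And>j w. w \<in> W \<Longrightarrow> a \<bullet> (br X ^^ j) w = 0) \<Longrightarrow> a = 0"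
  shows "end_var X ` linf W = UNIV"
proof (rule ccontr)
  let ?S = "end_var X ` linf W"
  assume ne: "?S \<noteq> UNIV"
  have z: "(\<lambda>_. 0) \<in> linf W"
    by (rule ess_bdd_imp_linf[of 0]) (use subspace_0[OF W] in \<open>auto simp: ess_bdd_def\<close>)
  have "subspace ?S"
  proof (rule subspaceI)
    show "0 \<in> ?S" using end_var_scaleR[of X 0 "\<lambda>_. 0"] z by force
    show "x + y \<in> ?S" if "x \<in> ?S" "y \<in> ?S" for x y
      using that linf_add[OF W] by (auto simp flip: end_var_add)
    show "a *\<^sub>R x \<in> ?S" if "x \<in> ?S" for a x
      using that linf_scaleR[OF W] by (auto simp flip: end_var_scaleR)
  qed
  then have "span ?S \<noteq> UNIV" using ne by (simp add: span_eq_iff[THEN iffD2])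
  then obtain a where a: "a \<noteq> 0" "\<And>x. x \<in> span ?S \<Longrightarrow> a \<bullet> x = 0"
    using span_not_UNIV_orthogonal by metis
  have "a \<bullet> Ad (exp_curve X t) ((br X ^^ j) w) = 0" if w: "w \<in> W" and t: "t \<in> {0..1}" for j w t
    using t
  proof (induction j arbitrary: t)
    case 0
    let ?f = "\<lambda>t. a \<bullet> Ad (exp_curve X t) w"
    \<comment> \<open>Weighting \<open>w\<close> with \<open>?f\<close> itself turns the pairing of
      \<open>a\<close> with \<open>end_var X ?k\<close> into the integral of the square of
      \<open>?f\<close>.\<close>
    let ?k = "\<lambda>t. ?f t *\<^sub>R w"
    have fc: "continuous_on {0..1} ?f" by (intro continuous_intros continuous_on_Ad_exp_curve)
    then have "bounded (?f ` {0..1})" by (intro compact_imp_bounded compact_continuous_image) auto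
    then obtain C where C: "C > 0" "\<And>t. t \<in> {0..1} \<Longrightarrow> \<bar>?f t\<bar> \<le> C" unfolding bounded_pos by auto
    have "ess_bdd {0..1} (C * norm w) ?k"
      unfolding ess_bdd_def
    proof (intro conjI)
      show "0 \<le> C * norm w" using C by simp
      show "?k \<in> borel_measurable (lebesgue_on {0..1})"
        by (intro continuous_imp_measurable_on_sets_lebesgue continuous_intros fc) auto
      have "{t \<in> {0..1}. C * norm w < norm (?k t)} = {}"
        using C(2) by (auto simp: not_less intro!: mult_right_mono)
      then show "negligible {t \<in> {0..1}. C * norm w < norm (?k t)}" by (simp only: negligible_empty)
    qed
    note eb = this
    have k: "?k \<in> linf W" by (rule ess_bdd_imp_linf[OF eb]) (use w W in \<open>auto intro: subspace_scale\<close>)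
    have "0 = a \<bullet> end_var X ?k" using a(2) k by (simp add: span_base)
    also have "\<dots> = integral {0..1} (\<lambda>t. a \<bullet> Ad (exp_curve X t) (?k t))"
      unfolding end_var_def
      using integral_linear[OF Ad_exp_integrable[OF eb] bounded_linear_inner_right[of a], of X]
      by (simp add: o_def)
    also have "\<dots> = integral {0..1} (\<lambda>t. (?f t)\<^sup>2)"
      by (simp add: linear_scale[OF Ad_linear[OF exp_curve_carrier]] power2_eq_square)
    finally have i0: "integral {0..1} (\<lambda>t. (?f t)\<^sup>2) = 0" by simp
    have f2: "continuous_on {0..1} (\<lambda>t. (?f t)\<^sup>2)" by (intro continuous_on_power fc)
    then have "(\<lambda>t. (?f t)\<^sup>2) integrable_on {0..1}" by (rule integrable_continuous_interval)
    then have "((\<lambda>t. (?f t)\<^sup>2) has_integral 0) {0..1}"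
      using i0 by (metis integrable_integral)
    then have "(?f t)\<^sup>2 = 0"
      using has_integral_0_cbox_imp_0[of 0 1 "\<lambda>t. (?f t)\<^sup>2" t] f2 0 by auto
    then show ?case by simp
  next
    case (Suc j)
    let ?x = "(br X ^^ j) w"
    have "((\<lambda>t. a \<bullet> Ad (exp_curve X t) ?x) has_vector_derivative a \<bullet> Ad (exp_curve X t) (br X ?x)) (at t within {0..1})"
      by (rule has_vector_derivative_at_within, rule bounded_linear.has_vector_derivative[OF bounded_linear_inner_right Ad_exp_curve_derivative])
    moreover have "((\<lambda>t. a \<bullet> Ad (exp_curve X t) ?x) has_vector_derivative 0) (at t within {0..1})"
      by (rule has_vector_derivative_transform[OF Suc.prems _ has_vector_derivative_const]) (simp add: Suc.IH)
    moreover have "at t within {0..1} \<noteq> bot" using Suc.prems by (simp add: trivial_limit_within islimpt_Icc)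
    ultimately show ?case using vector_derivative_unique_within by fastforce
  qed
  from this[of _ 0] have "a \<bullet> (br X ^^ j) w = 0" if "w \<in> W" for j w
    using that by (simp add: exp_curve(2) Ad_one)
  then have "a = 0" by (rule span)
  with a(1) show False ..
qed

end

section \<open>Homomorphisms and stratifications\<close>

locale lie_gp_hom = G: lie_gp G M + H: lie_gp H Q
  for G :: "('a, 'z) monoid_scheme" and M :: "('a, 'e::euclidean_space) manifold"
    and H :: "('b, 'y) monoid_scheme" and Q :: "('b, 'f::euclidean_space) manifold" +
  fixes f :: "'a \<Rightarrow> 'b"
  assumes hom: "f \<in> hom G H" and mdiff_f: "mdiff M Q f"
begin

sublocale atlas_map M Q f
  by unfold_locales (rule mdiff_f)

abbreviation df :: "'e \<Rightarrow> 'f" where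
  "df \<equiv> tangent_map (id_chart G M) (id_chart H Q) f \<one>\<^bsub>G\<^esub>"

lemma f_one [simp]: "f \<one>\<^bsub>G\<^esub> = \<one>\<^bsub>H\<^esub>"
  using hom_one[OF hom G.is_group H.is_group] .

lemma f_carrier [simp]: "x \<in> carrier G \<Longrightarrow> f x \<in> carrier H"
  using hom by (auto simp: hom_def)

lemma f_mult: "x \<in> carrier G \<Longrightarrow> y \<in> carrier G \<Longrightarrow> f (x \<otimes>\<^bsub>G\<^esub> y) = f x \<otimes>\<^bsub>H\<^esub> f y"
  using hom by (auto simp: hom_def)

lemma f_inv: "x \<in> carrier G \<Longrightarrow> f (inv\<^bsub>G\<^esub> x) = inv\<^bsub>H\<^esub> f x"
  using group_hom.hom_inv[of G H f] hom G.is_group H.is_group by (simp add: group_hom_def group_hom_axioms_def)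

lemma df_linear: "linear df"
  by (rule mdiff_linear[OF mdiff_f G.c0(1) H.c0(1) G.c0(2)]) (simp add: H.c0)

text \<open>Differentiate, at the identity, that \<open>f\<close> after conjugation by
  \<open>p\<close> equals conjugation by \<open>f p\<close> after \<open>f\<close>.\<close>

lemma df_Ad:
  assumes p: "p \<in> carrier G"
  shows "df (G.Ad p v) = H.Ad (f p) (df v)"
proof -
  let ?cp = "\<lambda>q. p \<otimes>\<^bsub>G\<^esub> q \<otimes>\<^bsub>G\<^esub> inv\<^bsub>G\<^esub> p" and ?cf = "\<lambda>q. f p \<otimes>\<^bsub>H\<^esub> q \<otimes>\<^bsub>H\<^esub> inv\<^bsub>H\<^esub> f p"
  have fp: "f p \<in> carrier H" using p by simp
  interpret C: atlas_map M M ?cp by (rule G.atlas_mapI[OF G.mdiff_conj[OF p]])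
  have 1: "tangent_map G.c0 H.c0 (\<lambda>x. f (?cp x)) \<one>\<^bsub>G\<^esub> v = tangent_map G.c0 H.c0 f (?cp \<one>\<^bsub>G\<^esub>) (G.Ad p v)"
    unfolding G.Ad_def by (rule C.tangent_map_comp[OF mdiff_f]) (use p G.c0 H.c0 in auto)
  have 2: "tangent_map G.c0 H.c0 (\<lambda>x. ?cf (f x)) \<one>\<^bsub>G\<^esub> v = H.Ad (f p) (df v)"
    unfolding H.Ad_def using tangent_map_comp[OF H.mdiff_conj[OF fp] G.c0(1) H.c0(1) H.c0(1) G.c0(2)] fp H.c0 by simp
  have "tangent_map G.c0 H.c0 (\<lambda>x. f (?cp x)) \<one>\<^bsub>G\<^esub> = tangent_map G.c0 H.c0 (\<lambda>x. ?cf (f x)) \<one>\<^bsub>G\<^esub>"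
    by (rule tangent_map_cong[OF G.atlas_axioms mdiff_comp[OF H.mdiff_conj[OF fp]] G.c0(1) H.c0(1) G.c0(2)])
      (use p fp H.c0 in \<open>auto simp: f_mult f_inv\<close>)
  with 1 2 p show ?thesis by simp
qed

text \<open>Differentiate \<open>df_Ad\<close> in the group element at the identity, where the
  derivative of \<open>Ad\<close> is the bracket.\<close>

lemma df_bracket: "df (G.br u v) = H.br (df u) (df v)"
proof -
  let ?F = "in_charts G.c0 H.c0 f"
  have Fe: "?F G.e0 = H.e0" using G.c0 by (simp add: in_charts_def)
  have F: "(?F has_derivative df) (at G.e0)"
    by (rule mdiff_has_derivative[OF mdiff_f]) (use G.c0 H.c0 in auto)
  have 1: "((\<lambda>x. H.Ad (H.pt (?F x)) (df v)) has_derivative (\<lambda>u. H.br (df u) (df v))) (at G.e0)"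
    by (rule has_derivative_compose[OF F]) (simp add: Fe H.Ad_has_derivative)
  have 2: "((\<lambda>x. df (G.Ad (G.pt x) v)) has_derivative (\<lambda>u. df (G.br u v))) (at G.e0)"
    by (rule bounded_linear.has_derivative[OF _ G.Ad_has_derivative]) (simp add: df_linear linear_conv_bounded_linear[symmetric])
  have "\<forall>\<^sub>F x in nhds G.e0. f (G.pt x) \<in> fst H.c0"
    by (rule eventually_map_in_chart) (use G.c0 H.c0 in auto)
  moreover have "\<forall>\<^sub>F x in nhds G.e0. G.pt x \<in> fst G.c0"
    by (rule G.eventually_chart_inv_in[OF G.c0 G.chart_openin[OF G.c0(1)] G.c0(2)])
  ultimately have "\<forall>\<^sub>F x in nhds G.e0. df (G.Ad (G.pt x) v) = H.Ad (H.pt (?F x)) (df v)"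
  proof eventually_elim
    case (elim x)
    then have "H.pt (?F x) = f (G.pt x)" by (simp add: in_charts_def H.c0)
    then show ?case using df_Ad[OF G.chart_carrier[OF G.c0(1) elim(2)]] by simp
  qed
  then have "((\<lambda>x. H.Ad (H.pt (?F x)) (df v)) has_derivative (\<lambda>u. df (G.br u v))) (at G.e0)"
    by (intro has_derivative_transform_eventually[OF 2])
      (auto dest: eventually_nhds_x_imp_x simp: eventually_at_filter elim: eventually_mono)
  from has_derivative_unique[OF 1 this] show ?thesis by metis
qed

end

context lie_gp
begin

text \<open>Conjugation by \<open>p\<close> is a homomorphism with differential \<open>Ad p\<close>,
  so \<open>df_bracket\<close> applies to it.\<close>

lemma Ad_bracket:
  assumes p: "p \<in> carrier G"
  shows "Ad p (br u v) = br (Ad p u) (Ad p v)"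
proof -
  have "(\<lambda>q. p \<otimes> q \<otimes> inv p) \<in> hom G G"
    using p by (auto simp: hom_def m_assoc mult_inv_cancel)
  then interpret C: lie_gp_hom G M G M "\<lambda>q. p \<otimes> q \<otimes> inv p"
    by unfold_locales (auto simp: mdiff_conj p)
  show ?thesis using C.df_bracket[of u v] by (simp add: Ad_def)
qed

lemma bilinear_bracket: "bilinear br"
  unfolding bilinear_def using bracket_linear by blast

text \<open>Differentiate \<open>Ad_bracket\<close> in the group element at the identity, using the
  product rule on the right-hand side.\<close>

lemma jacobi: "br w (br u v) = br (br w u) v + br u (br w v)"
proof -
  interpret B: bounded_bilinear br using bilinear_bracket by (simp add: bilinear_conv_bounded_bilinear)
  have inc: "\<forall>\<^sub>F x in nhds e0. pt x \<in> fst c0"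
    by (rule eventually_chart_inv_in[OF c0 chart_openin[OF c0(1)] c0(2)])
  then have ev: "\<forall>\<^sub>F x in nhds e0. br (Ad (pt x) u) (Ad (pt x) v) = Ad (pt x) (br u v)"
    by eventually_elim (simp add: Ad_bracket chart_carrier[OF c0(1)])
  have 1: "((\<lambda>x. br (Ad (pt x) u) (Ad (pt x) v)) has_derivative (\<lambda>w. br (Ad (pt e0) u) (br w v) + br (br w u) (Ad (pt e0) v))) (at e0)"
    by (rule B.FDERIV[OF Ad_has_derivative Ad_has_derivative])
  have "((\<lambda>x. Ad (pt x) (br u v)) has_derivative (\<lambda>w. br (Ad (pt e0) u) (br w v) + br (br w u) (Ad (pt e0) v))) (at e0)"
    by (rule has_derivative_transform_eventually[OF 1])
      (use ev in \<open>auto dest: eventually_nhds_x_imp_x simp: eventually_at_filter elim: eventually_mono\<close>)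
  from fun_cong[OF has_derivative_unique[OF this Ad_has_derivative], of w] show ?thesis
    by (simp add: Ad_one add.commute)
qed

end

section \<open>Stratifications and the lower central filtration\<close>

lemma span_induct_Collect:
  assumes "x \<in> span S" "subspace (Collect P)" "\<And>x. x \<in> S \<Longrightarrow> P x"
  shows "x \<in> Collect P"
  using span_induct[OF assms] by simp

declare One_nat_def [simp del] plus_1_eq_Suc [simp]

locale stratified =
  fixes br :: "'e::euclidean_space \<Rightarrow> 'e \<Rightarrow> 'e" and V :: "nat \<Rightarrow> 'e set" and s :: nat
  assumes bilinear: "bilinear br" and strat: "stratification br V s"
begin

lemma lin: "linear (br x)" "linear (\<lambda>x. br x y)"
  using bilinear by (auto simp: bilinear_def)

lemma s_pos: "1 \<le> s"
  using strat by (simp add: stratification_def)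

text \<open>The layers beyond \<open>s\<close> (and layer \<open>0\<close>) of \<open>V\<close> are unconstrained; they are replaced by
  \<open>{0}\<close>.\<close>

definition layer :: "nat \<Rightarrow> 'e set" where
  "layer i = (if i \<in> {1..s} then V i else {0})"

text \<open>For \<open>k \<ge> 1\<close> and a Lie bracket this is the lower central series. In
  contrast to the layers it does not depend on the chosen stratification, so it can be compared
  across homomorphisms.\<close>

definition filt :: "nat \<Rightarrow> 'e set" where
  "filt k = span (\<Union>i\<in>{k..}. layer i)"

lemma subspace_layer: "subspace (layer i)"
  using strat by (auto simp: layer_def stratification_def)

lemma layer_1: "layer 1 = V 1"
  using s_pos by (simp add: layer_def)

lemma subspace_filt: "subspace (filt k)"
  by (simp add: filt_def)

lemma layer_subset_filt: "k \<le> i \<Longrightarrow> layer i \<subseteq> filt k"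
  unfolding filt_def by (intro subset_trans[OF _ span_superset]) auto

lemma filt_antimono: "k \<le> i \<Longrightarrow> filt i \<subseteq> filt k"
  unfolding filt_def by (intro span_mono UN_mono) auto

lemma filt_1: "filt 1 = UNIV"
proof -
  have "(\<Union>i\<in>{1..s}. V i) \<subseteq> (\<Union>i\<in>{1..}. layer i)" by (force simp: layer_def)
  then have "span (\<Union>i\<in>{1..s}. V i) \<subseteq> filt 1" unfolding filt_def by (rule span_mono)
  then show ?thesis using strat by (auto simp: stratification_def)
qed

lemma filt_beyond: "s < k \<Longrightarrow> filt k = {0}"
proof -
  assume "s < k"
  then have "(\<Union>i\<in>{k..}. layer i) \<subseteq> {0}" by (auto simp: layer_def)
  then have "filt k \<subseteq> span {0}" unfolding filt_def by (rule span_mono)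
  then show ?thesis using subspace_0[OF subspace_filt, of k] by auto
qed

lemma filt_decompose:
  assumes "x \<in> filt k"
  obtains a where "a \<in> layer k" "x - a \<in> filt (Suc k)"
proof -
  have "x \<in> {x. \<exists>a\<in>layer k. x - a \<in> filt (Suc k)}"
    using assms unfolding filt_def[of k]
  proof (rule span_induct_Collect)
    show "subspace {x. \<exists>a\<in>layer k. x - a \<in> filt (Suc k)}"
    proof (rule subspaceI; clarsimp)
      show "\<exists>a\<in>layer k. - a \<in> filt (Suc k)"
        using subspace_0[OF subspace_layer] subspace_0[OF subspace_filt] by (metis neg_0_equal_iff_equal)
      fix x y a b assume "a \<in> layer k" "x - a \<in> filt (Suc k)" "b \<in> layer k" "y - b \<in> filt (Suc k)"
      then show "\<exists>a\<in>layer k. x + y - a \<in> filt (Suc k)"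
        using subspace_add[OF subspace_layer, of a k b] subspace_add[OF subspace_filt, of "x - a" "Suc k" "y - b"]
        by (intro bexI[of _ "a + b"]) (auto simp: algebra_simps)
    next
      fix c x a assume "a \<in> layer k" "x - a \<in> filt (Suc k)"
      then show "\<exists>a\<in>layer k. c *\<^sub>R x - a \<in> filt (Suc k)"
        using subspace_scale[OF subspace_layer, of a k c] subspace_scale[OF subspace_filt, of "x - a" "Suc k" c]
        by (intro bexI[of _ "c *\<^sub>R a"]) (auto simp: scaleR_diff_right)
    qed
    fix x assume "x \<in> (\<Union>i\<in>{k..}. layer i)"
    then obtain i where i: "k \<le> i" "x \<in> layer i" by auto
    show "\<exists>a\<in>layer k. x - a \<in> filt (Suc k)"
    proof (cases "i = k")
      case True
      then show ?thesis using i subspace_0[OF subspace_filt] by (intro bexI[of _ x]) auto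
    next
      case False
      then show ?thesis using i layer_subset_filt[of "Suc k" i] subspace_0[OF subspace_layer]
        by (intro bexI[of _ 0]) auto
    qed
  qed
  with that show thesis by blast
qed

text \<open>With \<open>{0}\<close> in place of the layers beyond \<open>s\<close>, the rule holds
  without an upper bound on \<open>i\<close>.\<close>

lemma bracket_layer:
  assumes "x \<in> V 1" "y \<in> layer i" "1 \<le> i"
  shows "br x y \<in> layer (Suc i)"
proof (cases "i < s")
  case True
  then have "span {br x y | x y. x \<in> V 1 \<and> y \<in> V i} = V (Suc i)"
    using strat assms by (auto simp: stratification_def)
  moreover have "br x y \<in> span {br x y | x y. x \<in> V 1 \<and> y \<in> V i}"
    using assms True by (intro span_base) (auto simp: layer_def)
  ultimately show ?thesis using True by (simp add: layer_def)
next
  case False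
  then have "br x y = 0"
    using assms strat linear_0[OF lin(1)] by (cases "i = s") (auto simp: layer_def stratification_def)
  then show ?thesis using subspace_0[OF subspace_layer] by simp
qed

lemma layer_Suc:
  assumes "1 \<le> i"
  shows "layer (Suc i) \<subseteq> span {br x y | x y. x \<in> V 1 \<and> y \<in> layer i}"
proof (cases "i < s")
  case True
  then have "span {br x y | x y. x \<in> V 1 \<and> y \<in> V i} = V (Suc i)"
    using strat assms by (auto simp: stratification_def)
  then show ?thesis using True assms by (auto simp: layer_def)
next
  case False
  then show ?thesis by (auto simp: layer_def span_zero)
qed

lemma ad_power_layer:
  assumes "X \<in> V 1" "w \<in> V 1"
  shows "(br X ^^ j) w \<in> layer (Suc j)"
  by (induction j) (use assms layer_1 bracket_layer in \<open>auto simp flip: One_nat_def\<close>)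

lemma ad_power_eventually_zero:
  assumes "X \<in> V 1" "w \<in> V 1"
  shows "s \<le> j \<Longrightarrow> (br X ^^ j) w = 0"
  using ad_power_layer[OF assms, of j] by (auto simp: layer_def)

lemma linear_ad_power: "linear (br X ^^ j)"
  by (induction j) (auto simp: linear_ident id_def intro: linear_compose[OF _ lin(1), unfolded o_def])

lemma subspace_V1: "subspace (V 1)"
  using subspace_layer[of 1] layer_1 by simp

text \<open>Orthogonality is the form in which the analysis delivers the spanning property. Here it
  becomes an explicit sum, finite because \<open>ad_X^s\<close> vanishes on
  \<open>V 1\<close>.\<close>

lemma ad_spanning_sum:
  assumes X: "X \<in> V 1" and span: "\<And>a. (\<And>j w. w \<in> V 1 \<Longrightarrow> a \<bullet> (br X ^^ j) w = 0) \<Longrightarrow> a = 0"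
  obtains v where "\<And>j. v j \<in> V 1" "x = (\<Sum>j<s. (br X ^^ j) (v j))"
proof -
  let ?S = "{\<Sum>j<s. (br X ^^ j) (v j) | v. \<forall>j. v j \<in> V 1}"
  note V1 = subspace_V1
  have sub: "subspace ?S"
  proof (rule subspaceI)
    show "0 \<in> ?S" using subspace_0[OF V1] linear_0[OF linear_ad_power]
      by (intro CollectI exI[of _ "\<lambda>_. 0"]) auto
    fix x y assume "x \<in> ?S" "y \<in> ?S"
    then obtain v w where v: "\<forall>j. v j \<in> V 1" "x = (\<Sum>j<s. (br X ^^ j) (v j))"
      and w: "\<forall>j. w j \<in> V 1" "y = (\<Sum>j<s. (br X ^^ j) (w j))" by blast
    then show "x + y \<in> ?S"
      by (intro CollectI exI[of _ "\<lambda>j. v j + w j"]) (auto simp: linear_add[OF linear_ad_power] sum.distrib subspace_add[OF V1])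
  next
    fix c x assume "x \<in> ?S"
    then obtain v where v: "\<forall>j. v j \<in> V 1" "x = (\<Sum>j<s. (br X ^^ j) (v j))" by blast
    then show "c *\<^sub>R x \<in> ?S"
      by (intro CollectI exI[of _ "\<lambda>j. c *\<^sub>R v j"]) (auto simp: linear_scale[OF linear_ad_power] scaleR_sum_right subspace_scale[OF V1])
  qed
  have gen: "(br X ^^ j) w \<in> ?S" if w: "w \<in> V 1" for j w
  proof (cases "j < s")
    case True
    have "(\<Sum>i<s. (br X ^^ i) (if i = j then w else 0)) = (\<Sum>i<s. if i = j then (br X ^^ j) w else 0)"
      by (rule sum.cong) (auto simp: linear_0[OF linear_ad_power])
    also have "\<dots> = (br X ^^ j) w" using True by simp
    finally show ?thesis using w subspace_0[OF V1]
      by (intro CollectI exI[of _ "\<lambda>i. if i = j then w else 0"]) auto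
  next
    case False
    then show ?thesis using ad_power_eventually_zero[OF X w] subspace_0[OF sub] by simp
  qed
  have "?S = UNIV"
  proof (rule ccontr)
    assume "?S \<noteq> UNIV"
    then have "span ?S \<noteq> UNIV" using sub by (metis (no_types, lifting) span_eq_iff)
    from span_not_UNIV_orthogonal[OF this]
    obtain a where a: "a \<noteq> 0" "\<forall>x\<in>span ?S. a \<bullet> x = 0" by blast
    have "a = 0" by (rule span, rule a(2)[rule_format], rule span_base, rule gen)
    with a(1) show False ..
  qed
  then have "x \<in> ?S" by (simp only: UNIV_I)
  then obtain v where "\<forall>j. v j \<in> V 1" "x = (\<Sum>j<s. (br X ^^ j) (v j))" by blast
  then show thesis by (intro that) auto
qed

text \<open>Expand \<open>w\<close> by \<open>ad_spanning_sum\<close>. The term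
  \<open>ad_X^j (v j)\<close> lies in layer \<open>j + 1\<close>, so directness of the layers leaves
  only the term with \<open>j = k\<close>, which is a bracket with \<open>X\<close>.\<close>

lemma ad_surj_on_layers:
  assumes X: "X \<in> V 1" and span: "\<And>a. (\<And>j w. w \<in> V 1 \<Longrightarrow> a \<bullet> (br X ^^ j) w = 0) \<Longrightarrow> a = 0"
    and w: "w \<in> layer (Suc k)" and k: "1 \<le> k"
  obtains u where "u \<in> layer k" "w = br X u"
proof (cases "Suc k \<le> s")
  case True
  obtain v where v: "\<And>j. v j \<in> V 1" "w = (\<Sum>j<s. (br X ^^ j) (v j))"
    using ad_spanning_sum[OF X span] by blast
  \<comment> \<open>The layer-\<open>i\<close> component of the expansion minus that of
    \<open>w\<close>. These add up to zero, so each of them vanishes.\<close>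
  define x where "x i = (br X ^^ (i - 1)) (v (i - 1)) - (if i = Suc k then w else 0)" for i
  have "x i \<in> V i" if i: "i \<in> {1..s}" for i
  proof -
    have "(br X ^^ (i - 1)) (v (i - 1)) \<in> layer i"
      using ad_power_layer[OF X v(1), of "i - 1" "i - 1"] i by simp
    moreover have "(if i = Suc k then w else 0) \<in> layer i" using w subspace_0[OF subspace_layer] by simp
    ultimately have "x i \<in> layer i" unfolding x_def by (rule subspace_diff[OF subspace_layer])
    then show ?thesis using i by (simp add: layer_def)
  qed
  moreover have "(\<Sum>i=1..s. x i) = 0"
  proof -
    have "(\<Sum>i=1..s. (br X ^^ (i - 1)) (v (i - 1))) = (\<Sum>j<s. (br X ^^ j) (v j))"
      by (rule sum.reindex_bij_witness[of _ Suc "\<lambda>i. i - 1"]) auto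
    moreover have "(\<Sum>i=1..s. if i = Suc k then w else 0) = w" using True by (subst sum.delta) auto
    ultimately show ?thesis unfolding x_def by (simp add: sum_subtractf v(2)[symmetric])
  qed
  moreover have "\<forall>x. (\<forall>i\<in>{1..s}. x i \<in> V i) \<and> (\<Sum>i=1..s. x i) = 0 \<longrightarrow> (\<forall>i\<in>{1..s}. x i = 0)"
    using strat unfolding stratification_def by (elim conjE) assumption
  ultimately have "\<forall>i\<in>{1..s}. x i = 0" by blast
  then have "x (Suc k) = 0" using True by simp
  then have "w = br X ((br X ^^ (k - 1)) (v k))" using k by (cases k) (auto simp: x_def)
  moreover have "(br X ^^ (k - 1)) (v k) \<in> layer k" using ad_power_layer[OF X v(1), of "k - 1" k] k by simp
  ultimately show thesis using that by blast
next
  case False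
  then have "w = 0" using w by (auto simp: layer_def)
  then show thesis using that[of 0] subspace_0[OF subspace_layer] linear_0[OF lin(1)] by simp
qed

lemma bracket_filt_1:
  assumes x: "x \<in> V 1" and z: "z \<in> filt m" and m: "1 \<le> m"
  shows "br x z \<in> filt (Suc m)"
proof -
  have "z \<in> {y. br x y \<in> filt (Suc m)}"
    using z unfolding filt_def[of m]
  proof (rule span_induct_Collect)
    show "subspace {y. br x y \<in> filt (Suc m)}"
      using linear_subspace_vimage[OF lin(1) subspace_filt] by (simp add: vimage_def)
    fix y assume "y \<in> (\<Union>i\<in>{m..}. layer i)"
    then obtain i where i: "m \<le> i" "y \<in> layer i" by auto
    then have "br x y \<in> layer (Suc i)" using bracket_layer[OF x] m by simp
    then show "br x y \<in> filt (Suc m)" using layer_subset_filt[of "Suc m" "Suc i"] i by auto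
  qed
  then show ?thesis by simp
qed

end

locale stratified_lie = stratified +
  assumes antisym: "br x y = - br y x"
    and jacobi: "br x (br y z) = br (br x y) z + br y (br x z)"
begin

text \<open>Layer \<open>i + 1\<close> is generated by brackets \<open>[a, b]\<close> with
  \<open>a\<close> in \<open>V 1\<close> and \<open>b\<close> in layer \<open>i\<close>; the Jacobi
  identity turns \<open>[[a, b], y]\<close> into \<open>[a, [b, y]] - [b, [a, y]]\<close>. The
  second term needs the induction hypothesis at \<open>j + 1\<close>, hence the generalisation over
  \<open>j\<close>.\<close>

lemma bracket_layer_filt:
  assumes "x \<in> layer i" "y \<in> filt j" "1 \<le> i" "1 \<le> j"
  shows "br x y \<in> filt (i + j)"
  using assms(3,1,2,4)
proof (induction i arbitrary: x y j rule: dec_induct)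
  case base
  then show ?case using bracket_filt_1 layer_1 by simp
next
  case (step i)
  have "x \<in> {x. br x y \<in> filt (Suc i + j)}"
    using subsetD[OF layer_Suc[OF step.hyps(1)] step.prems(1)]
  proof (rule span_induct_Collect)
    show "subspace {x. br x y \<in> filt (Suc i + j)}"
      using linear_subspace_vimage[OF lin(2) subspace_filt] by (simp add: vimage_def)
    fix x assume "x \<in> {br x y | x y. x \<in> V 1 \<and> y \<in> layer i}"
    then obtain a b where ab: "a \<in> layer 1" "b \<in> layer i" "x = br a b" using layer_1 by auto
    have a: "a \<in> V 1" using ab(1) layer_1 by simp
    have "br a (br b y) \<in> filt (Suc (i + j))"
      using step.IH[OF ab(2) step.prems(2,3)] step.prems by (intro bracket_filt_1[OF a]) auto
    moreover have "br b (br a y) \<in> filt (i + Suc j)"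
      using bracket_filt_1[OF a step.prems(2,3)] by (intro step.IH ab) auto
    moreover have "br (br a b) y = br a (br b y) - br b (br a y)" using jacobi[of a b y] by simp
    ultimately show "br x y \<in> filt (Suc i + j)" using subspace_diff[OF subspace_filt] ab(3) by simp
  qed
  then show ?case by simp
qed

lemma bracket_filt:
  assumes "x \<in> filt i" "y \<in> filt j" "1 \<le> i" "1 \<le> j"
  shows "br x y \<in> filt (i + j)"
proof -
  have "x \<in> {x. br x y \<in> filt (i + j)}"
    using assms(1) unfolding filt_def[of i]
  proof (rule span_induct_Collect)
    show "subspace {x. br x y \<in> filt (i + j)}"
      using linear_subspace_vimage[OF lin(2) subspace_filt] by (simp add: vimage_def)
    fix x assume "x \<in> (\<Union>i\<in>{i..}. layer i)"
    then obtain m where m: "i \<le> m" "x \<in> layer m" by auto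
    then have "br x y \<in> filt (m + j)" using bracket_layer_filt assms by auto
    then show "br x y \<in> filt (i + j)" using filt_antimono[of "i + j" "m + j"] m by auto
  qed
  then show ?thesis by simp
qed

end

text \<open>The image of the first layer need not lie in \<open>W 1\<close>: both gradings are compared through
  the lower central filtration only, and \<open>Y\<close> is the \<open>W 1\<close>-component of the image of \<open>X\<close>.\<close>

lemma ad_spanning_quotient:
  fixes T :: "'e::euclidean_space \<Rightarrow> 'f::euclidean_space"
  assumes "stratified br V s" "stratified_lie bq W r"
    and T: "linear T" "surj T" "\<And>x y. T (br x y) = bq (T x) (T y)"
    and X: "X \<in> V 1" and span: "\<And>a. (\<And>j w. w \<in> V 1 \<Longrightarrow> a \<bullet> (br X ^^ j) w = 0) \<Longrightarrow> a = 0"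
  obtains Y where "Y \<in> W 1" "Y \<noteq> 0" "\<And>a. (\<And>j w. w \<in> W 1 \<Longrightarrow> a \<bullet> (bq Y ^^ j) w = 0) \<Longrightarrow> a = 0"
proof -
  interpret V: stratified br V s by fact
  interpret W: stratified_lie bq W r by fact
  note Wadd = subspace_add[OF W.subspace_filt] and Wsub = W.filt_antimono[THEN subsetD]
  have bq_add: "bq (x + y) z = bq x z + bq y z" "bq z (x + y) = bq z x + bq z y" for x y z
    using linear_add[OF W.lin(2)] linear_add[OF W.lin(1)] by auto
  \<comment> \<open>Every element of layer \<open>k + 1\<close> is a bracket with \<open>X\<close>,
    so its image is a bracket of \<open>T X\<close>, which lies in \<open>filt 1\<close>, with an
    element of \<open>filt k\<close>.\<close>
  have TV: "T v \<in> W.filt k" if "v \<in> V.layer k" "1 \<le> k" for v k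
    using that(2,1)
  proof (induction k arbitrary: v rule: dec_induct)
    case base show ?case using W.filt_1 by simp
  next
    case (step k)
    obtain u where u: "u \<in> V.layer k" "v = br X u"
      by (rule V.ad_surj_on_layers[OF X span step.prems step.hyps(1)])
    have "bq (T X) (T u) \<in> W.filt (1 + k)"
      by (rule W.bracket_filt) (use step.IH[OF u(1)] step.hyps W.filt_1 in auto)
    then show ?case using u T(3) by simp
  qed
  \<comment> \<open>\<open>T\<close> is onto, and in the expansion of a preimage the terms with
    \<open>j \<ge> 1\<close> are mapped into \<open>filt 2\<close>.\<close>
  have WT1: "\<exists>v\<in>V.layer 1. w - T v \<in> W.filt (Suc 1)" for w
  proof -
    obtain x where x: "w = T x" using T(2) by (metis surjD)
    obtain v where v: "\<And>j. v j \<in> V 1" "x = (\<Sum>j<s. (br X ^^ j) (v j))"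
      using V.ad_spanning_sum[OF X span] by blast
    have "{..<s} = insert 0 {1..<s}" using V.s_pos by auto
    then have "x = v 0 + (\<Sum>j=1..<s. (br X ^^ j) (v j))" using v(2) by simp
    then have "w - T (v 0) = (\<Sum>j=1..<s. T ((br X ^^ j) (v j)))"
      using x by (simp add: linear_add[OF T(1)] linear_sum[OF T(1)])
    also have "\<dots> \<in> W.filt (Suc 1)"
    proof (rule subspace_sum[OF W.subspace_filt])
      fix j assume j: "j \<in> {1..<s}"
      have "T ((br X ^^ j) (v j)) \<in> W.filt (Suc j)" by (rule TV[OF V.ad_power_layer[OF X v(1)]]) simp
      then show "T ((br X ^^ j) (v j)) \<in> W.filt (Suc 1)" by (rule Wsub[rotated]) (use j in simp)
    qed
    finally show ?thesis using v(1)[of 0] V.layer_1 by auto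
  qed
  \<comment> \<open>\<open>T\<close> induces surjections of the graded quotients, from layer
    \<open>k\<close> of \<open>V\<close> onto layer \<open>k\<close> of \<open>W\<close> modulo the
    next filtration step.\<close>
  have WT: "\<exists>v\<in>V.layer k. w - T v \<in> W.filt (Suc k)" if "w \<in> W.layer k" "1 \<le> k" for w k
    using that(2,1)
  proof (induction k arbitrary: w rule: dec_induct)
    case base
    show ?case by (rule WT1)
  next
    case (step k)
    let ?S = "{w. \<exists>v\<in>V.layer (Suc k). w - T v \<in> W.filt (Suc (Suc k))}"
    have "w \<in> ?S"
      using subsetD[OF W.layer_Suc[OF step.hyps(1)] step.prems]
    proof (rule span_induct_Collect)
      show "subspace ?S"
      proof (rule subspaceI)
        show "0 \<in> ?S" using subspace_0[OF V.subspace_layer] subspace_0[OF W.subspace_filt] linear_0[OF T(1)]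
          by (intro CollectI bexI[of _ 0]) auto
        fix x y assume "x \<in> ?S" "y \<in> ?S"
        then obtain a b where "a \<in> V.layer (Suc k)" "x - T a \<in> W.filt (Suc (Suc k))"
          "b \<in> V.layer (Suc k)" "y - T b \<in> W.filt (Suc (Suc k))" by blast
        then show "x + y \<in> ?S"
          using subspace_add[OF V.subspace_layer, of a "Suc k" b] Wadd[of "x - T a" "Suc (Suc k)" "y - T b"]
          by (intro CollectI bexI[of _ "a + b"]) (auto simp: linear_add[OF T(1)] algebra_simps)
      next
        fix c x assume "x \<in> ?S"
        then obtain a where "a \<in> V.layer (Suc k)" "x - T a \<in> W.filt (Suc (Suc k))" by blast
        then show "c *\<^sub>R x \<in> ?S"
          using subspace_scale[OF V.subspace_layer, of a "Suc k" c] subspace_scale[OF W.subspace_filt, of "x - T a" "Suc (Suc k)" c]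
          by (intro CollectI bexI[of _ "c *\<^sub>R a"]) (auto simp: linear_scale[OF T(1)] scaleR_diff_right)
      qed
      fix w assume "w \<in> {bq x y | x y. x \<in> W 1 \<and> y \<in> W.layer k}"
      then obtain x y where w: "w = bq x y" "x \<in> W.layer 1" "y \<in> W.layer k" using W.layer_1 by auto
      obtain a where a: "a \<in> V.layer 1" "x - T a \<in> W.filt (Suc 1)" using WT1 by blast
      obtain b where b: "b \<in> V.layer k" "y - T b \<in> W.filt (Suc k)" using step.IH[OF w(3)] by blast
      have "br a b \<in> V.layer (Suc k)" using V.bracket_layer[of a b k] a b step.hyps V.layer_1 by auto
      moreover have "bq x y - T (br a b) \<in> W.filt (Suc (Suc k))"
      proof -
        \<comment> \<open>\<open>[x, y]\<close> expanded around \<open>[T a, T b]\<close>: each of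
          the three remainders has a factor that is one step deeper in the filtration than
          expected.\<close>
        have eq: "bq x y - T (br a b) = bq (T a) (y - T b) + bq (x - T a) (T b) + bq (x - T a) (y - T b)"
          using bq_add(1)[of "T a" "x - T a" y] bq_add(2)[of "T a" "T b" "y - T b"] bq_add(2)[of "x - T a" "T b" "y - T b"] T(3)
          by simp
        have "bq (T a) (y - T b) \<in> W.filt (1 + Suc k)" by (rule W.bracket_filt) (use W.filt_1 b in auto)
        moreover have "bq (x - T a) (T b) \<in> W.filt (Suc 1 + k)" by (rule W.bracket_filt) (use a TV[OF b(1)] step.hyps in auto)
        moreover have "bq (x - T a) (y - T b) \<in> W.filt (Suc 1 + Suc k)" by (rule W.bracket_filt) (use a b in auto)
        then have "bq (x - T a) (y - T b) \<in> W.filt (Suc (Suc k))" by (rule Wsub[rotated]) simp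
        ultimately show ?thesis unfolding eq by (intro Wadd) auto
      qed
      ultimately show "\<exists>v\<in>V.layer (Suc k). w - T v \<in> W.filt (Suc (Suc k))" unfolding w(1) by blast
    qed
    then show ?case by simp
  qed
  obtain Y where Y: "Y \<in> W.layer 1" "T X - Y \<in> W.filt (Suc 1)"
    using W.filt_decompose[of "T X" 1] W.filt_1 by auto
  have YW: "Y \<in> W 1" using Y W.layer_1 by simp
  let ?S = "span {(bq Y ^^ j) w | j w. w \<in> W 1}"
  have adS: "bq Y x \<in> ?S" if "x \<in> ?S" for x
    using that
  proof (rule span_induct[where P="\<lambda>x. bq Y x \<in> ?S"])
    show "subspace {x. bq Y x \<in> ?S}"
      using linear_subspace_vimage[OF W.lin(1) subspace_span] by (simp add: vimage_def)
    fix x assume "x \<in> {(bq Y ^^ j) w | j w. w \<in> W 1}"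
    then obtain j w where jw: "x = (bq Y ^^ j) w" "w \<in> W 1" by blast
    then have "bq Y x = (bq Y ^^ Suc j) w" by simp
    then show "bq Y x \<in> ?S" using jw(2) by (intro span_base) blast
  qed
  \<comment> \<open>Lift \<open>w\<close> to \<open>[X, u]\<close> with \<open>u\<close> in layer
    \<open>k\<close>. Replacing \<open>T X\<close> by \<open>Y\<close> and \<open>T u\<close> by an
    element \<open>a\<close> of \<open>?S\<close> changes the bracket only in
    \<open>filt (k + 2)\<close>, and \<open>?S\<close> is stable under \<open>ad_Y\<close>.\<close>
  have layerS: "\<exists>a\<in>?S. w - a \<in> W.filt (Suc k)" if "w \<in> W.layer k" "1 \<le> k" for w k
    using that(2,1)
  proof (induction k arbitrary: w rule: dec_induct)
    case base
    then have "w \<in> W 1" using W.layer_1 by simp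
    then have "(bq Y ^^ 0) w \<in> ?S" by (intro span_base) blast
    then show ?case using subspace_0[OF W.subspace_filt] by (intro bexI[of _ w]) auto
  next
    case (step k)
    obtain v where v: "v \<in> V.layer (Suc k)" "w - T v \<in> W.filt (Suc (Suc k))"
      using WT[OF step.prems] by auto
    obtain u where u: "u \<in> V.layer k" "v = br X u"
      by (rule V.ad_surj_on_layers[OF X span v(1) step.hyps(1)])
    have Tu: "T u \<in> W.filt k" using TV[OF u(1)] step.hyps by simp
    obtain p where p: "p \<in> W.layer k" "T u - p \<in> W.filt (Suc k)" using W.filt_decompose[OF Tu] by blast
    obtain a where a: "a \<in> ?S" "p - a \<in> W.filt (Suc k)" using step.IH[OF p(1)] by blast
    have ua: "T u - a \<in> W.filt (Suc k)" using Wadd[OF p(2) a(2)] by simp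
    have 1: "bq (T X - Y) (T u) \<in> W.filt (Suc 1 + k)" by (rule W.bracket_filt) (use Y Tu step.hyps in auto)
    have 2: "bq Y (T u - a) \<in> W.filt (1 + Suc k)" by (rule W.bracket_filt) (use W.filt_1 ua in auto)
    have "w - bq Y a = (w - T v) + bq (T X - Y) (T u) + bq Y (T u - a)"
      using bq_add(1)[of Y "T X - Y" "T u"] bq_add(2)[of Y a "T u - a"] T(3)[of X u] u(2) by simp
    also have "\<dots> \<in> W.filt (Suc (Suc k))" using 1 2 v(2) by (intro Wadd) auto
    finally show ?case using adS[OF a(1)] by blast
  qed
  \<comment> \<open>Successive approximation by \<open>?S\<close>, one layer at a time; it becomes
    exact at \<open>filt (r + 1) = {0}\<close>.\<close>
  have filtS: "\<exists>a\<in>?S. x - a \<in> W.filt (Suc n)" for x n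
  proof (induction n)
    case 0
    show ?case using W.filt_1 span_zero by (intro bexI[of _ 0]) (auto simp flip: One_nat_def)
  next
    case (Suc n)
    then obtain a where a: "a \<in> ?S" "x - a \<in> W.filt (Suc n)" by blast
    obtain p where p: "p \<in> W.layer (Suc n)" "x - a - p \<in> W.filt (Suc (Suc n))" using W.filt_decompose[OF a(2)] by blast
    obtain b where b: "b \<in> ?S" "p - b \<in> W.filt (Suc (Suc n))" using layerS[OF p(1)] by auto
    have "x - (a + b) \<in> W.filt (Suc (Suc n))" using Wadd[OF p(2) b(2)] by (simp add: algebra_simps)
    then show ?case using span_add[OF a(1) b(1)] by blast
  qed
  have S: "x \<in> ?S" for x
    using filtS[of x r] W.filt_beyond[of "Suc r"] by auto
  have orth: "a = 0" if a: "\<And>j w. w \<in> W 1 \<Longrightarrow> a \<bullet> (bq Y ^^ j) w = 0" for a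
  proof -
    have "a \<bullet> a = 0" using S[of a]
    proof (rule span_induct[where P="\<lambda>x. a \<bullet> x = 0"])
      show "subspace {x. a \<bullet> x = 0}" by (rule subspace_hyperplane)
    qed (use a in auto)
    then show ?thesis by simp
  qed
  show thesis
  proof (cases "Y = 0")
    case False
    then show thesis using that[OF YW] orth by blast
  next
    case True
    have zero: "bq 0 w = 0" for w using linear_0[OF W.lin(2)] .
    \<comment> \<open>For \<open>Y = 0\<close> all powers with \<open>j \<ge> 1\<close> vanish on
      \<open>W 1\<close>, so the spanning set lies in \<open>W 1\<close>, which is then the whole
      algebra. Any non-zero vector will do, since the power \<open>j = 0\<close> alone
      spans.\<close>
    have W1: "x \<in> W 1" for x
    proof -
      have "?S \<subseteq> W 1"
      proof (rule span_minimal[OF _ W.subspace_V1], clarify)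
        fix j w assume "w \<in> W 1"
        then show "(bq Y ^^ j) w \<in> W 1"
          using subspace_0[OF W.subspace_V1] by (cases j) (auto simp: True zero)
      qed
      then show ?thesis using S by blast
    qed
    obtain y :: 'f where y: "y \<in> Basis" using nonempty_Basis by blast
    show thesis
    proof (rule that[of y])
      show "y \<noteq> 0" using y by (rule nonzero_Basis)
      fix a assume "\<And>j w. w \<in> W 1 \<Longrightarrow> a \<bullet> (bq y ^^ j) w = 0"
      from this[of a 0] W1 show "a = 0" by simp
    qed (rule W1)
  qed
qed

section \<open>Passage to the quotient group\<close>

theorem proposition5p14:
  fixes G :: "('a, 'z) monoid_scheme"
    and M :: "('a, 'e::euclidean_space) manifold"
    and V :: "nat \<Rightarrow> 'e set"
    and s :: nat
    and N :: "'a set"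
    and Q :: "('a set, 'f::euclidean_space) manifold"
    and W :: "nat \<Rightarrow> 'f set"
    and r :: nat
  assumes "carnot_group G M V s"
    and "\<exists>X. nonabnormal_direction G M (V 1) X"
    and "N \<lhd> G"
    and "quotient_lie_group G M N Q"
    and "carnot_group (G Mod N) Q W r"
  shows "\<exists>Y. nonabnormal_direction (G Mod N) Q (W 1) Y"
proof -
  interpret N: normal N G by fact
  let ?f = "\<lambda>x. N #>\<^bsub>G\<^esub> x"
  have sub: "smooth_submersion M Q ?f" using assms(4) by (simp add: quotient_lie_group_def)
  interpret G: lie_gp G M using assms(1) by (intro lie_group_imp_lie_gp) (simp add: carnot_group_def)
  interpret H: lie_gp "G Mod N" Q using assms(5) by (intro lie_group_imp_lie_gp) (simp add: carnot_group_def)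
  interpret T: lie_gp_hom G M "G Mod N" Q ?f
    by unfold_locales (use sub N.r_coset_hom_Mod in \<open>auto simp: smooth_submersion_def intro: smooth_map_imp_mdiff\<close>)
  \<comment> \<open>The submersion property at the identity, read in the two chosen identity
    charts.\<close>
  have surj: "surj T.df"
    using sub G.c0 H.c0 T.f_one unfolding smooth_submersion_def by auto
  interpret V: stratified "lie_bracket G M" V s
    by unfold_locales (use assms(1) G.bilinear_bracket in \<open>auto simp: carnot_group_def\<close>)
  interpret W: stratified_lie "lie_bracket (G Mod N) Q" W r
  proof unfold_locales
    show "bilinear (lie_bracket (G Mod N) Q)" by (rule H.bilinear_bracket)
    show "stratification (lie_bracket (G Mod N) Q) W r" using assms(5) by (simp add: carnot_group_def)
    show "lie_bracket (G Mod N) Q x y = - lie_bracket (G Mod N) Q y x" for x y by (rule H.bracket_antisym)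
    show "lie_bracket (G Mod N) Q x (lie_bracket (G Mod N) Q y z) = lie_bracket (G Mod N) Q (lie_bracket (G Mod N) Q x y) z +
        lie_bracket (G Mod N) Q y (lie_bracket (G Mod N) Q x z)" for x y z by (rule H.jacobi)
  qed
  obtain X where X: "nonabnormal_direction G M (V 1) X" using assms(2) by blast
  then have XV: "X \<in> V 1" and ev: "G.end_var X ` linf (V 1) = UNIV"
    by (auto simp: G.nonabnormal_direction_iff[OF V.subspace_V1])
  \<comment> \<open>The nilpotency that \<open>end_var_surj_imp_ad_spanning\<close> asks for comes
    from the grading, by which \<open>ad_X^j\<close> vanishes on \<open>V 1\<close> for
    \<open>j \<ge> s\<close>.\<close>
  have span: "a = 0" if "\<And>j w. w \<in> V 1 \<Longrightarrow> a \<bullet> (lie_bracket G M X ^^ j) w = 0" for a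
    by (rule G.end_var_surj_imp_ad_spanning[OF ev _ that]) (use V.ad_power_eventually_zero[OF XV] in blast)+
  show ?thesis
  proof (rule ad_spanning_quotient[where T=T.df and X=X and br="lie_bracket G M" and bq="lie_bracket (G Mod N) Q" and V=V and W=W and s=s and r=r, OF V.stratified_axioms W.stratified_lie_axioms T.df_linear surj T.df_bracket XV])
    show "a = 0" if "\<And>j w. w \<in> V 1 \<Longrightarrow> a \<bullet> (lie_bracket G M X ^^ j) w = 0" for a
      by (rule span[OF that])
  next
    fix Y assume Y: "Y \<in> W 1" "Y \<noteq> 0"
      and spanY: "\<And>a. (\<And>j w. w \<in> W 1 \<Longrightarrow> a \<bullet> (lie_bracket (G Mod N) Q Y ^^ j) w = 0) \<Longrightarrow> a = 0"
    have "H.end_var Y ` linf (W 1) = UNIV"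
      by (rule H.ad_spanning_imp_end_var_surj[OF W.subspace_V1 spanY])
    with Y show ?thesis by (auto simp: H.nonabnormal_direction_iff[OF W.subspace_V1])
  qed
qed

end
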